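(* Let $\Omega\subset\mathbb{C}^d$ be an irreducible bounded symmetric domain, let $\mu>0$ be a real number, and let $(M_\Omega(\mu),g(\mu))$ be the associated Cartan--Hartogs domain. Then the Kähler metric $g(\mu)$ is extremal if and only if it is Kähler--Einstein.
   Context: Let $\Omega\subset\mathbb{C}^d$ be an irreducible bounded symmetric domain of genus $\gamma$, with total Euclidean volume $V(\Omega)$ and Bergman kernel $K(z,z)$. Its generic norm is $N(z,z)=(V(\Omega)K(z,z))^{-1/\gamma}$; write $N^\mu=N(z,z)^\mu$. For $\mu>0$ the Cartan--Hartogs domain based on $\Omega$ is $$M_\Omega(\mu)=\{(z,w)\in\Omega\times\mathbb{C}:\ |w|^2<N^\mu(z,z)\}\subset\mathbb{C}^{d+1},$$ endowed with the Kähler metric $g(\mu)$ with global Kähler potential $\Phi(z,w)=-\log(N^\mu-|w|^2)$, that is, with $z_{d+1}=w$, $$g(\mu)_{\alpha\bar\beta}=-\frac{\partial^2\log(N^\mu-|w|^2)}{\partial z_\alpha\,\partial\bar z_\beta},\qquad \alpha,\beta=1,\dots,d+1.$$ For a Kähler metric $g$ on an $n$-dimensional complex manifold, in local holomorphic coordinates let $(g^{\alpha\bar\beta})$ be the inverse of the metric, normalized by $\sum_\beta g^{\alpha\bar\beta}g_{\tau\bar\beta}=\delta_{\alpha\tau}$. The Ricci tensor is $\mathrm{Ric}_{\alpha\bar\beta}=-\partial^2\log\det(g)/\partial z_\alpha\partial\bar z_\beta$ and the scalar curvature is $\kappa_g=\sum_{\alpha,\beta}g^{\alpha\bar\beta}\mathrm{Ric}_{\alpha\bar\beta}$.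 The metric $g$ is Kähler--Einstein if $\mathrm{Ric}=\lambda g$ for some real constant $\lambda$. The metric $g$ (not necessarily on a compact manifold) is called extremal (in the sense of Calabi) if the $(1,0)$-part of the Hamiltonian vector field associated to $\kappa_g$ is holomorphic, i.e. in local coordinates $$\frac{\partial}{\partial\bar z_\eta}\left(\sum_{\beta=1}^{n}g^{\alpha\bar\beta}\frac{\partial\kappa_g}{\partial\bar z_\beta}\right)=0\qquad\text{for all }\alpha,\eta=1,\dots,n.$$ *)

theory Defs
  imports "HOL-Analysis.Analysis"
begin

section \<open>Several complex variables\<close>

definition wirtinger :: "'n::finite \<Rightarrow> (complex^'n \<Rightarrow> complex) \<Rightarrow> complex^'n \<Rightarrow> complex" where
  "wirtinger j f p =
     (frechet_derivative f (at p) (axis j 1) - \<i> * frechet_derivative f (at p) (axis j \<i>)) / 2"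

definition wirtinger_bar :: "'n::finite \<Rightarrow> (complex^'n \<Rightarrow> complex) \<Rightarrow> complex^'n \<Rightarrow> complex" where
  "wirtinger_bar j f p =
     (frechet_derivative f (at p) (axis j 1) + \<i> * frechet_derivative f (at p) (axis j \<i>)) / 2"

definition holomorphic_fun :: "(complex^'n::finite) set \<Rightarrow> (complex^'n \<Rightarrow> complex) \<Rightarrow> bool" where
  "holomorphic_fun S f \<longleftrightarrow>
     (\<forall>p\<in>S. \<exists>f'. (f has_derivative f') (at p) \<and> (\<forall>c v. f' (c *s v) = c * f' v))"

definition holomorphic_map ::
    "(complex^'n::finite) set \<Rightarrow> (complex^'n \<Rightarrow> complex^'m::finite) \<Rightarrow> bool" where
  "holomorphic_map S F \<longleftrightarrow> (\<forall>i. holomorphic_fun S (\<lambda>p. F p $ i))"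

definition biholomorphic :: "(complex^'n::finite) set \<Rightarrow> (complex^'m::finite) set \<Rightarrow> bool" where
  "biholomorphic A B \<longleftrightarrow>
     (\<exists>F G. holomorphic_map A F \<and> holomorphic_map B G \<and> F ` A = B \<and> G ` B = A \<and>
        (\<forall>z\<in>A. G (F z) = z) \<and> (\<forall>z\<in>B. F (G z) = z))"


section \<open>Bounded symmetric domains\<close>

definition bounded_domain :: "(complex^'n::finite) set \<Rightarrow> bool" where
  "bounded_domain D \<longleftrightarrow> D \<noteq> {} \<and> open D \<and> connected D \<and> bounded D"

definition bounded_symmetric_domain :: "(complex^'n::finite) set \<Rightarrow> bool" where
  "bounded_symmetric_domain D \<longleftrightarrow> bounded_domain D \<and>
     (\<forall>p\<in>D. \<exists>s. holomorphic_map D s \<and> s ` D \<subseteq> D \<and> (\<forall>z\<in>D. s (s z) = z) \<and> s p = p \<and>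
        (\<exists>e>0. \<forall>z\<in>D \<inter> ball p e. s z = z \<longrightarrow> z = p))"

text \<open>The coordinates with index in \<open>I\<close> and those with index outside \<open>I\<close> vary independently,
  i.e. \<open>D\<close> is the product of its two projections.\<close>

definition product_along :: "'n::finite set \<Rightarrow> (complex^'n) set \<Rightarrow> bool" where
  "product_along I D \<longleftrightarrow> (\<forall>x\<in>D. \<forall>y\<in>D. (\<chi> i. if i \<in> I then x $ i else y $ i) \<in> D)"

text \<open>Irreducible: not biholomorphic to a product of two bounded domains of positive dimension.
  As dimensions are types, the product is written inside \<open>complex^'n\<close> with the coordinates
  distributed over \<open>I\<close> and its complement.  A product \<open>D\<close> that is biholomorphic to a symmetric
  domain has symmetric factors, so nothing changes if the factors are required to be symmetric.\<close>

definition irreducible_bounded_symmetric_domain :: "(complex^'n::finite) set \<Rightarrow> bool" where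
  "irreducible_bounded_symmetric_domain \<Omega> \<longleftrightarrow> bounded_symmetric_domain \<Omega> \<and>
     \<not> (\<exists>(D :: (complex^'n) set) I. bounded_domain D \<and> biholomorphic \<Omega> D \<and>
          I \<noteq> {} \<and> I \<noteq> UNIV \<and> product_along I D)"


section \<open>The Bergman kernel\<close>

definition bergman_space :: "(complex^'n::finite) set \<Rightarrow> (complex^'n \<Rightarrow> complex) set" where
  "bergman_space D = {f. holomorphic_fun D f \<and> set_integrable lborel D (\<lambda>z. (cmod (f z))\<^sup>2)}"

text \<open>The reproducing kernel of the Bergman space; the representing function of evaluation at
  \<open>w \<in> D\<close> is unique on \<open>D\<close>.\<close>

definition bergman_kernel :: "(complex^'n::finite) set \<Rightarrow> complex^'n \<Rightarrow> complex^'n \<Rightarrow> complex" where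
  "bergman_kernel D z w =
     (SOME k. k \<in> bergman_space D \<and>
        (\<forall>f\<in>bergman_space D. f w = (LINT x:D|lborel. f x * cnj (k x)))) z"


section \<open>Kaehler metrics on open sets, in coordinates\<close>

text \<open>A metric is given by its matrix: \<open>g p $ \<alpha> $ \<beta>\<close> is the coefficient with holomorphic index
  \<open>\<alpha>\<close> and antiholomorphic index \<open>\<beta>\<close>.\<close>

type_synonym 'n hmetric = "complex^'n \<Rightarrow> complex^'n^'n"

definition metric_of_potential :: "(complex^'n::finite \<Rightarrow> real) \<Rightarrow> 'n hmetric" where
  "metric_of_potential \<Phi> p =
     (\<chi> \<alpha> \<beta>. wirtinger \<alpha> (wirtinger_bar \<beta> (\<lambda>q. complex_of_real (\<Phi> q))) p)"

text \<open>The transpose comes from the normalization: the sum over \<open>\<beta>\<close> of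
  \<open>inverse_metric g p $ \<alpha> $ \<beta> * g p $ \<tau> $ \<beta>\<close> is 1 if \<open>\<alpha> = \<tau>\<close> and 0 otherwise.\<close>

definition inverse_metric :: "'n::finite hmetric \<Rightarrow> 'n hmetric" where
  "inverse_metric g p = matrix_inv (transpose (g p))"

definition ricci :: "'n::finite hmetric \<Rightarrow> 'n hmetric" where
  "ricci g p = (\<chi> \<alpha> \<beta>. - wirtinger \<alpha> (wirtinger_bar \<beta> (\<lambda>q. ln (det (g q)))) p)"

definition scalar_curvature :: "'n::finite hmetric \<Rightarrow> complex^'n \<Rightarrow> complex" where
  "scalar_curvature g p = (\<Sum>\<alpha>\<in>UNIV. \<Sum>\<beta>\<in>UNIV. inverse_metric g p $ \<alpha> $ \<beta> * ricci g p $ \<alpha> $ \<beta>)"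

definition kaehler_einstein :: "(complex^'n::finite) set \<Rightarrow> 'n hmetric \<Rightarrow> bool" where
  "kaehler_einstein M g \<longleftrightarrow>
     (\<exists>l::real. \<forall>p\<in>M. \<forall>\<alpha> \<beta>. ricci g p $ \<alpha> $ \<beta> = complex_of_real l * g p $ \<alpha> $ \<beta>)"

definition extremal :: "(complex^'n::finite) set \<Rightarrow> 'n hmetric \<Rightarrow> bool" where
  "extremal M g \<longleftrightarrow>
     (\<forall>p\<in>M. \<forall>\<alpha> \<eta>. wirtinger_bar \<eta>
        (\<lambda>q. \<Sum>\<beta>\<in>UNIV. inverse_metric g q $ \<alpha> $ \<beta> * wirtinger_bar \<beta> (scalar_curvature g) q) p = 0)"


section \<open>The genus\<close>

definition bergman_metric :: "(complex^'n::finite) set \<Rightarrow> 'n hmetric" where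
  "bergman_metric D = metric_of_potential (\<lambda>z. ln (Re (bergman_kernel D z z)))"

text \<open>The component of \<open>\<nabla>\<^sub>k \<partial>\<^sub>i\<close> along \<open>\<partial>\<^sub>\<alpha>\<close> for the Chern connection.\<close>

definition christoffel :: "'n::finite hmetric \<Rightarrow> 'n \<Rightarrow> 'n \<Rightarrow> 'n \<Rightarrow> complex^'n \<Rightarrow> complex" where
  "christoffel g \<alpha> k i p =
     (\<Sum>\<beta>\<in>UNIV. inverse_metric g p $ \<alpha> $ \<beta> * wirtinger k (\<lambda>q. g q $ i $ \<beta>) p)"

text \<open>The Hermitian Jordan triple product on the tangent space at \<open>p\<close>: minus the curvature
  tensor of the Bergman metric, whose components are \<open>- \<partial>\<close>-bar of the Christoffel symbols.
  For a circled domain and \<open>p = 0\<close> this is the triple product of Koecher and Loos; on the unit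
  disc, at 0, it is \<open>2 * u * cnj v * w\<close>.\<close>

definition triple ::
    "(complex^'n::finite) set \<Rightarrow> complex^'n \<Rightarrow> complex^'n \<Rightarrow> complex^'n \<Rightarrow> complex^'n \<Rightarrow> complex^'n" where
  "triple D p u v w =
     (\<chi> \<alpha>. \<Sum>i\<in>UNIV. \<Sum>k\<in>UNIV. \<Sum>l\<in>UNIV.
        wirtinger_bar l (christoffel (bergman_metric D) \<alpha> k i) p * u $ i * w $ k * cnj (v $ l))"

text \<open>With the normalization \<open>{e,e,e} = 2e\<close> of tripotents, the eigenvalues of \<open>v \<mapsto> {e,e,v}\<close>
  are 0, 1 and 2.\<close>

definition orthogonal_tripotents ::
    "(complex^'n::finite) set \<Rightarrow> complex^'n \<Rightarrow> (complex^'n) list \<Rightarrow> bool" where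
  "orthogonal_tripotents D p es \<longleftrightarrow>
     (\<forall>i<length es. es ! i \<noteq> 0 \<and> triple D p (es ! i) (es ! i) (es ! i) = 2 *s (es ! i)) \<and>
     (\<forall>i<length es. \<forall>j<length es. i \<noteq> j \<longrightarrow> (\<forall>v. triple D p (es ! i) (es ! j) v = 0))"

definition frame :: "(complex^'n::finite) set \<Rightarrow> complex^'n \<Rightarrow> (complex^'n) list \<Rightarrow> bool" where
  "frame D p es \<longleftrightarrow> orthogonal_tripotents D p es \<and>
     (\<forall>es'. orthogonal_tripotents D p es' \<longrightarrow> length es' \<le> length es)"

text \<open>The genus \<open>2 + a (r - 1) + b\<close>, where \<open>r\<close> is the rank (the length of a frame
  \<open>e\<^sub>1, \<dots>, e\<^sub>r\<close>) and \<open>a\<close>, \<open>b\<close> are the complex dimensions of the joint Peirce spaces \<open>V\<^sub>1\<^sub>2\<close> and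
  \<open>V\<^sub>1\<^sub>0\<close>.  For an irreducible domain these numbers depend neither on the base point nor on the
  frame; for \<open>r = 1\<close> the term with \<open>a\<close> vanishes.\<close>

definition genus :: "(complex^'n::finite) set \<Rightarrow> nat" where
  "genus D =
     (let p = (SOME p. p \<in> D);
          es = (SOME es. frame D p es);
          r = length es;
          a = vec.dim {v. triple D p (es ! 0) (es ! 0) v = v \<and> triple D p (es ! 1) (es ! 1) v = v};
          b = vec.dim {v. triple D p (es ! 0) (es ! 0) v = v \<and>
                 (\<forall>j. 0 < j \<and> j < r \<longrightarrow> triple D p (es ! j) (es ! j) v = 0)}
      in 2 + a * (r - 1) + b)"


section \<open>Cartan--Hartogs domains\<close>

text \<open>The generic norm on the diagonal.  A realization of \<open>\<Omega>\<close> other than the circled one multiplies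
  it by a constant and the squared modulus of a nowhere vanishing holomorphic function.\<close>

definition generic_norm :: "(complex^'d::finite) set \<Rightarrow> complex^'d \<Rightarrow> real" where
  "generic_norm \<Omega> z =
     (measure lborel \<Omega> * Re (bergman_kernel \<Omega> z z)) powr (- 1 / real (genus \<Omega>))"

text \<open>A point of \<open>complex^('d option)\<close> is a pair \<open>(z, w)\<close> with \<open>w\<close> at index \<open>None\<close>.\<close>

definition base_part :: "complex^('d::finite option) \<Rightarrow> complex^'d" where
  "base_part p = (\<chi> i. p $ Some i)"

definition fibre_part :: "complex^('d::finite option) \<Rightarrow> complex" where
  "fibre_part p = p $ None"

definition cartan_hartogs :: "(complex^'d::finite) set \<Rightarrow> real \<Rightarrow> (complex^('d option)) set" where
  "cartan_hartogs \<Omega> \<mu> =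
     {p. base_part p \<in> \<Omega> \<and> (cmod (fibre_part p))\<^sup>2 < generic_norm \<Omega> (base_part p) powr \<mu>}"

definition cartan_hartogs_metric :: "(complex^'d::finite) set \<Rightarrow> real \<Rightarrow> 'd option hmetric" where
  "cartan_hartogs_metric \<Omega> \<mu> =
     metric_of_potential
       (\<lambda>p. - ln (generic_norm \<Omega> (base_part p) powr \<mu> - (cmod (fibre_part p))\<^sup>2))"

end

theory Submission
  imports Defs "HOL-Complex_Analysis.Cauchy_Integral_Formula"
begin

text \<open>Write \<open>d\<close> for the dimension of \<open>\<Omega>\<close>, \<open>\<phi> = - log N\<^sup>\<mu>\<close> and \<open>P = N\<^sup>\<mu> - |w|\<^sup>2\<close>, so
  that \<open>-log P\<close> is the potential of the metric \<open>g\<close>.  Up to an additive constant \<open>\<phi>\<close> is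
  \<open>\<mu>/\<gamma>\<close> times the logarithm of the Bergman kernel on the diagonal, \<open>\<gamma>\<close> being the genus.

  The proof computes the Ricci tensor.  The metric \<open>g\<close> is a rank-one modification of the
  pull-back of \<open>\<partial>\<partial>\<close>-bar \<open>\<phi>\<close> (\<open>gCH_formula\<close>), hence
  \<open>det g = (N\<^sup>\<mu>/P)\<^sup>d (N\<^sup>\<mu>/P\<^sup>2) det (\<partial>\<partial>-bar \<phi>)\<close>.  If the last determinant is a constant multiple of the
  Bergman kernel, then \<open>log det g\<close> is a combination of \<open>log P\<close> and \<open>\<phi>\<close>, and
  \<open>Ric = c \<partial>\<partial>-bar \<phi> - (d + 2) g\<close> with \<open>c = d + 1 - \<gamma>/\<mu>\<close> (\<open>ricci_gCH\<close>).  If \<open>c = 0\<close> the metric is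
  Einstein.  Conversely the scalar curvature is a constant plus \<open>c d P/N\<^sup>\<mu>\<close>, and the fibre component of
  its gradient is \<open>- c d w (P/N\<^sup>\<mu>)\<^sup>2\<close>.  For \<open>w \<noteq> 0\<close> this is not holomorphic in \<open>w\<close> unless
  \<open>c = 0\<close>, so an extremal metric is Einstein (\<open>einstein_if_extremal\<close>).  An Einstein metric has constant
  scalar curvature and so is extremal (\<open>extremal_if_einstein\<close>).

  What remains is that the Bergman metric of a bounded symmetric domain is Einstein
  (\<open>bergman_metric_einstein\<close>): \<open>det (\<partial>\<partial>-bar log K)\<close> is a positive multiple of \<open>K\<close>.  The quotient of the
  two is a function \<open>h\<close> that is invariant under every symmetry \<open>s\<close>, because
  \<open>K(z,z) = |J(z)|\<^sup>2 K(s z, s z)\<close> with the holomorphic Jacobian determinant \<open>J\<close>, and because \<open>log |J|\<^sup>2\<close> is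
  annihilated by \<open>\<partial>\<partial>\<close>-bar.  The symmetry at \<open>p\<close> has derivative \<open>-1\<close> there
  (\<open>involution_jacobian_fixed_point\<close>), so the derivative of \<open>h\<close> at \<open>p\<close> equals its own negative.  As \<open>p\<close>
  is arbitrary and the domain is connected, \<open>h\<close> is constant.  Positivity of \<open>h\<close> is the positivity of the Bergman metric
  (\<open>bergman_metric_form_positive\<close>).

  The parts before that supply the analysis behind these steps: holomorphic functions of several variables via
  Cauchy estimates on complex lines, the change of variables formula with Jacobian \<open>|det|\<^sup>2\<close>, existence of
  the reproducing kernel, and smoothness of \<open>K(z,z)\<close>, which comes from the joint holomorphy of \<open>K\<close> in the first
  variable and the conjugate of the second.\<close>

section \<open>Linear algebra\<close>

definition replace_column :: "'n::finite \<Rightarrow> 'a::field^'n \<Rightarrow> 'a^'n^'n" where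
  "replace_column k c = (\<chi> i j. if j = k then c $ i else mat 1 $ i $ j)"

lemma replace_column_mult_vec:
  "replace_column k c *v x = x + x $ k *s (c - axis k 1)"
proof (subst vec_eq_iff, rule allI)
  fix i
  have "(replace_column k c *v x) $ i = (\<Sum>j\<in>UNIV. (if j = k then c $ i else mat 1 $ i $ j) * x $ j)"
    by (simp add: replace_column_def matrix_vector_mult_def)
  also have "\<dots> = (\<Sum>j\<in>UNIV. (if j = k then (c $ i - mat 1 $ i $ k) * x $ k else 0)
                                + (if j = i then x $ i else 0))"
    by (intro sum.cong) (auto simp: mat_def algebra_simps)
  also have "\<dots> = (c $ i - mat 1 $ i $ k) * x $ k + x $ i"
    by (simp add: sum.distrib)
  finally show "(replace_column k c *v x) $ i = (x + x $ k *s (c - axis k 1)) $ i"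
    by (auto simp: mat_def axis_def algebra_simps)
qed

lemma det_replace_column: "det (replace_column k c) = c $ k"
proof -
  have "replace_column k c = (\<chi> i j. if j = k then (mat 1 *v c) $ i else mat 1 $ i $ j)"
    by (simp add: replace_column_def cong: if_cong)
  then show ?thesis
    by (simp only: cramer_lemma) simp
qed

lemma invertible_replace_column: "c $ k \<noteq> 0 \<Longrightarrow> invertible (replace_column k c)"
  by (simp add: invertible_det_nz det_replace_column)

lemma matrix_mult_axis:
  fixes A :: "'a::field^'n::finite^'m::finite"
  shows "A *v axis j 1 = column j A"
  by (simp add: vec_eq_iff matrix_vector_mult_def column_def axis_def if_distrib cong: if_cong)

lemma matrix_eq_axis:
  fixes A B :: "'a::field^'n::finite^'m::finite"
  assumes "\<And>j. A *v axis j 1 = B *v axis j 1"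
  shows "A = B"
proof -
  have "A $ i $ j = B $ i $ j" for i j
    using arg_cong[OF assms[of j], of "\<lambda>v. v $ i"]
    by (simp add: matrix_mult_axis column_def)
  then show ?thesis by (simp add: vec_eq_iff)
qed

lemma vec_eq_sum_axis:
  fixes v :: "'a::field^'n::finite"
  shows "v = (\<Sum>j\<in>UNIV. v $ j *s axis j 1)"
  by (simp add: vec_eq_iff axis_def if_distrib cong: if_cong)

text \<open>Gaussian elimination, one column at a time: a column \<open>c\<close> with \<open>c $ k \<noteq> 0\<close> in position \<open>k\<close> is turned into the
  standard one by dividing by \<open>replace_column k c\<close> on the left.  A vanishing pivot is first repaired by adding one
  row to another, which is multiplication by a matrix of the same kind.\<close>

lemma invertible_matrix_induct [consumes 1, case_names mat_one mult column]:
  fixes A :: "'a::field^'n::finite^'n"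
  assumes inv: "invertible A"
    and one: "P (mat 1)"
    and mult: "\<And>A B. invertible A \<Longrightarrow> invertible B \<Longrightarrow> P A \<Longrightarrow> P B \<Longrightarrow> P (A ** B)"
    and col: "\<And>k c. c $ k \<noteq> 0 \<Longrightarrow> P (replace_column k c)"
  shows "P A"
proof -
  have "P A" if "invertible A" "\<And>j. j \<notin> K \<Longrightarrow> A *v axis j 1 = axis j 1" for A :: "'a^'n^'n" and K
    using finite[of K] that
  proof (induction K arbitrary: A rule: finite_induct)
    case empty
    then have "A = mat 1" by (intro matrix_eq_axis) simp
    then show ?case using one by simp
  next
    case (insert k K)
    have pivot: "P A" if A: "invertible A" "A $ k $ k \<noteq> 0"
      "\<And>j. j \<notin> insert k K \<Longrightarrow> A *v axis j 1 = axis j 1" for A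
    proof -
      define C where "C = replace_column k (column k A)"
      have C: "invertible C"
        unfolding C_def using A(2) by (intro invertible_replace_column) (simp add: column_def)
      then obtain D where D: "C ** D = mat 1" "D ** C = mat 1"
        unfolding invertible_def by blast
      have iD: "invertible D" using D unfolding invertible_def by blast
      have Dk: "D *v (A *v axis k 1) = axis k 1"
      proof -
        have "C *v axis k 1 = A *v axis k 1"
          by (simp add: C_def replace_column_mult_vec matrix_mult_axis[of A])
        then show ?thesis
          by (metis D(2) matrix_vector_mul_assoc matrix_vector_mul_lid)
      qed
      have Dj: "D *v axis j 1 = axis j 1" if "j \<noteq> k" for j
      proof -
        have "C *v axis j 1 = axis j 1"
          using that by (simp add: C_def replace_column_mult_vec axis_def)
        then show ?thesis
          by (metis D(2) matrix_vector_mul_assoc matrix_vector_mul_lid)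
      qed
      have "P (D ** A)"
      proof (rule insert.IH)
        show "invertible (D ** A)" using iD A(1) by (rule invertible_mult)
        fix j assume "j \<notin> K"
        then show "D ** A *v axis j 1 = axis j 1"
          using Dk Dj A(3)[of j]
          by (cases "j = k") (auto simp flip: matrix_vector_mul_assoc)
      qed
      moreover have "P C" unfolding C_def using A(2) by (intro col) (simp add: column_def)
      ultimately have "P (C ** (D ** A))"
        using mult[OF C invertible_mult[OF iD A(1)]] by blast
      then show ?thesis using D(1) by (simp add: matrix_mul_assoc)
    qed
    show ?case
    proof (cases "A $ k $ k = 0")
      case False
      then show ?thesis using pivot insert.prems by blast
    next
      case True
      have "\<exists>i\<in>K. A $ i $ k \<noteq> 0"
      proof (rule ccontr)
        assume "\<not> ?thesis"
        then have z: "A $ i $ k = 0" if "i \<in> insert k K" for i using that True by auto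
        \<comment> \<open>if all these entries vanish, column k lies in the span of the columns that are already standard\<close>
        define v :: "'a^'n" where "v = (\<chi> j. if j \<in> insert k K then 0 else A $ j $ k)"
        have "A *v v = (\<Sum>j\<in>UNIV. v $ j *s (A *v axis j 1))"
          by (subst vec_eq_sum_axis[of v])
            (simp add: vec.linear_sum[OF matrix_vector_mul_linear_gen] vector_scalar_commute)
        also have "\<dots> = (\<Sum>j\<in>UNIV. v $ j *s axis j 1)"
          by (intro sum.cong) (use insert.prems(2) in \<open>auto simp: v_def\<close>)
        also have "\<dots> = v" by (rule vec_eq_sum_axis[symmetric])
        also have "v = A *v axis k 1"
          using z by (simp add: vec_eq_iff v_def matrix_mult_axis column_def)
        finally have "A *v v = A *v axis k 1" .
        then have "v = axis k 1"
          using insert.prems(1) unfolding invertible_def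
          by (metis matrix_vector_mul_assoc matrix_vector_mul_lid)
        then have "v $ k = 1" by simp
        then show False by (simp add: v_def)
      qed
      then obtain i where i: "i \<in> K" "A $ i $ k \<noteq> 0" by blast
      have ik: "i \<noteq> k" using i insert.hyps by auto
      define S where "S = replace_column i (axis i 1 + axis k (1::'a))"
      define T where "T = replace_column i (axis i 1 - axis k (1::'a))"
      have Sv: "S *v x = x + x $ i *s axis k 1" and Tv: "T *v x = x - x $ i *s axis k 1" for x
        unfolding S_def T_def replace_column_mult_vec
        by (simp_all add: vec_eq_iff)
      have TS: "T ** S = mat 1"
        by (rule matrix_eq_axis)
          (use ik in \<open>simp add: Sv Tv axis_def vec_eq_iff flip: matrix_vector_mul_assoc\<close>)
      have inv: "invertible S" "invertible T"
        unfolding S_def T_def using ik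
        by (auto intro!: invertible_replace_column simp: axis_def)
      have "P (S ** A)"
      proof (rule pivot)
        show "invertible (S ** A)" using inv insert.prems(1) by (intro invertible_mult)
        have "(S ** A) $ k $ k = (S *v (A *v axis k 1)) $ k"
          unfolding matrix_mult_axis
          by (simp add: column_def matrix_vector_mult_def matrix_matrix_mult_def)
        also have "\<dots> = A $ i $ k"
          by (simp add: Sv matrix_mult_axis column_def True)
        finally show "(S ** A) $ k $ k \<noteq> 0" using i by simp
        fix j assume j: "j \<notin> insert k K"
        then have "i \<noteq> j" using i by auto
        then show "S ** A *v axis j 1 = axis j 1"
          using insert.prems(2)[OF j]
          by (simp add: Sv axis_def flip: matrix_vector_mul_assoc)
      qed
      moreover have "P T" unfolding T_def using ik by (intro col) (simp add: axis_def)
      ultimately have "P (T ** (S ** A))"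
        using mult[OF inv(2) invertible_mult[OF inv(1) insert.prems(1)]] by blast
      then show ?thesis using TS by (simp add: matrix_mul_assoc)
    qed
  qed
  from this[of A UNIV] inv show ?thesis by simp
qed

definition option_block :: "'a::field^'n::finite^'n \<Rightarrow> 'a \<Rightarrow> 'a^('n option)^('n option)" where
  "option_block A c = (\<chi> \<alpha> \<beta>. case \<alpha> of
      None \<Rightarrow> (case \<beta> of None \<Rightarrow> c | Some j \<Rightarrow> 0)
    | Some i \<Rightarrow> (case \<beta> of None \<Rightarrow> 0 | Some j \<Rightarrow> A $ i $ j))"

lemma sum_UNIV_option:
  fixes f :: "'n::finite option \<Rightarrow> 'a::comm_monoid_add"
  shows "(\<Sum>\<alpha>\<in>UNIV. f \<alpha>) = f None + (\<Sum>i\<in>UNIV. f (Some i))"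
  by (simp add: UNIV_option_conv sum.reindex)

lemma option_block_mult: "option_block A c ** option_block B d = option_block (A ** B) (c * d)"
  by (auto simp: vec_eq_iff option_block_def matrix_matrix_mult_def sum_UNIV_option
      split: option.splits)

text \<open>Both sides are multiplicative in \<open>A\<close> and agree on the generators of the preceding induction.\<close>

lemma det_option_block:
  fixes A :: "'a::field^'n::finite^'n"
  assumes "invertible A"
  shows "det (option_block A c) = c * det A"
proof -
  have "det (option_block A 1) = det A"
    using assms
  proof (induction rule: invertible_matrix_induct)
    case mat_one
    have "option_block (mat 1 :: 'a^'n^'n) 1 = mat 1"
      by (auto simp: vec_eq_iff option_block_def mat_def split: option.splits)
    then show ?case by simp
  next
    case (mult A B)
    have "option_block (A ** B) 1 = option_block A 1 ** option_block B 1"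
      by (simp add: option_block_mult)
    with mult show ?case by (simp add: det_mul)
  next
    case (column k c)
    have "option_block (replace_column k c) 1 =
        replace_column (Some k) (\<chi> \<alpha>. case \<alpha> of None \<Rightarrow> 0 | Some i \<Rightarrow> c $ i)"
      by (auto simp: vec_eq_iff option_block_def replace_column_def mat_def split: option.splits)
    then show ?case by (simp add: det_replace_column)
  qed
  moreover have "option_block A c = option_block A 1 ** replace_column None (axis None c)"
  proof -
    have "replace_column None (axis None c) = option_block (mat 1 :: 'a^'n^'n) c"
      by (auto simp: vec_eq_iff option_block_def replace_column_def mat_def axis_def
          split: option.splits)
    then show ?thesis by (simp add: option_block_mult)
  qed
  ultimately show ?thesis
    by (simp add: det_mul det_replace_column)
qed

text \<open>Linear in the argument paired with the first index: for a metric this is the holomorphic index.\<close>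

definition sesquilinear_form :: "complex^'n::finite^'n \<Rightarrow> complex^'n \<Rightarrow> complex^'n \<Rightarrow> complex" where
  "sesquilinear_form A u v = (\<Sum>i\<in>UNIV. \<Sum>j\<in>UNIV. u $ i * cnj (v $ j) * A $ i $ j)"

lemma sesquilinear_form_add_left:
  "sesquilinear_form A (u + u') v = sesquilinear_form A u v + sesquilinear_form A u' v"
  by (simp add: sesquilinear_form_def algebra_simps sum.distrib)

lemma sesquilinear_form_add_right:
  "sesquilinear_form A u (v + v') = sesquilinear_form A u v + sesquilinear_form A u v'"
  by (simp add: sesquilinear_form_def algebra_simps sum.distrib)

lemma sesquilinear_form_axis:
  "sesquilinear_form A (axis i a) (axis j b) = a * cnj b * A $ i $ j"
proof -
  have "sesquilinear_form A (axis i a) (axis j b) =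
     (\<Sum>k\<in>UNIV. \<Sum>l\<in>UNIV. if k = i then (if l = j then a * cnj b * A $ i $ j else 0) else 0)"
    unfolding sesquilinear_form_def by (intro sum.cong refl) (auto simp: axis_def)
  also have "\<dots> = (\<Sum>k\<in>UNIV. if k = i then \<Sum>l\<in>UNIV. (if l = j then a * cnj b * A $ i $ j else 0) else 0)"
    by (intro sum.cong) auto
  finally show ?thesis by simp
qed

text \<open>Polarization: the values on \<open>axis i 1 + axis j 1\<close> and \<open>axis i 1 + axis j \<i>\<close> determine the real and the imaginary
  part of the relation.\<close>

lemma hermitian_if_real_form:
  assumes re: "\<And>v. Im (sesquilinear_form A v v) = 0"
  shows "A $ j $ i = cnj (A $ i $ j)"
proof -
  have 1: "Im (sesquilinear_form A (axis i a) (axis j b) + sesquilinear_form A (axis j b) (axis i a)) = 0"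
    for a b
    using re[of "axis i a + axis j b"] re[of "axis i a"] re[of "axis j b"]
    by (simp add: sesquilinear_form_add_left sesquilinear_form_add_right)
  show ?thesis
    using 1[of 1 1] 1[of 1 \<i>]
    by (auto simp: sesquilinear_form_axis complex_eq_iff)
qed

lemma cnj_det: "cnj (det A) = det (\<chi> i j. cnj (A $ i $ j))"
  by (simp add: det_def)

text \<open>The form stays positive along the segment from the identity to \<open>A\<close>, so the determinant is real and never zero
  there, and its sign at the identity persists.\<close>

lemma det_pos_if_pos_form:
  fixes A :: "complex^'n::finite^'n"
  assumes pos: "\<And>v. v \<noteq> 0 \<Longrightarrow> Im (sesquilinear_form A v v) = 0 \<and> Re (sesquilinear_form A v v) > 0"
  shows "Im (det A) = 0 \<and> Re (det A) > 0"
proof -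
  define B where "B t = (\<chi> i j. of_real (1 - t) * mat 1 $ i $ j + of_real t * A $ i $ j)" for t :: real
  have form0: "sesquilinear_form M 0 0 = 0" for M :: "complex^'n^'n"
    by (simp add: sesquilinear_form_def)
  have id: "sesquilinear_form (mat 1) v v = of_real ((norm v)\<^sup>2)" for v :: "complex^'n"
  proof -
    have "sesquilinear_form (mat 1) v v = (\<Sum>i\<in>UNIV. \<Sum>j\<in>UNIV. if j = i then v $ i * cnj (v $ i) else 0)"
      unfolding sesquilinear_form_def by (intro sum.cong refl) (auto simp: mat_def)
    then show ?thesis
      by (simp add: norm_vec_def L2_set_def sum_nonneg complex_norm_square del: of_real_power)
  qed
  have formB: "sesquilinear_form (B t) v v =
      of_real (1 - t) * of_real ((norm v)\<^sup>2) + of_real t * sesquilinear_form A v v" for t v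
    unfolding id[symmetric]
    by (simp add: sesquilinear_form_def B_def algebra_simps sum.distrib sum_distrib_left sum_subtractf)
  have posB: "Im (sesquilinear_form (B t) v v) = 0 \<and> Re (sesquilinear_form (B t) v v) > 0"
    if t: "0 \<le> t" "t \<le> 1" and v: "v \<noteq> 0" for t v
  proof -
    have "(1 - t) * (norm v)\<^sup>2 + t * Re (sesquilinear_form A v v) > 0"
    proof (cases "t = 0")
      case False
      have "t * Re (sesquilinear_form A v v) > 0" "(1 - t) * (norm v)\<^sup>2 \<ge> 0"
        using False t pos[OF v] by auto
      then show ?thesis by linarith
    qed (use v in simp)
    then show ?thesis using pos[OF v] by (simp add: formB)
  qed
  have nz: "det (B t) \<noteq> 0" if t: "0 \<le> t" "t \<le> 1" for t
  proof -
    have "invertible (transpose (B t))"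
    proof -
      have "v = 0" if "transpose (B t) *v v = 0" for v
      proof (rule ccontr)
        assume "v \<noteq> 0"
        have "sesquilinear_form (B t) v v = (\<Sum>j\<in>UNIV. cnj (v $ j) * (transpose (B t) *v v) $ j)"
          unfolding sesquilinear_form_def matrix_vector_mult_def transpose_def
          by (subst sum.swap) (simp add: sum_distrib_left algebra_simps)
        then show False using posB[OF t \<open>v \<noteq> 0\<close>] that by simp
      qed
      then show ?thesis
        by (simp add: invertible_left_inverse matrix_left_invertible_ker)
    qed
    then show ?thesis by (simp add: invertible_det_nz)
  qed
  have real: "Im (det (B t)) = 0" if t: "0 \<le> t" "t \<le> 1" for t
  proof -
    have "Im (sesquilinear_form (B t) v v) = 0" for v
      using posB[OF t, of v] by (cases "v = 0") (auto simp: form0)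
    then have herm: "B t $ j $ i = cnj (B t $ i $ j)" for i j
      by (rule hermitian_if_real_form)
    have "transpose (B t) = (\<chi> i j. cnj (B t $ i $ j))"
      by (simp add: vec_eq_iff transpose_def flip: herm)
    then have "cnj (det (B t)) = det (B t)"
      by (metis cnj_det det_transpose)
    then show ?thesis by (simp add: complex_eq_iff)
  qed
  have "continuous_on {0..1} (\<lambda>t. Re (det (B t)))"
    unfolding det_def B_def by (intro continuous_intros)
  moreover have "B 0 = mat 1" "B 1 = A"
    by (auto simp: B_def vec_eq_iff mat_def)
  moreover have "Re (det (B t)) \<noteq> 0" if "0 \<le> t" "t \<le> 1" for t
    using nz[OF that] real[OF that] by (auto simp: complex_eq_iff)
  ultimately have "Re (det A) > 0"
    using IVT2'[of "\<lambda>t. Re (det (B t))" 1 0 0] by fastforce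
  then show ?thesis using real[of 1] \<open>B 1 = A\<close> by simp
qed

section \<open>Holomorphic functions of several variables\<close>

definition complex_differential ::
    "(complex^'n::finite \<Rightarrow> complex) \<Rightarrow> complex^'n \<Rightarrow> complex^'n \<Rightarrow> complex" where
  "complex_differential f p v = (\<Sum>j\<in>UNIV. v $ j * wirtinger j f p)"

lemma frechet_derivative_eq:
  "(f has_derivative f') (at p) \<Longrightarrow> frechet_derivative f (at p) = f'"
  using frechet_derivative_at by metis

lemma wirtinger_eq:
  assumes "(f has_derivative f') (at p)"
  shows "wirtinger j f p = (f' (axis j 1) - \<i> * f' (axis j \<i>)) / 2"
    and "wirtinger_bar j f p = (f' (axis j 1) + \<i> * f' (axis j \<i>)) / 2"
  by (simp_all add: wirtinger_def wirtinger_bar_def frechet_derivative_eq[OF assms])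

lemma complex_linear_coordinates:
  assumes "linear (f' :: complex^'n::finite \<Rightarrow> complex)" "\<And>c v. f' (c *s v) = c * f' v"
  shows "f' v = (\<Sum>j\<in>UNIV. v $ j * f' (axis j 1))"
  by (subst vec_eq_sum_axis[of v]) (simp add: linear_sum[OF assms(1)] assms(2))

lemma axis_scale: "axis j c = c *s axis j (1::complex)"
  by (simp add: vec_eq_iff axis_def)

lemma has_complex_differential:
  assumes "holomorphic_fun S f" "p \<in> S"
  shows "(f has_derivative complex_differential f p) (at p)"
    and "complex_differential f p (axis j 1) = wirtinger j f p"
    and "wirtinger_bar j f p = 0"
proof -
  obtain f' where f': "(f has_derivative f') (at p)" "\<And>c v. f' (c *s v) = c * f' v"
    using assms unfolding holomorphic_fun_def by blast
  have lin: "linear f'" using f'(1) has_derivative_linear by blast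
  have w: "wirtinger j f p = f' (axis j 1)" "wirtinger_bar j f p = 0" for j
    unfolding wirtinger_eq[OF f'(1)]
    by (subst (2) axis_scale, subst f'(2), simp add: field_simps)+
  have "complex_differential f p = f'"
    unfolding complex_differential_def w by (intro ext complex_linear_coordinates[symmetric] lin f'(2))
  then show "(f has_derivative complex_differential f p) (at p)"
    "complex_differential f p (axis j 1) = wirtinger j f p" "wirtinger_bar j f p = 0"
    using f' w by simp_all
qed

lemma bounded_linear_coordinate_form:
  "bounded_linear (\<lambda>v::complex^'n::finite. \<Sum>j\<in>UNIV. v $ j * a j)"
  by (intro bounded_linear_sum bounded_linear_mult_const bounded_linear_vec_nth)

lemma holomorphic_at:
  fixes f :: "complex^'n::finite \<Rightarrow> complex"
  assumes "(f has_derivative (\<lambda>v. \<Sum>j\<in>UNIV. v $ j * a j)) (at p)"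
  shows "\<exists>f'. (f has_derivative f') (at p) \<and> (\<forall>c v. f' (c *s v) = c * f' v)"
  using assms by (intro exI[of _ "\<lambda>v. \<Sum>j\<in>UNIV. v $ j * a j"])
    (simp add: sum_distrib_left mult.assoc)

lemma holomorphic_fun_subset: "holomorphic_fun S f \<Longrightarrow> T \<subseteq> S \<Longrightarrow> holomorphic_fun T f"
  by (auto simp: holomorphic_fun_def)

lemma holomorphic_fun_cong:
  assumes "open S" "\<And>z. z \<in> S \<Longrightarrow> f z = g z" "holomorphic_fun S f"
  shows "holomorphic_fun S g"
  using assms unfolding holomorphic_fun_def
  by (metis has_derivative_transform_within_open)

lemma holomorphic_fun_continuous: "holomorphic_fun S f \<Longrightarrow> continuous_on S f"
  by (meson continuous_at_imp_continuous_on has_complex_differential(1) has_derivative_continuous)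

lemma holomorphic_fun_const: "holomorphic_fun S (\<lambda>_. c)"
  unfolding holomorphic_fun_def by (auto intro!: exI[of _ "\<lambda>_. 0"])

lemma holomorphic_fun_coordinate: "holomorphic_fun S (\<lambda>z. z $ i)"
  unfolding holomorphic_fun_def
  by (auto intro!: exI[of _ "\<lambda>v. v $ i"] bounded_linear_imp_has_derivative bounded_linear_vec_nth)

lemma holomorphic_fun_add:
  "holomorphic_fun S f \<Longrightarrow> holomorphic_fun S g \<Longrightarrow> holomorphic_fun S (\<lambda>z. f z + g z)"
  unfolding holomorphic_fun_def
proof
  fix p assume *: "\<forall>p\<in>S. \<exists>f'. (f has_derivative f') (at p) \<and> (\<forall>c v. f' (c *s v) = c * f' v)"
    "\<forall>p\<in>S. \<exists>g'. (g has_derivative g') (at p) \<and> (\<forall>c v. g' (c *s v) = c * g' v)" "p \<in> S"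
  then obtain f' g' where "(f has_derivative f') (at p)" "\<forall>c v. f' (c *s v) = c * f' v"
    "(g has_derivative g') (at p)" "\<forall>c v. g' (c *s v) = c * g' v"
    by blast
  then show "\<exists>h. ((\<lambda>z. f z + g z) has_derivative h) (at p) \<and> (\<forall>c v. h (c *s v) = c * h v)"
    by (intro exI[of _ "\<lambda>v. f' v + g' v"]) (auto intro: has_derivative_add simp: distrib_left)
qed

lemma holomorphic_fun_mult:
  assumes "holomorphic_fun S f" "holomorphic_fun S g"
  shows "holomorphic_fun S (\<lambda>z. f z * g z)"
  unfolding holomorphic_fun_def
proof
  fix p assume "p \<in> S"
  then obtain f' g' where *: "(f has_derivative f') (at p)" "\<And>c v. f' (c *s v) = c * f' v"
    "(g has_derivative g') (at p)" "\<And>c v. g' (c *s v) = c * g' v"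
    using assms unfolding holomorphic_fun_def by metis
  show "\<exists>h. ((\<lambda>z. f z * g z) has_derivative h) (at p) \<and> (\<forall>c v. h (c *s v) = c * h v)"
    using has_derivative_mult[OF *(1,3)] *(2,4)
    by (intro exI[of _ "\<lambda>v. f p * g' v + f' v * g p"]) (simp add: algebra_simps)
qed

lemma holomorphic_fun_cmult: "holomorphic_fun S f \<Longrightarrow> holomorphic_fun S (\<lambda>z. c * f z)"
  by (intro holomorphic_fun_mult holomorphic_fun_const)

lemma holomorphic_fun_diff:
  "holomorphic_fun S f \<Longrightarrow> holomorphic_fun S g \<Longrightarrow> holomorphic_fun S (\<lambda>z. f z - g z)"
  using holomorphic_fun_add[of S f "\<lambda>z. - 1 * g z"] holomorphic_fun_cmult[of S g "-1"] by simp

lemma holomorphic_fun_sum: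
  "(\<And>i. i \<in> I \<Longrightarrow> holomorphic_fun S (f i)) \<Longrightarrow> holomorphic_fun S (\<lambda>z. \<Sum>i\<in>I. f i z)"
  by (induction I rule: infinite_finite_induct)
    (auto intro: holomorphic_fun_const holomorphic_fun_add)

lemma holomorphic_fun_prod:
  "(\<And>i. i \<in> I \<Longrightarrow> holomorphic_fun S (f i)) \<Longrightarrow> holomorphic_fun S (\<lambda>z. \<Prod>i\<in>I. f i z)"
  by (induction I rule: infinite_finite_induct)
    (auto intro: holomorphic_fun_const holomorphic_fun_mult)

lemma holomorphic_fun_det:
  "(\<And>i j. holomorphic_fun S (\<lambda>z. A z $ i $ j)) \<Longrightarrow> holomorphic_fun S (\<lambda>z. det (A z))"
  unfolding det_def
  by (intro holomorphic_fun_sum holomorphic_fun_mult holomorphic_fun_const holomorphic_fun_prod)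

lemma norm_scale_vec: "norm (c *s (v::complex^'n::finite)) = norm c * norm v"
  by (simp add: norm_vec_def L2_set_def norm_mult power_mult_distrib real_sqrt_mult
      flip: sum_distrib_left)

lemma bounded_linear_scale_vec: "bounded_linear (\<lambda>c. c *s (v::complex^'n::finite))"
  by (rule bounded_linear_intro[of _ "norm v"])
    (auto simp: norm_scale_vec vec_eq_iff algebra_simps)

lemma has_derivative_vec:
  fixes F :: "'a::real_normed_vector \<Rightarrow> complex^'m::finite"
  assumes "\<And>i. ((\<lambda>x. F x $ i) has_derivative (\<lambda>v. F' v $ i)) (at p)"
  shows "(F has_derivative F') (at p)"
proof -
  have dec: "v = (\<Sum>i\<in>UNIV. axis i (v $ i))" for v :: "complex^'m"
    by (simp add: vec_eq_iff axis_def)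
  have bl: "bounded_linear (\<lambda>c::complex. axis i c :: complex^'m)" for i
    using bounded_linear_scale_vec[of "axis i 1"] by (simp flip: axis_scale)
  have "((\<lambda>x. \<Sum>i\<in>UNIV. axis i (F x $ i)) has_derivative (\<lambda>v. \<Sum>i\<in>UNIV. axis i (F' v $ i))) (at p)"
    by (intro has_derivative_sum bounded_linear.has_derivative[OF bl] assms)
  then show ?thesis by (simp flip: dec)
qed

lemma has_derivative_holomorphic_map:
  assumes "holomorphic_map S F" "p \<in> S"
  shows "(F has_derivative (\<lambda>v. \<chi> i. complex_differential (\<lambda>z. F z $ i) p v)) (at p)"
  using assms has_complex_differential(1)
  by (intro has_derivative_vec) (auto simp: holomorphic_map_def)

lemma complex_differential_scale:
  "complex_differential f p (c *s v) = c * complex_differential f p v"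
  by (simp add: complex_differential_def sum_distrib_left algebra_simps)

lemma holomorphic_fun_compose:
  assumes "holomorphic_map S F" "holomorphic_fun T f" "F ` S \<subseteq> T"
  shows "holomorphic_fun S (\<lambda>z. f (F z))"
  unfolding holomorphic_fun_def
proof
  fix p assume p: "p \<in> S"
  have *: "(F has_derivative (\<lambda>v. \<chi> i. complex_differential (\<lambda>z. F z $ i) p v)) (at p)"
    using has_derivative_holomorphic_map assms(1) p .
  have "(f has_derivative complex_differential f (F p)) (at (F p))"
    using has_complex_differential(1)[OF assms(2)] assms(3) p by blast
  note diff_chain_at[OF * this]
  moreover have "(\<chi> i. complex_differential (\<lambda>z. F z $ i) p (c *s v)) =
      c *s (\<chi> i. complex_differential (\<lambda>z. F z $ i) p v)" for c v
    by (simp add: vec_eq_iff complex_differential_scale)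
  ultimately show "\<exists>f'. ((\<lambda>z. f (F z)) has_derivative f') (at p) \<and> (\<forall>c v. f' (c *s v) = c * f' v)"
    by (auto simp: o_def complex_differential_scale intro!: exI)
qed

lemma slice_has_field_derivative:
  assumes "holomorphic_fun S f" "p + \<zeta> *s v \<in> S"
  shows "((\<lambda>\<zeta>. f (p + \<zeta> *s v)) has_field_derivative complex_differential f (p + \<zeta> *s v) v) (at \<zeta>)"
proof -
  have "((\<lambda>\<zeta>. p + \<zeta> *s v) has_derivative (\<lambda>c. 0 + c *s v)) (at \<zeta>)"
    by (intro has_derivative_add has_derivative_const
        bounded_linear_imp_has_derivative bounded_linear_scale_vec)
  from diff_chain_at[OF this has_complex_differential(1)[OF assms]]
  have "((\<lambda>\<zeta>. f (p + \<zeta> *s v)) has_derivative (\<lambda>c. c * complex_differential f (p + \<zeta> *s v) v)) (at \<zeta>)"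
    by (simp add: o_def complex_differential_scale)
  then show ?thesis
    by (rule has_derivative_imp_has_field_derivative) (rule refl)
qed

lemma slice_holomorphic_on:
  assumes "holomorphic_fun S f" "\<And>\<zeta>. \<zeta> \<in> T \<Longrightarrow> p + \<zeta> *s v \<in> S"
  shows "(\<lambda>\<zeta>. f (p + \<zeta> *s v)) holomorphic_on T"
  using slice_has_field_derivative[OF assms(1) assms(2)]
  unfolding holomorphic_on_def field_differentiable_def
  by (blast intro: has_field_derivative_at_within)

lemma deriv_slice:
  assumes "holomorphic_fun S f" "p \<in> S"
  shows "deriv (\<lambda>\<zeta>. f (p + \<zeta> *s v)) 0 = complex_differential f p v"
  using slice_has_field_derivative[of S f p 0 v] assms by (simp add: DERIV_imp_deriv)

text \<open>Cauchy's inequality on discs of radius \<open>R/2\<close> for the first derivative and \<open>R/4\<close> for the second, the latter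
  combined with Taylor's theorem.\<close>

lemma cauchy_estimates:
  fixes g :: "complex \<Rightarrow> complex"
  assumes g: "g holomorphic_on ball 0 R" and R: "R > 0"
    and M: "\<And>\<zeta>. \<zeta> \<in> ball 0 R \<Longrightarrow> norm (g \<zeta>) \<le> M"
  shows "norm (deriv g 0) \<le> 2 * M / R"
    and "norm \<zeta> \<le> R / 2 \<Longrightarrow> norm (g \<zeta> - g 0 - deriv g 0 * \<zeta>) \<le> 32 * M * (norm \<zeta>)\<^sup>2 / R\<^sup>2"
proof -
  have hd: "(deriv ^^ n) g holomorphic_on ball 0 R" for n
    using holomorphic_higher_deriv[OF g] by simp
  have *: "norm ((deriv ^^ n) g z) \<le> fact n * M / (R/4) ^ n" if z: "norm z \<le> R / 2" for n z
  proof (rule Cauchy_inequality)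
    have sub: "cball z (R/4) \<subseteq> ball 0 R"
    proof
      fix x assume "x \<in> cball z (R/4)"
      then have "norm (x - z) \<le> R/4" by (simp add: dist_norm norm_minus_commute)
      then have "norm x \<le> R/2 + R/4" using z norm_triangle_ineq[of "x - z" z] by simp
      then show "x \<in> ball 0 R" using R by simp
    qed
    then show "g holomorphic_on ball z (R/4)" "continuous_on (cball z (R/4)) g"
      using holomorphic_on_subset[OF g order_trans[OF ball_subset_cball]]
        holomorphic_on_imp_continuous_on[OF holomorphic_on_subset[OF g]] by simp_all
    show "R/4 > 0" using R by simp
    show "norm (g x) \<le> M" if "norm (z - x) = R/4" for x
      using sub that by (intro M) (auto simp: dist_norm)
  qed
  show "norm (deriv g 0) \<le> 2 * M / R"
  proof (rule order_trans[OF Cauchy_inequality[of g 0 "R/2" M 1, simplified]])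
    show "g holomorphic_on ball 0 (R/2)" "continuous_on (cball 0 (R/2)) g"
      using R by (auto intro!: holomorphic_on_imp_continuous_on intro: holomorphic_on_subset[OF g])
    show "norm (g x) \<le> M" if "norm x * 2 = R" for x using that R by (intro M) auto
  qed (use R in \<open>auto simp: mult.commute\<close>)
  assume \<zeta>: "norm \<zeta> \<le> R / 2"
  have "norm ((deriv ^^ 0) g \<zeta> - (\<Sum>i\<le>1. (deriv ^^ i) g 0 * (\<zeta> - 0) ^ i / fact i))
      \<le> (fact 2 * M / (R/4) ^ 2) * norm (\<zeta> - 0) ^ Suc 1 / fact 1"
  proof (rule complex_Taylor)
    show "convex (cball 0 (R/2) :: complex set)" by simp
    show "((deriv ^^ i) g has_field_derivative (deriv ^^ Suc i) g x) (at x within cball 0 (R/2))"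
      if "x \<in> cball 0 (R/2)" for i x
      using holomorphic_derivI[OF hd[of i] open_ball] that R
      by (auto intro: has_field_derivative_at_within)
    show "norm ((deriv ^^ Suc 1) g x) \<le> fact 2 * M / (R/4) ^ 2" if "x \<in> cball 0 (R/2)" for x
      using *[of x 2] that by (simp add: numeral_2_eq_2)
  qed (use \<zeta> R in auto)
  then show "norm (g \<zeta> - g 0 - deriv g 0 * \<zeta>) \<le> 32 * M * (norm \<zeta>)\<^sup>2 / R\<^sup>2"
    by (simp add: power2_eq_square field_simps diff_diff_eq)
qed

text \<open>The one-variable estimates on the complex line through \<open>p\<close> in direction \<open>v\<close>.  The quadratic error bound depends on
  \<open>f\<close> only through its supremum; this uniformity makes the limit arguments below work.\<close>

lemma holomorphic_fun_estimates:
  fixes f :: "complex^'n::finite \<Rightarrow> complex"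
  assumes f: "holomorphic_fun (ball p R) f" and R: "R > 0"
    and M: "\<And>z. z \<in> ball p R \<Longrightarrow> norm (f z) \<le> M"
  shows "norm (complex_differential f p v) \<le> 2 * M * norm v / R"
    and "norm v \<le> R / 2 \<Longrightarrow>
      norm (f (p + v) - f p - complex_differential f p v) \<le> 32 * M * (norm v)\<^sup>2 / R\<^sup>2"
proof -
  define u where "u = complex_of_real (1 / norm v) *s v"
  define g where "g = (\<lambda>\<zeta>. f (p + \<zeta> *s u))"
  have pR: "p \<in> ball p R" using R by simp
  have u: "norm u \<le> 1" "v = complex_of_real (norm v) *s u"
    by (cases "v = 0"; simp add: u_def norm_scale_vec vec_eq_iff norm_divide)+
  have in_ball: "p + \<zeta> *s u \<in> ball p R" if "\<zeta> \<in> ball 0 R" for \<zeta>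
    using that u(1) mult_left_mono[OF u(1), of "norm \<zeta>"] by (simp add: dist_norm norm_scale_vec)
  have g: "g holomorphic_on ball 0 R"
    unfolding g_def using f in_ball by (rule slice_holomorphic_on)
  have Mg: "norm (g \<zeta>) \<le> M" if "\<zeta> \<in> ball 0 R" for \<zeta>
    unfolding g_def using M in_ball that by blast
  have dg: "deriv g 0 = complex_differential f p u"
    unfolding g_def using f pR by (rule deriv_slice)
  have dv: "complex_differential f p v = of_real (norm v) * deriv g 0"
    by (subst u(2)) (simp add: complex_differential_scale dg)
  show "norm (complex_differential f p v) \<le> 2 * M * norm v / R"
    using mult_left_mono[OF cauchy_estimates(1)[OF g R Mg], of "norm v"]
    by (simp add: dv norm_mult algebra_simps)
  assume v: "norm v \<le> R / 2"
  have "norm (g (of_real (norm v)) - g 0 - deriv g 0 * of_real (norm v)) \<le> 32 * M * (norm v)\<^sup>2 / R\<^sup>2"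
    using cauchy_estimates(2)[OF g R Mg, of "of_real (norm v)"] v by simp
  moreover have "g (of_real (norm v)) = f (p + v)" "g 0 = f p"
    using u(2) by (simp_all add: g_def)
  ultimately show "norm (f (p + v) - f p - complex_differential f p v) \<le> 32 * M * (norm v)\<^sup>2 / R\<^sup>2"
    by (simp add: dv mult.commute)
qed

lemma holomorphic_fun_lipschitz:
  fixes f :: "complex^'n::finite \<Rightarrow> complex"
  assumes f: "holomorphic_fun (ball p R) f" and R: "R > 0"
    and M: "\<And>z. z \<in> ball p R \<Longrightarrow> norm (f z) \<le> M"
    and xy: "x \<in> ball p (R/2)" "y \<in> ball p (R/2)"
  shows "norm (f x - f y) \<le> 4 * M / R * norm (x - y)"
proof (rule differentiable_bound[OF convex_ball _ _ xy])
  fix z assume z: "z \<in> ball p (R/2)"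
  then have sub: "ball z (R/2) \<subseteq> ball p R"
    by (intro ball_subset_ball_iff[THEN iffD2]) (auto simp: dist_commute)
  show "(f has_derivative complex_differential f z) (at z within ball p (R/2))"
    using has_complex_differential(1)[OF f, of z] z R by (auto intro: has_derivative_at_withinI)
  have "norm (complex_differential f z v) \<le> 2 * M * norm v / (R/2)" for v
    using R M sub by (intro holomorphic_fun_estimates(1)[OF holomorphic_fun_subset[OF f sub]]) auto
  then show "onorm (complex_differential f z) \<le> 4 * M / R"
    by (intro onorm_le) (simp add: field_simps)
qed

lemma has_derivative_if_quadratic_error:
  fixes f :: "complex^'n::finite \<Rightarrow> complex"
  assumes "r > 0"
    and err: "\<And>v. norm v < r \<Longrightarrow> norm (f (p + v) - f p - (\<Sum>j\<in>UNIV. v $ j * a j)) \<le> C * (norm v)\<^sup>2"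
  shows "(f has_derivative (\<lambda>v. \<Sum>j\<in>UNIV. v $ j * a j)) (at p)"
  unfolding has_derivative_at
proof (intro conjI bounded_linear_coordinate_form)
  show "((\<lambda>h. norm (f (p + h) - f p - (\<Sum>j\<in>UNIV. h $ j * a j)) / norm h) \<longlongrightarrow> 0) (at 0)"
  proof (rule tendsto_sandwich[of "\<lambda>_. 0" _ _ "\<lambda>h. C * norm h"])
    have "eventually (\<lambda>h. h \<in> ball 0 r) (at (0::complex^'n))"
      by (rule eventually_at_in_open') (use assms(1) in auto)
    then show "eventually (\<lambda>h. norm (f (p + h) - f p - (\<Sum>j\<in>UNIV. h $ j * a j)) / norm h \<le> C * norm h) (at 0)"
    proof eventually_elim
      case (elim h)
      then show ?case using err[of h] by (cases "h = 0") (auto simp: divide_simps power2_eq_square)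
    qed
    show "((\<lambda>h. C * norm h) \<longlongrightarrow> 0) (at (0::complex^'n))"
      by (rule tendsto_eq_intros refl)+ simp
  qed auto
qed

text \<open>The linear approximations of the \<open>f n\<close> at \<open>p\<close> have a common quadratic error bound, so they pass to the limit.\<close>

lemma holomorphic_uniform_limit_at:
  fixes f :: "nat \<Rightarrow> complex^'n::finite \<Rightarrow> complex"
  assumes R: "R > 0" and f: "\<And>n. holomorphic_fun (ball p R) (f n)"
    and lim: "uniform_limit (ball p R) f l sequentially"
  shows "\<exists>l'. (l has_derivative l') (at p) \<and> (\<forall>c v. l' (c *s v) = c * l' v)"
proof -
  define r where "r = R / 2"
  have r: "r > 0" "cball p r \<subseteq> ball p R" using R by (auto simp: r_def)
  obtain N where N: "\<And>n z. n \<ge> N \<Longrightarrow> z \<in> ball p R \<Longrightarrow> dist (f n z) (l z) < 1"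
    using uniform_limitD[OF lim zero_less_one] unfolding eventually_sequentially by blast
  have "bounded (f N ` cball p r)"
    using holomorphic_fun_continuous[OF f] r(2)
    by (intro compact_imp_bounded compact_continuous_image) (auto intro: continuous_on_subset)
  then obtain B where B: "\<And>z. z \<in> cball p r \<Longrightarrow> norm (f N z) \<le> B"
    unfolding bounded_iff by blast
  have bd: "norm (f n z) \<le> B + 2" if "n \<ge> N" "z \<in> ball p r" for n z
  proof -
    have "z \<in> cball p r" using that(2) by simp
    moreover from this have "z \<in> ball p R" using r(2) by blast
    ultimately show ?thesis
      using N[OF that(1), of z] N[of N z] B[of z]
        norm_triangle_ineq[of "f N z" "f n z - f N z"] dist_triangle2[of "f n z" "f N z" "l z"]
      by (simp add: dist_norm)
  qed
  define a where "a j = deriv (\<lambda>\<zeta>. l (p + \<zeta> *s axis j 1)) 0" for j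
  have a: "(\<lambda>n. wirtinger j (f n) p) \<longlonglongrightarrow> a j" for j
  proof -
    have in_ball: "p + \<zeta> *s axis j 1 \<in> ball p R" if "\<zeta> \<in> ball 0 R" for \<zeta>
      using that by (simp add: dist_norm norm_scale_vec norm_axis_1)
    have "(\<lambda>n. (deriv ^^ 1) (\<lambda>\<zeta>. f n (p + \<zeta> *s axis j 1)) 0)
        \<longlonglongrightarrow> (deriv ^^ 1) (\<lambda>\<zeta>. l (p + \<zeta> *s axis j 1)) 0"
    proof (rule higher_deriv_complex_uniform_limit[where A = "ball 0 R"])
      show "uniform_limit (ball 0 R) (\<lambda>n \<zeta>. f n (p + \<zeta> *s axis j 1)) (\<lambda>\<zeta>. l (p + \<zeta> *s axis j 1)) sequentially"
        using in_ball by (intro uniform_limit_compose'[OF lim]) auto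
      show "\<forall>\<^sub>F n in sequentially. (\<lambda>\<zeta>. f n (p + \<zeta> *s axis j 1)) holomorphic_on ball 0 R"
        by (intro always_eventually allI slice_holomorphic_on[OF f in_ball])
    qed (use R in auto)
    then show ?thesis
      using R by (simp add: a_def deriv_slice[OF f] has_complex_differential(2)[OF f])
  qed
  have "(l has_derivative (\<lambda>v. \<Sum>j\<in>UNIV. v $ j * a j)) (at p)"
  proof (rule has_derivative_if_quadratic_error)
    show "r / 2 > 0" using r by simp
    fix v :: "complex^'n" assume v: "norm v < r / 2"
    have ev: "norm (f n (p + v) - f n p - (\<Sum>j\<in>UNIV. v $ j * wirtinger j (f n) p))
        \<le> 32 * (B + 2) / r\<^sup>2 * (norm v)\<^sup>2" if "n \<ge> N" for n
    proof -
      have "holomorphic_fun (ball p r) (f n)"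
        by (rule holomorphic_fun_subset[OF f]) (use r(2) ball_subset_cball in blast)
      from holomorphic_fun_estimates(2)[OF this r(1) bd[OF that], of v] v show ?thesis
        by (simp add: complex_differential_def)
    qed
    have pt: "(\<lambda>n. f n z) \<longlonglongrightarrow> l z" if "z \<in> ball p R" for z
      using tendsto_uniform_limitI[OF lim that] .
    have mem: "p \<in> ball p R" "p + v \<in> ball p R"
      using R v by (auto simp: r_def dist_norm)
    have "(\<lambda>n. norm (f n (p + v) - f n p - (\<Sum>j\<in>UNIV. v $ j * wirtinger j (f n) p)))
      \<longlonglongrightarrow> norm (l (p + v) - l p - (\<Sum>j\<in>UNIV. v $ j * a j))"
      by (intro tendsto_intros a pt mem)
    then show "norm (l (p + v) - l p - (\<Sum>j\<in>UNIV. v $ j * a j)) \<le> 32 * (B + 2) / r\<^sup>2 * (norm v)\<^sup>2"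
      by (rule LIMSEQ_le_const2) (use ev in blast)
  qed
  then show ?thesis by (rule holomorphic_at)
qed

lemma holomorphic_fun_locally_uniform_limit:
  fixes f :: "nat \<Rightarrow> complex^'n::finite \<Rightarrow> complex"
  assumes f: "\<And>n. holomorphic_fun S (f n)"
    and lim: "\<And>p. p \<in> S \<Longrightarrow> \<exists>R>0. ball p R \<subseteq> S \<and> uniform_limit (ball p R) f l sequentially"
  shows "holomorphic_fun S l"
  unfolding holomorphic_fun_def
proof
  fix p assume "p \<in> S"
  then obtain R where R: "R > 0" "ball p R \<subseteq> S" "uniform_limit (ball p R) f l sequentially"
    using lim by blast
  show "\<exists>l'. (l has_derivative l') (at p) \<and> (\<forall>c v. l' (c *s v) = c * l' v)"
    by (rule holomorphic_uniform_limit_at[OF R(1) holomorphic_fun_subset[OF f R(2)] R(3)])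
qed

lemma holomorphic_fun_bounded_on_cball:
  fixes f :: "complex^'n::finite \<Rightarrow> complex"
  assumes "holomorphic_fun S f" "cball p r \<subseteq> S"
  obtains M where "\<And>z. z \<in> cball p r \<Longrightarrow> norm (f z) \<le> M"
proof -
  have "bounded (f ` cball p r)"
    using holomorphic_fun_continuous[OF assms(1)] assms(2)
    by (intro compact_imp_bounded compact_continuous_image) (auto intro: continuous_on_subset)
  then show ?thesis using that unfolding bounded_iff by blast
qed

text \<open>A partial derivative is a locally uniform limit of difference quotients, which are holomorphic.\<close>

lemma holomorphic_fun_wirtinger:
  fixes f :: "complex^'n::finite \<Rightarrow> complex"
  assumes S: "open S" and f: "holomorphic_fun S f"
  shows "holomorphic_fun S (wirtinger j f)"
  unfolding holomorphic_fun_def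
proof
  fix p assume "p \<in> S"
  then obtain r where r: "r > 0" "cball p r \<subseteq> S"
    using S open_contains_cball by blast
  define R where "R = r / 2"
  have R: "R > 0" using r by (simp add: R_def)
  obtain M where M: "\<And>z. z \<in> cball p r \<Longrightarrow> norm (f z) \<le> M"
    using holomorphic_fun_bounded_on_cball[OF f r(2)] by blast
  have M0: "M \<ge> 0" using M[of p] r by (smt (verit) centre_in_cball norm_ge_zero)
  have near: "ball z R \<subseteq> ball p r" if "z \<in> ball p R" for z
    using that by (intro ball_subset_ball_iff[THEN iffD2]) (auto simp: R_def dist_commute)
  define h where "h n = R / (2 * real (Suc n))" for n
  have h: "0 < h n" "h n \<le> R / 2" for n
    using R by (auto simp: h_def field_simps)
  define F where "F n z = (f (z + of_real (h n) *s axis j 1) - f z) / of_real (h n)" for n z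
  have step: "z + of_real (h n) *s axis j 1 \<in> ball z R" for n and z :: "complex^'n"
    using h[of n] R by (simp add: dist_norm norm_scale_vec norm_axis_1)
  show "\<exists>l'. (wirtinger j f has_derivative l') (at p) \<and> (\<forall>c v. l' (c *s v) = c * l' v)"
  proof (rule holomorphic_uniform_limit_at[OF R, where f = F])
    fix n
    have "holomorphic_map (ball p R) (\<lambda>z. z + of_real (h n) *s axis j 1)"
      unfolding holomorphic_map_def
      by (auto intro!: holomorphic_fun_add holomorphic_fun_coordinate holomorphic_fun_const)
    then have "holomorphic_fun (ball p R) (\<lambda>z. f (z + of_real (h n) *s axis j 1))"
      by (rule holomorphic_fun_compose[OF _ f]) (use step near r(2) ball_subset_cball in blast)
    moreover have "holomorphic_fun (ball p R) f"
      by (rule holomorphic_fun_subset[OF f]) (use r in \<open>auto simp: R_def\<close>)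
    ultimately have "holomorphic_fun (ball p R)
        (\<lambda>z. (1 / of_real (h n)) * (f (z + of_real (h n) *s axis j 1) - f z))"
      by (intro holomorphic_fun_cmult holomorphic_fun_diff)
    then show "holomorphic_fun (ball p R) (F n)" by (simp add: F_def[abs_def])
  next
    have est: "dist (F n z) (wirtinger j f z) \<le> 32 * M / R\<^sup>2 * h n" if z: "z \<in> ball p R" for n z
    proof -
      let ?v = "of_real (h n) *s axis j 1 :: complex^'n"
      have sub: "ball z R \<subseteq> cball p r" using near[OF z] ball_subset_cball by blast
      have hz: "holomorphic_fun (ball z R) f"
        by (rule holomorphic_fun_subset[OF f]) (use sub r in blast)
      have "norm (f (z + ?v) - f z - complex_differential f z ?v) \<le> 32 * M * (norm ?v)\<^sup>2 / R\<^sup>2"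
        using hz R M sub h[of n]
        by (intro holomorphic_fun_estimates(2)) (auto simp: norm_scale_vec norm_axis_1)
      then have *: "norm (f (z + ?v) - f z - of_real (h n) * wirtinger j f z) \<le> 32 * M * (h n)\<^sup>2 / R\<^sup>2"
        using has_complex_differential(2)[OF hz, of z j] R
        by (simp add: complex_differential_scale norm_scale_vec norm_axis_1)
      have eq: "F n z - wirtinger j f z
          = (f (z + ?v) - f z - of_real (h n) * wirtinger j f z) / of_real (h n)"
        using h[of n] by (simp add: F_def field_simps)
      have "dist (F n z) (wirtinger j f z)
          = norm (f (z + ?v) - f z - of_real (h n) * wirtinger j f z) / h n"
        unfolding dist_norm eq using h[of n] by (simp add: norm_divide)
      also have "\<dots> \<le> 32 * M * (h n)\<^sup>2 / R\<^sup>2 / h n"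
        using * h[of n] by (intro divide_right_mono) auto
      also have "\<dots> = 32 * M / R\<^sup>2 * h n"
        using h[of n] by (simp add: power2_eq_square)
      finally show ?thesis .
    qed
    have h0: "(\<lambda>n. 32 * M / R\<^sup>2 * h n) \<longlonglongrightarrow> 32 * M / R\<^sup>2 * (R / 2 * 0)"
      unfolding h_def using LIMSEQ_inverse_real_of_nat
      by (intro tendsto_mult_left) (auto simp: field_simps dest: tendsto_mult_left[of _ 0 _ "R/2"])
    show "uniform_limit (ball p R) F (wirtinger j f) sequentially"
    proof (rule uniform_limitI)
      fix e :: real assume "e > 0"
      with h0 have "\<forall>\<^sub>F n in sequentially. 32 * M / R\<^sup>2 * h n < e"
        by (intro order_tendstoD) auto
      then show "\<forall>\<^sub>F n in sequentially. \<forall>z\<in>ball p R. dist (F n z) (wirtinger j f z) < e"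
        by eventually_elim (use est in \<open>blast intro: le_less_trans\<close>)
    qed
  qed
qed

text \<open>As dimensions are types, \<open>complex^('n + 'm)\<close> serves as the product of \<open>complex^'n\<close> and \<open>complex^'m\<close>.\<close>

definition join :: "complex^'n::finite \<Rightarrow> complex^'m::finite \<Rightarrow> complex^('n + 'm)" where
  "join x y = (\<chi> i. case i of Inl j \<Rightarrow> x $ j | Inr j \<Rightarrow> y $ j)"

definition left_part :: "complex^('n::finite + 'm::finite) \<Rightarrow> complex^'n" where
  "left_part z = (\<chi> j. z $ Inl j)"

definition right_part :: "complex^('n::finite + 'm::finite) \<Rightarrow> complex^'m" where
  "right_part z = (\<chi> j. z $ Inr j)"

lemma join_simps [simp]: "left_part (join x y) = x" "right_part (join x y) = y"
  "join (left_part z) (right_part z) = z" "join x y $ Inl j = x $ j" "join x y $ Inr k = y $ k"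
  by (auto simp: join_def left_part_def right_part_def vec_eq_iff split: sum.splits)

lemma sum_UNIV_plus:
  fixes f :: "'n::finite + 'm::finite \<Rightarrow> 'a::comm_monoid_add"
  shows "(\<Sum>i\<in>UNIV. f i) = (\<Sum>j\<in>UNIV. f (Inl j)) + (\<Sum>j\<in>UNIV. f (Inr j))"
  unfolding UNIV_Plus_UNIV[symmetric] by (subst sum.Plus) auto

lemma norm_join: "(norm (join x y))\<^sup>2 = (norm x)\<^sup>2 + (norm y)\<^sup>2"
  by (simp add: norm_vec_def L2_set_def sum_nonneg sum_UNIV_plus)

lemma norm_parts: "norm (left_part z) \<le> norm z" "norm (right_part z) \<le> norm z"
  using norm_join[of "left_part z" "right_part z"]
  by (simp_all add: power2_le_imp_le)

lemma norm_join_le: "norm (join x y) \<le> norm x + norm y"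
  by (rule power2_le_imp_le) (auto simp: norm_join power2_sum)

lemma parts_diff: "left_part (z - w) = left_part z - left_part w"
  "right_part (z - w) = right_part z - right_part w"
  by (simp_all add: left_part_def right_part_def vec_eq_iff)

lemma join_diff: "join x y - join x' y' = join (x - x') (y - y')"
  by (auto simp: join_def vec_eq_iff split: sum.splits)

lemma join_add: "join x y + join x' y' = join (x + x') (y + y')"
  by (auto simp: join_def vec_eq_iff split: sum.splits)

text \<open>Osgood's lemma.  The increment of \<open>H\<close> splits into one increment in each variable, with quadratic errors, and a
  mixed second difference; the latter is of second order because the Lipschitz estimate applies in either variable.\<close>

lemma holomorphic_fun_separately:
  fixes H :: "complex^('n::finite + 'm::finite) \<Rightarrow> complex"
  assumes bd: "\<And>\<zeta>. \<zeta> \<in> S \<Longrightarrow> \<exists>R>0. \<exists>M. ball \<zeta> R \<subseteq> S \<and> (\<forall>\<xi>\<in>ball \<zeta> R. norm (H \<xi>) \<le> M)"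
    and left: "\<And>y. holomorphic_fun {x. join x y \<in> S} (\<lambda>x. H (join x y))"
    and right: "\<And>x. holomorphic_fun {y. join x y \<in> S} (\<lambda>y. H (join x y))"
  shows "holomorphic_fun S H"
  unfolding holomorphic_fun_def
proof
  fix \<zeta> assume "\<zeta> \<in> S"
  then obtain R M where R: "R > 0" "ball \<zeta> R \<subseteq> S" and M: "\<And>\<xi>. \<xi> \<in> ball \<zeta> R \<Longrightarrow> norm (H \<xi>) \<le> M"
    using bd by blast
  define x0 y0 r where "x0 = left_part \<zeta>" "y0 = right_part \<zeta>" "r = R / 2"
  have z: "\<zeta> = join x0 y0" and r: "r > 0" using R(1) by (simp_all add: x0_y0_r_def)
  have poly: "join x y \<in> ball \<zeta> R" if "x \<in> ball x0 r" "y \<in> ball y0 r" for x y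
    using that norm_join_le[of "x0 - x" "y0 - y"]
    by (simp add: z dist_norm join_diff x0_y0_r_def(3))
  have M0: "M \<ge> 0" using M[of \<zeta>] R(1) by (smt (verit) centre_in_ball norm_ge_zero)
  have bdM: "norm (H (join x y)) \<le> M" if "x \<in> ball x0 r" "y \<in> ball y0 r" for x y
    using M poly that by blast
  have hl: "holomorphic_fun (ball x0 r) (\<lambda>x. H (join x y))" if "y \<in> ball y0 r" for y
    by (rule holomorphic_fun_subset[OF left]) (use poly that R in auto)
  have hr: "holomorphic_fun (ball y0 r) (\<lambda>y. H (join x y))" if "x \<in> ball x0 r" for x
    by (rule holomorphic_fun_subset[OF right]) (use poly that R in auto)
  define a where "a i = (case i of Inl j \<Rightarrow> wirtinger j (\<lambda>x. H (join x y0)) x0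
                                 | Inr j \<Rightarrow> wirtinger j (\<lambda>y. H (join x0 y)) y0)" for i
  define C where "C = 80 * M / r\<^sup>2"
  have "(H has_derivative (\<lambda>v. \<Sum>i\<in>UNIV. v $ i * a i)) (at \<zeta>)"
  proof (rule has_derivative_if_quadratic_error)
    show "r / 2 > 0" using r by simp
    fix v :: "complex^('n + 'm)" assume v: "norm v < r / 2"
    define s t where "s = left_part v" "t = right_part v"
    have st: "v = join s t" "norm s \<le> norm v" "norm t \<le> norm v"
      by (simp_all add: s_t_def norm_parts)
    \<comment> \<open>F is holomorphic and of order |v|, so its increment over s is of order |v| * |v|\<close>
    define F where "F x = H (join x (y0 + t)) - H (join x y0)" for x
    have c0: "x0 \<in> ball x0 r" "y0 \<in> ball y0 r" "y0 + t \<in> ball y0 r" using r v st by (auto simp: dist_norm)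
    have F: "holomorphic_fun (ball x0 r) F"
      unfolding F_def by (intro holomorphic_fun_diff hl c0)
    have Fb: "norm (F x) \<le> 4 * M / r * norm v" if "x \<in> ball x0 r" for x
    proof -
      have "norm (F x) \<le> 4 * M / r * norm (y0 + t - y0)"
        unfolding F_def using r v st
        by (intro holomorphic_fun_lipschitz[OF hr[OF that] r bdM[OF that]]) (auto simp: dist_norm)
      also have "\<dots> \<le> 4 * M / r * norm v"
        using st M0 r by (intro mult_left_mono) auto
      finally show ?thesis .
    qed
    have 1: "norm (F (x0 + s) - F x0) \<le> 4 * (4 * M / r * norm v) / r * norm (x0 + s - x0)"
      using r v st by (intro holomorphic_fun_lipschitz[OF F r Fb]) (auto simp: dist_norm)
    also have "\<dots> \<le> 4 * (4 * M / r * norm v) / r * norm v"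
      using st M0 r by (intro mult_left_mono) auto
    also have "\<dots> = 16 * M / r\<^sup>2 * (norm v)\<^sup>2" by (simp add: power2_eq_square)
    finally have e1: "norm (F (x0 + s) - F x0) \<le> 16 * M / r\<^sup>2 * (norm v)\<^sup>2" .
    have "norm (H (join (x0 + s) y0) - H (join x0 y0) - complex_differential (\<lambda>x. H (join x y0)) x0 s)
        \<le> 32 * M * (norm s)\<^sup>2 / r\<^sup>2"
      using v st by (intro holomorphic_fun_estimates(2)[OF hl[OF c0(2)] r] bdM c0) auto
    also have "\<dots> \<le> 32 * M / r\<^sup>2 * (norm v)\<^sup>2"
      using st(2) M0 by (auto intro!: divide_right_mono mult_left_mono power_mono)
    finally have e2: "norm (H (join (x0 + s) y0) - H (join x0 y0)
        - complex_differential (\<lambda>x. H (join x y0)) x0 s) \<le> 32 * M / r\<^sup>2 * (norm v)\<^sup>2" .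
    have "norm (H (join x0 (y0 + t)) - H (join x0 y0) - complex_differential (\<lambda>y. H (join x0 y)) y0 t)
        \<le> 32 * M * (norm t)\<^sup>2 / r\<^sup>2"
      using v st by (intro holomorphic_fun_estimates(2)[OF hr[OF c0(1)] r] bdM c0) auto
    also have "\<dots> \<le> 32 * M / r\<^sup>2 * (norm v)\<^sup>2"
      using st(3) M0 by (auto intro!: divide_right_mono mult_left_mono power_mono)
    finally have e3: "norm (H (join x0 (y0 + t)) - H (join x0 y0)
        - complex_differential (\<lambda>y. H (join x0 y)) y0 t) \<le> 32 * M / r\<^sup>2 * (norm v)\<^sup>2" .
    have lin: "(\<Sum>i\<in>UNIV. v $ i * a i) = complex_differential (\<lambda>x. H (join x y0)) x0 s
        + complex_differential (\<lambda>y. H (join x0 y)) y0 t"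
      by (simp add: sum_UNIV_plus complex_differential_def a_def st(1))
    have split: "H (\<zeta> + v) - H \<zeta> - (\<Sum>i\<in>UNIV. v $ i * a i) = (F (x0 + s) - F x0)
       + (H (join (x0 + s) y0) - H (join x0 y0) - complex_differential (\<lambda>x. H (join x y0)) x0 s)
       + (H (join x0 (y0 + t)) - H (join x0 y0) - complex_differential (\<lambda>y. H (join x0 y)) y0 t)"
      unfolding lin F_def unfolding z st(1) join_add by simp
    have "norm (H (\<zeta> + v) - H \<zeta> - (\<Sum>i\<in>UNIV. v $ i * a i)) \<le>
       16 * M / r\<^sup>2 * (norm v)\<^sup>2 + 32 * M / r\<^sup>2 * (norm v)\<^sup>2 + 32 * M / r\<^sup>2 * (norm v)\<^sup>2"
      unfolding split by (intro norm_triangle_mono e1 e2 e3)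
    then show "norm (H (\<zeta> + v) - H \<zeta> - (\<Sum>i\<in>UNIV. v $ i * a i)) \<le> C * (norm v)\<^sup>2"
      by (simp add: C_def field_simps)
  qed
  then show "\<exists>f'. (H has_derivative f') (at \<zeta>) \<and> (\<forall>c v. f' (c *s v) = c * f' v)"
    by (rule holomorphic_at)
qed

section \<open>Holomorphic change of variables\<close>

text \<open>A numbering of the real and imaginary parts of the coordinates.  The index type \<open>'n bit0\<close> has twice as many
  elements as \<open>'n\<close> and is well-ordered, as the real change of variables theorem requires.\<close>

definition real_index :: "'n::finite bit0 \<Rightarrow> 'n \<times> bool" where
  "real_index = (SOME e. bij e)"

lemma bij_real_index: "bij (real_index :: 'n::finite bit0 \<Rightarrow> 'n \<times> bool)"
proof -
  have "card (UNIV :: 'n bit0 set) = card (UNIV :: ('n \<times> bool) set)"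
    by simp
  then have "\<exists>e :: 'n bit0 \<Rightarrow> 'n \<times> bool. bij e"
    by (metis finite finite_same_card_bij)
  then show ?thesis unfolding real_index_def by (rule someI_ex)
qed

definition from_real :: "real^('n::finite bit0) \<Rightarrow> complex^'n" where
  "from_real x = (\<chi> j. Complex (x $ inv real_index (j, False)) (x $ inv real_index (j, True)))"

definition to_real :: "complex^'n::finite \<Rightarrow> real^('n bit0)" where
  "to_real z = (\<chi> i. if snd (real_index i) then Im (z $ fst (real_index i)) else Re (z $ fst (real_index i)))"

lemma real_index_inv [simp]: "real_index (inv real_index y) = y" "inv real_index (real_index i) = i"
  by (rule surj_f_inv_f[OF bij_is_surj[OF bij_real_index]],
      rule inv_f_f[OF bij_is_inj[OF bij_real_index]])

lemma from_to_real [simp]: "from_real (to_real z) = z"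
  by (simp add: from_real_def to_real_def vec_eq_iff)

lemma to_from_real [simp]: "to_real (from_real x) = x"
proof -
  have "to_real (from_real x) $ i = x $ i" for i
  proof (cases "real_index i")
    case (Pair j b)
    then have "i = inv real_index (j, b)" by (metis real_index_inv(2))
    with Pair show ?thesis by (cases b) (auto simp: from_real_def to_real_def)
  qed
  then show ?thesis by (simp add: vec_eq_iff)
qed

lemma inner_to_real: "to_real z \<bullet> to_real w = z \<bullet> w"
proof -
  have "to_real z \<bullet> to_real w = (\<Sum>i\<in>UNIV. (\<lambda>(j, b). if b then Im (z $ j) * Im (w $ j)
        else Re (z $ j) * Re (w $ j)) (real_index i))"
    by (auto simp: inner_vec_def to_real_def case_prod_beta intro!: sum.cong)
  also have "\<dots> = (\<Sum>(j, b)\<in>UNIV. if b then Im (z $ j) * Im (w $ j) else Re (z $ j) * Re (w $ j))"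
    by (rule sum.reindex_bij_betw) (use bij_real_index in \<open>simp add: bij_def bij_betw_def\<close>)
  also have "\<dots> = z \<bullet> w"
    by (simp add: inner_vec_def inner_complex_def UNIV_bool add.commute
        sum.cartesian_product[symmetric] flip: UNIV_Times_UNIV)
  finally show ?thesis .
qed

lemma inner_from_real: "from_real x \<bullet> from_real y = x \<bullet> y"
  by (metis inner_to_real to_from_real)

lemma linear_to_real: "linear to_real"
  by (rule linearI) (auto simp: to_real_def vec_eq_iff)

lemma linear_from_real: "linear from_real"
  by (rule linearI) (auto simp: from_real_def vec_eq_iff complex_eq_iff)

lemma from_real_Basis: "bij_betw from_real Basis (Basis :: (complex^'n::finite) set)"
proof -
  have *: "from_real (axis i 1) = axis (fst (real_index i)) (if snd (real_index i) then \<i> else 1)" for i :: "'n bit0"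
  proof -
    have "inv real_index (j, b) = i \<longleftrightarrow> real_index i = (j, b)" for j b
      by (metis real_index_inv)
    then show ?thesis
      by (cases "real_index i") (auto simp: from_real_def axis_def vec_eq_iff complex_eq_iff)
  qed
  have B: "(Basis :: (real^('n bit0)) set) = range (\<lambda>i. axis i 1)"
    by (auto simp: Basis_vec_def)
  have "from_real ` Basis = (Basis :: (complex^'n) set)"
  proof
    show "from_real ` Basis \<subseteq> (Basis :: (complex^'n) set)"
      by (auto simp: B * Basis_vec_def Basis_complex_def)
    show "(Basis :: (complex^'n) set) \<subseteq> from_real ` Basis"
    proof
      fix b :: "complex^'n" assume "b \<in> Basis"
      then obtain j u where "b = axis j u" "u = 1 \<or> u = \<i>"
        by (auto simp: Basis_vec_def Basis_complex_def)
      then have "b = from_real (axis (inv real_index (j, u = \<i>)) 1)"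
        by (elim disjE) (simp_all add: * complex_i_not_one[symmetric])
      then show "b \<in> from_real ` Basis" by (auto simp: B)
    qed
  qed
  moreover have "inj from_real" by (metis injI to_from_real)
  ultimately show ?thesis by (auto simp: bij_betw_def intro: inj_on_subset)
qed

lemma lborel_from_real: "lborel = distr lborel borel (from_real :: _ \<Rightarrow> complex^'n::finite)"
proof (rule lborel_eqI)
  have meas: "(from_real :: _ \<Rightarrow> complex^'n) \<in> borel_measurable lborel"
    using borel_measurable_continuous_onI[OF linear_continuous_on[OF
          linear_conv_bounded_linear[THEN iffD1, OF linear_from_real]]] by simp
  fix l u :: "complex^'n" assume lu: "\<And>b. b \<in> Basis \<Longrightarrow> l \<bullet> b \<le> u \<bullet> b"
  have ball: "(\<forall>b\<in>(Basis :: (complex^'n) set). P b) \<longleftrightarrow> (\<forall>b\<in>Basis. P (from_real b))" for P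
    using from_real_Basis[where 'n = 'n] unfolding bij_betw_def by (metis ball_imageD image_eqI imageE)
  have inner: "x \<bullet> from_real b = to_real x \<bullet> b" for x and b :: "real^('n bit0)"
    by (metis inner_to_real to_from_real)
  have "from_real -` box l u = box (to_real l) (to_real u)"
    by (auto simp: mem_box ball inner)
  moreover have "to_real l \<bullet> b \<le> to_real u \<bullet> b" if "b \<in> Basis" for b
    using lu[of "from_real b"] bij_betwE[OF from_real_Basis[where 'n = 'n]] that by (simp add: inner)
  ultimately have "emeasure (distr lborel borel from_real) (box l u)
      = (\<Prod>b\<in>Basis. (to_real u - to_real l) \<bullet> b)"
    using meas by (simp add: emeasure_distr)
  also have "(\<Prod>b\<in>Basis. (to_real u - to_real l) \<bullet> b) = (\<Prod>b\<in>Basis. (u - l) \<bullet> from_real b)"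
    by (intro prod.cong refl) (simp add: inner linear_diff[OF linear_to_real])
  also have "\<dots> = (\<Prod>b\<in>Basis. (u - l) \<bullet> b)"
    by (rule prod.reindex_bij_betw[OF from_real_Basis])
  finally show "emeasure (distr lborel borel from_real) (box l u) = ennreal (\<Prod>b\<in>Basis. (u - l) \<bullet> b)" .
qed simp

definition real_matrix :: "complex^'n::finite^'n \<Rightarrow> real^('n bit0)^('n bit0)" where
  "real_matrix A = matrix (\<lambda>x. to_real (A *v from_real x))"

lemma linear_matrix_vector: "linear (\<lambda>x. A *v x)" for A :: "complex^'n::finite^'m::finite"
  by (rule linearI)
    (auto simp: matrix_vector_mult_def vec_eq_iff algebra_simps sum.distrib scaleR_sum_right)

lemma linear_real_map: "linear (\<lambda>x. to_real (A *v from_real x))"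
  using linear_compose[OF linear_from_real linear_compose[OF linear_matrix_vector linear_to_real]]
  by (simp add: o_def)

lemma real_matrix_mult: "real_matrix (A ** B) = real_matrix A ** real_matrix B"
proof -
  have "(\<lambda>x. to_real (A ** B *v from_real x)) =
      (\<lambda>x. to_real (A *v from_real x)) o (\<lambda>x. to_real (B *v from_real x))"
    by (simp add: fun_eq_iff matrix_vector_mul_assoc)
  then show ?thesis
    unfolding real_matrix_def by (simp add: matrix_compose linear_real_map)
qed

lemma real_matrix_one: "real_matrix (mat 1) = mat 1"
  by (simp add: real_matrix_def) (simp add: matrix_def axis_def mat_def vec_eq_iff)

lemma det_real_matrix_nonzero:
  assumes "invertible A"
  shows "det (real_matrix A) \<noteq> 0"
proof -
  obtain B where "A ** B = mat 1" using assms unfolding invertible_def by blast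
  then have "det (real_matrix A) * det (real_matrix B) = 1"
    by (metis det_I det_mul real_matrix_mult real_matrix_one)
  then show ?thesis by auto
qed

lemma replace_column_mult:
  "replace_column k (axis k a) ** replace_column k b = replace_column k (\<chi> i. if i = k then a * b $ k else b $ i)"
  "replace_column k b ** replace_column k (axis k a) = replace_column k (a *s b)"
  "u $ k = 0 \<Longrightarrow> replace_column k (axis k 1 + u) ** replace_column k (axis k 1 + u)
     = replace_column k (axis k 1 + 2 *s u)"
  by (rule matrix_eq_axis; auto simp: replace_column_mult_vec axis_def vec_eq_iff algebra_simps
      simp flip: matrix_vector_mul_assoc)+

text \<open>Both sides are multiplicative, which leaves the matrices \<open>replace_column k c\<close>.  They factor into a
  unit scalar in coordinate \<open>k\<close> (an isometry), a positive scalar (a real diagonal matrix with two such entries) and a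
  shear.  A shear is conjugate to its own square, so its determinant has absolute value 1.\<close>

lemma det_real_matrix:
  assumes "invertible A"
  shows "\<bar>det (real_matrix A)\<bar> = (cmod (det A))\<^sup>2"
  using assms
proof (induction rule: invertible_matrix_induct)
  case mat_one
  then show ?case by (simp add: real_matrix_one)
next
  case (mult A B)
  then show ?case by (simp add: real_matrix_mult det_mul abs_mult norm_mult power_mult_distrib)
next
  case (column k c)
  define \<Delta> where "\<Delta> c = \<bar>det (real_matrix (replace_column k c))\<bar>" for c
  have unit: "\<Delta> (axis k a) = 1" if "cmod a = 1" for a
  proof -
    let ?D = "replace_column k (axis k a)"
    have "norm (?D *v x) = norm x" for x
    proof -
      have "norm ((?D *v x) $ i) = norm (x $ i)" for i
        using that by (auto simp: replace_column_mult_vec axis_def algebra_simps norm_mult)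
      then show ?thesis by (simp add: norm_vec_def)
    qed
    then have "orthogonal_transformation (\<lambda>x. to_real (?D *v from_real x))"
      by (simp add: orthogonal_transformation linear_real_map norm_eq_sqrt_inner inner_to_real inner_from_real)
    then show ?thesis unfolding \<Delta>_def real_matrix_def by simp
  qed
  have real: "\<Delta> (axis k (of_real r)) = r\<^sup>2" for r
  proof -
    let ?D = "replace_column k (axis k (complex_of_real r))"
    have entry: "to_real (?D *v from_real x) $ i = (if fst (real_index i) = k then r else 1) * x $ i" for x i
    proof -
      have "(?D *v z) $ j = of_real (if j = k then r else 1) * z $ j" for z j
        by (simp add: replace_column_mult_vec axis_def algebra_simps)
      then have "to_real (?D *v from_real x) $ i
         = (if fst (real_index i) = k then r else 1) * to_real (from_real x) $ i"
        unfolding to_real_def by simp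
      then show ?thesis by simp
    qed
    have ax: "axis j (1::real) $ i = (if i = j then 1 else 0)" for i j :: "'a bit0"
      by (simp add: axis_def)
    have "det (real_matrix ?D) = (\<Prod>i\<in>UNIV. real_matrix ?D $ i $ i)"
      by (rule det_diagonal) (auto simp: real_matrix_def matrix_def entry ax)
    also have "\<dots> = (\<Prod>i\<in>UNIV. (\<lambda>(j, b). if j = k then r else 1) (real_index i))"
      by (intro prod.cong) (auto simp: real_matrix_def matrix_def entry ax split: prod.split)
    also have "\<dots> = (\<Prod>(j, b :: bool)\<in>UNIV. if j = k then r else 1)"
      by (rule prod.reindex_bij_betw) (use bij_real_index in \<open>simp add: bij_def bij_betw_def\<close>)
    also have "\<dots> = r\<^sup>2"
      by (simp add: UNIV_bool power2_eq_square prod.distrib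
          prod.cartesian_product[symmetric] flip: UNIV_Times_UNIV)
    finally show ?thesis by (simp add: \<Delta>_def)
  qed
  have shear: "\<Delta> (axis k 1 + u) = 1" if u: "u $ k = 0" for u
  proof -
    have nz: "\<Delta> b \<noteq> 0" if "b $ k \<noteq> 0" for b
      unfolding \<Delta>_def using det_real_matrix_nonzero[OF invertible_replace_column[OF that]] by simp
    \<comment> \<open>conjugation by a scaling with factor 2 relates the shear to its square\<close>
    have "replace_column k (axis k 2) ** replace_column k (axis k 1 + 2 *s u)
        = replace_column k (axis k 1 + u) ** replace_column k (axis k 2)"
      unfolding replace_column_mult using u
      by (intro arg_cong[of _ _ "replace_column k"]) (auto simp: vec_eq_iff axis_def)
    then have "\<Delta> (axis k 2) * (\<Delta> (axis k 1 + u) * \<Delta> (axis k 1 + u)) = \<Delta> (axis k 1 + u) * \<Delta> (axis k 2)"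
      unfolding \<Delta>_def abs_mult[symmetric] det_mul[symmetric] real_matrix_mult[symmetric]
        replace_column_mult(3)[of u, OF u] by simp
    then show ?thesis using nz[of "axis k 2"] nz[of "axis k 1 + u"] u by simp
  qed
  define a r where "a = c $ k" and "r = cmod (c $ k)"
  have r: "r \<noteq> 0" "cmod (a / of_real r) = 1"
    using column by (simp_all add: r_def a_def norm_divide)
  define u where "u = (\<chi> i. if i = k then 0 else c $ i)"
  have "replace_column k c = replace_column k (axis k a) ** replace_column k (axis k 1 + u)"
    unfolding replace_column_mult
    by (intro arg_cong[of _ _ "replace_column k"]) (auto simp: vec_eq_iff axis_def u_def a_def)
  moreover have "replace_column k (axis k a)
      = replace_column k (axis k (of_real r)) ** replace_column k (axis k (a / of_real r))"
    unfolding replace_column_mult using r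
    by (intro arg_cong[of _ _ "replace_column k"]) (auto simp: vec_eq_iff axis_def)
  ultimately have "\<Delta> c = \<Delta> (axis k (of_real r)) * \<Delta> (axis k (a / of_real r)) * \<Delta> (axis k 1 + u)"
    by (simp add: \<Delta>_def real_matrix_mult det_mul abs_mult)
  also have "\<dots> = r\<^sup>2"
    by (simp add: real unit[OF r(2)] shear u_def)
  finally show ?case by (simp add: \<Delta>_def det_replace_column r_def)
qed

definition jacobian :: "(complex^'n::finite \<Rightarrow> complex^'m::finite) \<Rightarrow> complex^'n \<Rightarrow> complex^'n^'m" where
  "jacobian F z = (\<chi> i j. wirtinger j (\<lambda>z. F z $ i) z)"

lemma has_derivative_jacobian:
  assumes "holomorphic_map S F" "p \<in> S"
  shows "(F has_derivative (\<lambda>v. jacobian F p *v v)) (at p)"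
proof -
  have "(\<chi> i. complex_differential (\<lambda>z. F z $ i) p v) = jacobian F p *v v" for v
    by (simp add: vec_eq_iff complex_differential_def jacobian_def matrix_vector_mult_def mult.commute)
  then show ?thesis using has_derivative_holomorphic_map[OF assms] by simp
qed

lemma holomorphic_fun_det_jacobian:
  assumes "open S" "holomorphic_map S F"
  shows "holomorphic_fun S (\<lambda>z. det (jacobian F z))"
proof (rule holomorphic_fun_det)
  fix i j
  have "holomorphic_fun S (wirtinger j (\<lambda>z. F z $ i))"
    using assms by (intro holomorphic_fun_wirtinger) (auto simp: holomorphic_map_def)
  then show "holomorphic_fun S (\<lambda>z. jacobian F z $ i $ j)" by (simp add: jacobian_def)
qed

lemma set_integral_from_real:
  fixes h :: "complex^'n::finite \<Rightarrow> real"
  assumes [measurable]: "(\<lambda>x. indicator U x *\<^sub>R h x) \<in> borel_measurable borel"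
  shows "set_integrable lborel U h \<longleftrightarrow> (\<lambda>x. h (from_real x)) absolutely_integrable_on (from_real -` U)"
    and "set_integrable lborel U h \<Longrightarrow>
      (LINT z:U|lborel. h z) = integral (from_real -` U) (\<lambda>x. h (from_real x))"
proof -
  have meas[measurable]: "(from_real :: _ \<Rightarrow> complex^'n) \<in> borel_measurable borel"
    by (rule borel_measurable_continuous_onI[OF linear_continuous_on[OF
          linear_conv_bounded_linear[THEN iffD1, OF linear_from_real]]])
  have ind: "indicator U (from_real x) = (indicator (from_real -` U) x :: real)" for x
    by (simp add: indicator_def)
  have m2: "(\<lambda>x. indicator (from_real -` U) x *\<^sub>R h (from_real x)) \<in> borel_measurable borel"
    using measurable_compose[OF meas assms] by (simp add: ind)
  show 1: "set_integrable lborel U h \<longleftrightarrow> (\<lambda>x. h (from_real x)) absolutely_integrable_on (from_real -` U)"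
    unfolding set_integrable_def
    by (subst lborel_from_real, subst integrable_distr_eq) (use m2 assms in \<open>simp_all add: ind integrable_completion\<close>)
  assume "set_integrable lborel U h"
  then have "(\<lambda>x. h (from_real x)) absolutely_integrable_on (from_real -` U)" using 1 by blast
  note set_lebesgue_integral_eq_integral(2)[OF this, symmetric]
  also have "(LINT x:from_real -` U|lebesgue. h (from_real x)) = (LINT x:from_real -` U|lborel. h (from_real x))"
    unfolding set_lebesgue_integral_def using m2 by (simp add: integral_completion)
  also have "\<dots> = (LINT z:U|lborel. h z)"
    unfolding set_lebesgue_integral_def
    by (subst lborel_from_real, subst integral_distr) (use assms in \<open>simp_all add: ind\<close>)
  finally show "(LINT z:U|lborel. h z) = integral (from_real -` U) (\<lambda>x. h (from_real x))" by simp
qed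

lemma real_change_of_variables:
  fixes h :: "complex^'n::finite \<Rightarrow> real"
  assumes S: "open S" and F: "holomorphic_map S F" "inj_on F S"
    and J: "\<And>z. z \<in> S \<Longrightarrow> det (jacobian F z) \<noteq> 0"
    and FS: "open (F ` S)" and h: "continuous_on (F ` S) h" "set_integrable lborel (F ` S) h"
  shows "set_integrable lborel S (\<lambda>z. (cmod (det (jacobian F z)))\<^sup>2 * h (F z))"
    and "(LINT z:S|lborel. (cmod (det (jacobian F z)))\<^sup>2 * h (F z)) = (LINT z:F ` S|lborel. h z)"
proof -
  define T where "T = (from_real -` S :: (real^('n bit0)) set)"
  define G where "G = (\<lambda>x. to_real (F (from_real x)))"
  have bl: "bounded_linear (from_real :: _ \<Rightarrow> complex^'n)" "bounded_linear (to_real :: complex^'n \<Rightarrow> _)"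
    using linear_from_real linear_to_real by (auto simp: linear_conv_bounded_linear)
  have T: "open T" unfolding T_def
    using S linear_continuous_on[OF bl(1)] by (intro open_vimage) auto
  have GT: "G ` T = from_real -` (F ` S)"
  proof
    show "G ` T \<subseteq> from_real -` (F ` S)" by (auto simp: G_def T_def)
    show "from_real -` (F ` S) \<subseteq> G ` T"
    proof
      fix x assume "x \<in> from_real -` (F ` S)"
      then obtain z where "z \<in> S" "from_real x = F z" by auto
      then have "x = G (to_real z)" "to_real z \<in> T" by (auto simp: G_def T_def dest: sym)
      then show "x \<in> G ` T" by blast
    qed
  qed
  have inj: "inj_on G T"
    using F(2) by (auto simp: inj_on_def G_def T_def) (metis from_to_real to_from_real)
  have G': "(G has_derivative (\<lambda>v. to_real (jacobian F (from_real x) *v from_real v))) (at x within T)"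
    if "x \<in> T" for x
  proof (rule has_derivative_at_withinI)
    have *: "(F has_derivative (*v) (jacobian F (from_real x))) (at (from_real x))"
      using has_derivative_jacobian[OF F(1)] that by (simp add: T_def)
    have "((to_real \<circ> (F \<circ> from_real)) has_derivative (to_real \<circ> ((*v) (jacobian F (from_real x)) \<circ> from_real))) (at x)"
      by (intro diff_chain_at * bounded_linear_imp_has_derivative bl)
    then show "(G has_derivative (\<lambda>v. to_real (jacobian F (from_real x) *v from_real v))) (at x)"
      by (simp add: G_def o_def)
  qed
  have detG: "\<bar>det (matrix (\<lambda>v. to_real (jacobian F (from_real x) *v from_real v)))\<bar>
      = (cmod (det (jacobian F (from_real x))))\<^sup>2" if "x \<in> T" for x
    using det_real_matrix[of "jacobian F (from_real x)"] J that
    by (simp add: real_matrix_def T_def invertible_det_nz)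
  have m1: "(\<lambda>z. indicator (F ` S) z *\<^sub>R h z) \<in> borel_measurable borel"
    using FS h(1) by (intro borel_measurable_continuous_on_indicator) auto
  have contF: "continuous_on S F"
    by (meson F(1) continuous_at_imp_continuous_on has_derivative_continuous has_derivative_jacobian)
  have "continuous_on S (\<lambda>z. (cmod (det (jacobian F z)))\<^sup>2 * h (F z))"
    using holomorphic_fun_continuous[OF holomorphic_fun_det_jacobian[OF S F(1)]]
      continuous_on_compose2[OF h(1) contF]
    by (intro continuous_intros) auto
  then have m2: "(\<lambda>z. indicator S z *\<^sub>R ((cmod (det (jacobian F z)))\<^sup>2 * h (F z))) \<in> borel_measurable borel"
    using S by (intro borel_measurable_continuous_on_indicator) auto
  let ?h = "\<lambda>x. h (from_real x)"
  let ?D = "\<lambda>x. \<bar>det (matrix (\<lambda>v. to_real (jacobian F (from_real x) *v from_real v)))\<bar>"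
  have "?h absolutely_integrable_on (G ` T)"
    using h(2) set_integral_from_real(1)[OF m1] by (simp add: GT)
  moreover have "T \<in> sets lebesgue" by (intro sets_completionI_sets) (simp add: T)
  ultimately have *: "(\<lambda>x. ?D x * ?h (G x)) absolutely_integrable_on T"
     "integral T (\<lambda>x. ?D x * ?h (G x)) = integral (G ` T) ?h"
    using has_absolute_integral_change_of_variables[of T G
        "\<lambda>x v. to_real (jacobian F (from_real x) *v from_real v)" "\<lambda>x. vec (?h x) :: real^1"
        "vec (integral (G ` T) ?h)", OF _ G' inj]
    unfolding absolutely_integrable_on_1_iff integral_on_1_eq by (auto simp: vec_eq_iff)
  have eq: "?D x * ?h (G x) = (cmod (det (jacobian F (from_real x))))\<^sup>2 * h (F (from_real x))"
    if "x \<in> T" for x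
    using detG[OF that] by (simp add: G_def)
  have "(\<lambda>x. (cmod (det (jacobian F (from_real x))))\<^sup>2 * h (F (from_real x))) absolutely_integrable_on T"
    using *(1) by (rule set_integrable_cong[THEN iffD1, rotated -1]) (auto simp: eq)
  then show int: "set_integrable lborel S (\<lambda>z. (cmod (det (jacobian F z)))\<^sup>2 * h (F z))"
    using set_integral_from_real(1)[OF m2] by (simp add: T_def)
  have "(LINT z:S|lborel. (cmod (det (jacobian F z)))\<^sup>2 * h (F z))
      = integral T (\<lambda>x. (cmod (det (jacobian F (from_real x))))\<^sup>2 * h (F (from_real x)))"
    using set_integral_from_real(2)[OF m2 int] by (simp add: T_def)
  also have "\<dots> = integral T (\<lambda>x. ?D x * ?h (G x))"
    by (rule Henstock_Kurzweil_Integration.integral_cong) (simp add: eq)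
  also have "\<dots> = (LINT z:F ` S|lborel. h z)"
    using *(2) set_integral_from_real(2)[OF m1 h(2)] by (simp add: GT)
  finally show "(LINT z:S|lborel. (cmod (det (jacobian F z)))\<^sup>2 * h (F z)) = (LINT z:F ` S|lborel. h z)" .
qed

lemma set_integrable_Re_Im:
  fixes f :: "'a \<Rightarrow> complex"
  shows "set_integrable M S f \<longleftrightarrow> set_integrable M S (\<lambda>x. Re (f x)) \<and> set_integrable M S (\<lambda>x. Im (f x))"
proof
  assume "set_integrable M S f"
  then show "set_integrable M S (\<lambda>x. Re (f x)) \<and> set_integrable M S (\<lambda>x. Im (f x))"
    unfolding set_integrable_def using integrable_Re integrable_Im by fastforce
next
  assume *: "set_integrable M S (\<lambda>x. Re (f x)) \<and> set_integrable M S (\<lambda>x. Im (f x))"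
  then have "integrable M (\<lambda>x. complex_of_real (indicator S x *\<^sub>R Re (f x))
      + \<i> * complex_of_real (indicator S x *\<^sub>R Im (f x)))"
    unfolding set_integrable_def
    by (intro Bochner_Integration.integrable_add integrable_mult_right integrable_of_real) auto
  moreover have "complex_of_real (indicator S x *\<^sub>R Re (f x)) + \<i> * complex_of_real (indicator S x *\<^sub>R Im (f x))
      = indicator S x *\<^sub>R f x" for x
    by (simp add: complex_eq_iff)
  ultimately show "set_integrable M S f" unfolding set_integrable_def by simp
qed

lemma set_integral_Re_Im:
  fixes f :: "'a \<Rightarrow> complex"
  assumes "set_integrable M S f"
  shows "(LINT x:S|M. f x) = Complex (LINT x:S|M. Re (f x)) (LINT x:S|M. Im (f x))"
  using integral_Re[OF assms[unfolded set_integrable_def]] integral_Im[OF assms[unfolded set_integrable_def]]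
  by (simp add: set_lebesgue_integral_def complex_eq_iff)

text \<open>The substitution rule for a holomorphic map; the real Jacobian determinant is the squared modulus of the complex one.\<close>

theorem holomorphic_change_of_variables:
  fixes f :: "complex^'n::finite \<Rightarrow> complex"
  assumes S: "open S" and F: "holomorphic_map S F" "inj_on F S"
    and J: "\<And>z. z \<in> S \<Longrightarrow> det (jacobian F z) \<noteq> 0"
    and FS: "open (F ` S)" and f: "continuous_on (F ` S) f" "set_integrable lborel (F ` S) f"
  shows "set_integrable lborel S (\<lambda>z. of_real ((cmod (det (jacobian F z)))\<^sup>2) * f (F z))"
    and "(LINT z:S|lborel. of_real ((cmod (det (jacobian F z)))\<^sup>2) * f (F z)) = (LINT z:F ` S|lborel. f z)"
proof -
  have c: "continuous_on (F ` S) (\<lambda>z. Re (f z))" "continuous_on (F ` S) (\<lambda>z. Im (f z))"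
    using f(1) by (auto intro: continuous_intros)
  have i: "set_integrable lborel (F ` S) (\<lambda>z. Re (f z))" "set_integrable lborel (F ` S) (\<lambda>z. Im (f z))"
    using f(2) set_integrable_Re_Im by blast+
  note re = real_change_of_variables[OF S F J FS c(1) i(1)]
  note im = real_change_of_variables[OF S F J FS c(2) i(2)]
  show int: "set_integrable lborel S (\<lambda>z. of_real ((cmod (det (jacobian F z)))\<^sup>2) * f (F z))"
    unfolding set_integrable_Re_Im using re(1) im(1) by (simp del: of_real_power)
  show "(LINT z:S|lborel. of_real ((cmod (det (jacobian F z)))\<^sup>2) * f (F z)) = (LINT z:F ` S|lborel. f z)"
    unfolding set_integral_Re_Im[OF int] set_integral_Re_Im[OF f(2)] using re(2) im(2)
    by (simp del: of_real_power)
qed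

section \<open>The mean value property and the Bergman space\<close>

text \<open>Cauchy's integral formula at the centre of the unit circle.\<close>

lemma circle_mean_value:
  assumes "f holomorphic_on ball 0 R" "R > 1"
  shows "set_integrable lborel {0..1} (\<lambda>t. f (exp (2 * of_real pi * \<i> * of_real t)))"
    and "(LINT t:{0..1}|lborel. f (exp (2 * of_real pi * \<i> * of_real t))) = f 0"
proof -
  let ?e = "\<lambda>t. exp (2 * of_real pi * \<i> * complex_of_real t)"
  have e: "?e t \<in> ball 0 R" for t
    using assms(2) by (simp add: norm_exp)
  have hol: "f holomorphic_on cball 0 1"
    using assms by (auto intro: holomorphic_on_subset)
  have "((\<lambda>u. f u / (u - 0)) has_contour_integral 2 * of_real pi * \<i> * f 0) (circlepath 0 1)"
    using hol by (intro Cauchy_integral_circlepath_simple) auto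
  then have "((\<lambda>t. f (?e t) / ?e t * (2 * of_real pi * \<i> * ?e t)) has_integral 2 * of_real pi * \<i> * f 0) {0..1}"
    unfolding has_contour_integral_def
    by (rule has_integral_eq[rotated])
      (simp add: vector_derivative_circlepath01, simp add: circlepath mult_ac)
  from has_integral_mult_right[OF this, of "inverse (2 * of_real pi * \<i>)"]
  have hi: "((\<lambda>t. f (?e t)) has_integral f 0) {0..1}"
    by (simp add: field_simps)
  have "continuous_on {0..1} (\<lambda>t. f (?e t))"
    using e by (intro continuous_on_compose2[OF holomorphic_on_imp_continuous_on[OF assms(1)]])
      (auto intro!: continuous_intros)
  then show si: "set_integrable lborel {0..1} (\<lambda>t. f (?e t))"
    unfolding set_integrable_def by (intro borel_integrable_compact) auto
  show "(LINT t:{0..1}|lborel. f (?e t)) = f 0"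
    using set_borel_integral_eq_integral(2)[OF si] hi by (simp add: integral_unique)
qed

lemma continuous_imp_set_borel_measurable:
  fixes f :: "'a::euclidean_space \<Rightarrow> 'b::euclidean_space"
  assumes "open S" "continuous_on S f"
  shows "set_borel_measurable lborel S f"
  unfolding set_borel_measurable_def
  using assms by (simp add: borel_measurable_continuous_on_indicator)

lemma jacobian_rotation:
  fixes p :: "complex^'n::finite"
  shows "jacobian (\<lambda>z. p + c *s (z - p)) z = (\<chi> i j. c * mat 1 $ i $ j)"
proof -
  have "wirtinger j (\<lambda>z. (p + c *s (z - p)) $ i) z = c * mat 1 $ i $ j" for i j
  proof -
    have "((\<lambda>z. (p + c *s (z - p)) $ i) has_derivative (\<lambda>v. 0 + c * (v $ i - 0))) (at z)"
      unfolding vector_add_component vector_smult_component vector_minus_component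
      by (intro has_derivative_add has_derivative_const has_derivative_mult_right
          has_derivative_diff bounded_linear_imp_has_derivative bounded_linear_vec_nth)
    from wirtinger_eq(1)[OF this, of j] show ?thesis
      by (auto simp: mat_def axis_def algebra_simps)
  qed
  then show ?thesis by (simp add: jacobian_def vec_eq_iff)
qed

lemma rotation_invariance:
  fixes F :: "complex^'n::finite \<Rightarrow> complex"
  assumes c: "cmod c = 1" and F: "continuous_on (ball p r) F" "set_integrable lborel (ball p r) F"
  shows "(LINT z:ball p r|lborel. F (p + c *s (z - p))) = (LINT z:ball p r|lborel. F z)"
proof -
  let ?R = "\<lambda>z. p + c *s (z - p)"
  have c0: "c \<noteq> 0" using c by auto
  have im: "?R ` ball p r = ball p r"
  proof
    show "?R ` ball p r \<subseteq> ball p r"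
      using c by (auto simp: dist_norm norm_scale_vec norm_minus_commute simp del: vector_ssub_ldistrib)
    show "ball p r \<subseteq> ?R ` ball p r"
    proof
      fix z assume z: "z \<in> ball p r"
      have "z = ?R (p + inverse c *s (z - p))" using c0 by (simp add: vec_eq_iff)
      moreover have "p + inverse c *s (z - p) \<in> ball p r"
        using z c by (simp add: dist_norm norm_scale_vec norm_minus_commute norm_inverse del: vector_ssub_ldistrib)
      ultimately show "z \<in> ?R ` ball p r" by blast
    qed
  qed
  have hol: "holomorphic_map (ball p r) ?R"
    unfolding holomorphic_map_def
    by (auto intro!: holomorphic_fun_add holomorphic_fun_const holomorphic_fun_cmult
        holomorphic_fun_diff holomorphic_fun_coordinate)
  have inj: "inj_on ?R (ball p r)" using c0 by (auto simp: inj_on_def vec_eq_iff)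
  have "det (jacobian ?R z) = (\<Prod>i\<in>(UNIV::'n set). (\<chi> i j. c * mat 1 $ i $ j :: complex^'n^'n) $ i $ i)" for z
    unfolding jacobian_rotation by (rule det_diagonal) (simp add: mat_def)
  then have det: "cmod (det (jacobian ?R z)) = 1" for z
    using c by (simp add: mat_def norm_mult norm_power)
  then have nz: "det (jacobian ?R z) \<noteq> 0" for z by (metis norm_zero zero_neq_one)
  show ?thesis
    using holomorphic_change_of_variables(2)[OF open_ball hol inj nz, unfolded im, OF open_ball F]
    by (simp add: det del: vector_ssub_ldistrib)
qed

text \<open>By the invariance of Lebesgue measure under \<open>z \<mapsto> p + e\<^sup>i\<^sup>t (z - p)\<close> the integral over the ball does not change when
  \<open>F\<close> is averaged over \<open>t\<close>, and this average is \<open>F p\<close> at every point, by the mean value property on the circle.\<close>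

lemma ball_mean_value:
  fixes F :: "complex^'n::finite \<Rightarrow> complex"
  assumes S: "open S" "cball p r \<subseteq> S" "r > 0" and F: "holomorphic_fun S F"
  shows "set_integrable lborel (ball p r) F"
    and "(LINT z:ball p r|lborel. F z) = measure lborel (ball p r) * F p"
proof -
  have cF: "continuous_on (cball p r) F"
    using holomorphic_fun_continuous[OF F] S(2) continuous_on_subset by blast
  then have cFb: "continuous_on (ball p r) F"
    using continuous_on_subset ball_subset_cball by blast
  have "set_integrable lborel (cball p r) F"
    unfolding set_integrable_def by (intro borel_integrable_compact cF compact_cball)
  then show int: "set_integrable lborel (ball p r) F"
    by (rule set_integrable_subset) auto
  let ?e = "\<lambda>t. exp (2 * of_real pi * \<i> * complex_of_real t)"
  have e1: "cmod (?e t) = 1" for t by (simp add: norm_exp)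
  define G where "G = (\<lambda>(t, z). F (p + ?e t *s (z - p)))"
  have mem: "p + c *s (z - p) \<in> cball p r" if "z \<in> cball p r" "cmod c = 1" for z c
    using that by (simp add: dist_norm norm_scale_vec norm_minus_commute del: vector_ssub_ldistrib)
  have sm: "continuous_on U (\<lambda>x. a x *s b x)" if "continuous_on U a" "continuous_on U b"
    for U and a :: "real \<times> (complex^'n) \<Rightarrow> complex" and b :: "real \<times> (complex^'n) \<Rightarrow> complex^'n"
    unfolding vector_scalar_mult_def using that by (intro continuous_intros)
  have contG: "continuous_on ({0..1} \<times> cball p r) G"
    unfolding G_def case_prod_beta
    by (rule continuous_on_compose2[OF cF]) (use mem e1 in \<open>auto intro!: continuous_intros sm\<close>)
  have "set_integrable lborel ({0..1} \<times> cball p r) G"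
    unfolding set_integrable_def by (intro borel_integrable_compact contG compact_Times) auto
  then have "set_integrable lborel ({0..1} \<times> ball p r) G"
    by (rule set_integrable_subset) (auto intro: borel_Times)
  then have prod: "integrable (lborel \<Otimes>\<^sub>M lborel)
      (\<lambda>(t, z). indicator {0..1} t *\<^sub>R indicator (ball p r) z *\<^sub>R G (t, z))"
    unfolding set_integrable_def lborel_prod
    by (rule Bochner_Integration.integrable_cong[THEN iffD1, rotated -1]) (auto simp: indicator_def)
  have "(LINT z|lborel. LINT t|lborel. indicator {0..1} t *\<^sub>R indicator (ball p r) z *\<^sub>R G (t, z))
      = (LINT t|lborel. LINT z|lborel. indicator {0..1} t *\<^sub>R indicator (ball p r) z *\<^sub>R G (t, z))"
    by (rule lborel_pair.Fubini_integral[OF prod])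
  also have "(LINT t|lborel. LINT z|lborel. indicator {0..1} t *\<^sub>R indicator (ball p r) z *\<^sub>R G (t, z))
      = (LINT t|lborel. indicator {0..1} t *\<^sub>R (LINT z:ball p r|lborel. G (t, z)))"
    by (simp add: set_lebesgue_integral_def flip: scaleR_scaleR)
  also have "\<dots> = (LINT t:{0..1::real}|lborel. (LINT z:ball p r|lborel. F z))"
    unfolding set_lebesgue_integral_def[of lborel "{0..1}"]
    by (simp only: G_def prod.case rotation_invariance[OF e1 cFb int])
  also have "\<dots> = (LINT z:ball p r|lborel. F z)"
    by (simp add: set_lebesgue_integral_def)
  also have "(LINT z|lborel. LINT t|lborel. indicator {0..1} t *\<^sub>R indicator (ball p r) z *\<^sub>R G (t, z))
      = (LINT z|lborel. indicator (ball p r) z *\<^sub>R F p)"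
  proof (intro Bochner_Integration.integral_cong refl)
    fix z
    show "(LINT t|lborel. indicator {0..1} t *\<^sub>R indicator (ball p r) z *\<^sub>R G (t, z)) = indicator (ball p r) z *\<^sub>R F p"
    proof (cases "z \<in> ball p r")
      case True
      define R where "R = (if z = p then 2 else r / norm (z - p))"
      have R: "R > 1" using True by (auto simp: R_def dist_norm norm_minus_commute)
      have sub: "p + \<zeta> *s (z - p) \<in> S" if "\<zeta> \<in> ball 0 R" for \<zeta>
      proof -
        have "norm (\<zeta> *s (z - p)) \<le> r"
          unfolding norm_scale_vec using that S(3)
          by (auto simp: R_def field_simps split: if_splits)
        then have "p + \<zeta> *s (z - p) \<in> cball p r" by (simp add: dist_norm del: vector_ssub_ldistrib)
        then show ?thesis using S(2) by blast
      qed
      have "(\<lambda>\<zeta>. F (p + \<zeta> *s (z - p))) holomorphic_on ball 0 R"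
        using F sub by (rule slice_holomorphic_on)
      from circle_mean_value(2)[OF this R] show ?thesis
        using True by (simp add: G_def set_lebesgue_integral_def)
    qed simp
  qed
  also have "\<dots> = measure lborel (ball p r) *\<^sub>R F p"
    using emeasure_lborel_ball_finite[of p r] by (simp add: less_top)
  finally show "(LINT z:ball p r|lborel. F z) = measure lborel (ball p r) * F p"
    by (simp add: scaleR_conv_of_real)
qed

definition bergman_inner ::
    "(complex^'n::finite) set \<Rightarrow> (complex^'n \<Rightarrow> complex) \<Rightarrow> (complex^'n \<Rightarrow> complex) \<Rightarrow> complex" where
  "bergman_inner D f g = (LINT z:D|lborel. f z * cnj (g z))"

definition bergman_norm2 :: "(complex^'n::finite) set \<Rightarrow> (complex^'n \<Rightarrow> complex) \<Rightarrow> real" where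
  "bergman_norm2 D f = (LINT z:D|lborel. (cmod (f z))\<^sup>2)"

context
  fixes D :: "(complex^'n::finite) set"
  assumes D: "bounded_domain D"
begin

lemma open_D: "open D" and bounded_D: "bounded D" and connected_D: "connected D" and D_nonempty: "D \<noteq> {}"
  using D by (auto simp: bounded_domain_def)

lemma bergman_holomorphic: "f \<in> bergman_space D \<Longrightarrow> holomorphic_fun D f"
  and bergman_square_integrable: "f \<in> bergman_space D \<Longrightarrow> set_integrable lborel D (\<lambda>z. (cmod (f z))\<^sup>2)"
  by (auto simp: bergman_space_def)

lemma bergman_product_integrable:
  assumes "f \<in> bergman_space D" "g \<in> bergman_space D"
  shows "set_integrable lborel D (\<lambda>z. f z * cnj (g z))"
proof (rule set_integrable_bound)
  show "set_integrable lborel D (\<lambda>z. (cmod (f z))\<^sup>2 + (cmod (g z))\<^sup>2)"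
    using assms bergman_square_integrable by (intro set_integral_add(1)) auto
  show "set_borel_measurable lborel D (\<lambda>z. f z * cnj (g z))"
    using assms bergman_holomorphic holomorphic_fun_continuous open_D
    by (intro continuous_imp_set_borel_measurable continuous_intros) auto
  have "cmod (f z) * cmod (g z) \<le> (cmod (f z))\<^sup>2 + (cmod (g z))\<^sup>2" for z
  proof -
    have "0 \<le> cmod (f z) * cmod (g z)" by simp
    then show ?thesis using sum_squares_bound[of "cmod (f z)" "cmod (g z)"] by linarith
  qed
  then show "AE z in lborel. z \<in> D \<longrightarrow> norm (f z * cnj (g z)) \<le> norm ((cmod (f z))\<^sup>2 + (cmod (g z))\<^sup>2)"
    by (simp add: norm_mult)
qed

lemma bergman_cmult: "f \<in> bergman_space D \<Longrightarrow> (\<lambda>z. c * f z) \<in> bergman_space D"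
  by (auto simp: bergman_space_def norm_mult power_mult_distrib intro: holomorphic_fun_cmult)

lemma bergman_add:
  assumes "f \<in> bergman_space D" "g \<in> bergman_space D"
  shows "(\<lambda>z. f z + g z) \<in> bergman_space D"
proof -
  have "set_integrable lborel D (\<lambda>z. (cmod (f z + g z))\<^sup>2)"
  proof (rule set_integrable_bound)
    show "set_integrable lborel D (\<lambda>z. 2 * (cmod (f z))\<^sup>2 + 2 * (cmod (g z))\<^sup>2)"
      using assms bergman_square_integrable by (intro set_integral_add(1) set_integrable_mult_right) auto
    show "set_borel_measurable lborel D (\<lambda>z. (cmod (f z + g z))\<^sup>2)"
      using assms bergman_holomorphic holomorphic_fun_continuous open_D
      by (intro continuous_imp_set_borel_measurable continuous_intros) auto
    have "(cmod (f z + g z))\<^sup>2 \<le> 2 * (cmod (f z))\<^sup>2 + 2 * (cmod (g z))\<^sup>2" for z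
    proof -
      have "(cmod (f z + g z))\<^sup>2 \<le> (cmod (f z) + cmod (g z))\<^sup>2"
        by (intro power_mono norm_triangle_ineq) auto
      also have "\<dots> \<le> 2 * (cmod (f z))\<^sup>2 + 2 * (cmod (g z))\<^sup>2"
        using sum_squares_bound[of "cmod (f z)" "cmod (g z)"] by (simp add: power2_sum)
      finally show ?thesis .
    qed
    then show "AE z in lborel. z \<in> D \<longrightarrow> norm ((cmod (f z + g z))\<^sup>2) \<le> norm (2 * (cmod (f z))\<^sup>2 + 2 * (cmod (g z))\<^sup>2)"
      by simp
  qed
  then show ?thesis
    using assms by (auto simp: bergman_space_def intro: holomorphic_fun_add)
qed

lemma bergman_diff:
  assumes "f \<in> bergman_space D" "g \<in> bergman_space D"
  shows "(\<lambda>z. f z - g z) \<in> bergman_space D"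
  using bergman_add[OF assms(1) bergman_cmult[OF assms(2), of "-1"]] by simp

lemma bounded_holomorphic_bergman:
  assumes "holomorphic_fun D f" "\<And>z. z \<in> D \<Longrightarrow> cmod (f z) \<le> C"
  shows "f \<in> bergman_space D"
proof -
  have "emeasure lborel D < \<infinity>"
    using bounded_D emeasure_bounded_finite by blast
  then have 1: "set_integrable lborel D (\<lambda>z. C\<^sup>2 :: real)"
    unfolding set_integrable_def using open_D by (intro integrable_indicator integrable_scaleR_left) auto
  have "set_integrable lborel D (\<lambda>z. (cmod (f z))\<^sup>2)"
  proof (rule set_integrable_bound[OF 1])
    show "set_borel_measurable lborel D (\<lambda>z. (cmod (f z))\<^sup>2)"
      using assms(1) holomorphic_fun_continuous open_D
      by (intro continuous_imp_set_borel_measurable continuous_intros) auto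
    show "AE z in lborel. z \<in> D \<longrightarrow> norm ((cmod (f z))\<^sup>2) \<le> norm (C\<^sup>2)"
      using assms(2) by (intro AE_I2 impI) (simp add: power_mono)
  qed
  then show ?thesis using assms(1) by (simp add: bergman_space_def)
qed

lemma bergman_const: "(\<lambda>z. c) \<in> bergman_space D"
  by (rule bounded_holomorphic_bergman) (auto intro: holomorphic_fun_const)

lemma bergman_coordinate: "(\<lambda>z. z $ i) \<in> bergman_space D"
proof -
  obtain C where "\<And>z. z \<in> D \<Longrightarrow> norm z \<le> C"
    using bounded_D unfolding bounded_iff by blast
  then show ?thesis
    by (intro bounded_holomorphic_bergman[of _ C] holomorphic_fun_coordinate)
      (meson component_le_norm_cart order_trans Finite_Cartesian_Product.norm_nth_le)
qed

lemma bergman_norm2_nonneg: "bergman_norm2 D f \<ge> 0"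
  unfolding bergman_norm2_def set_lebesgue_integral_def by (intro Bochner_Integration.integral_nonneg) auto

lemma bergman_inner_self: "bergman_inner D f f = of_real (bergman_norm2 D f)"
  unfolding bergman_inner_def bergman_norm2_def
  by (simp only: set_integral_complex_of_real[symmetric] complex_norm_square)

lemma bergman_inner_cnj: "bergman_inner D g f = cnj (bergman_inner D f g)"
  unfolding bergman_inner_def set_lebesgue_integral_def Bochner_Integration.integral_cnj[symmetric]
  by (simp add: mult.commute)

lemma bergman_inner_add_left:
  assumes "f \<in> bergman_space D" "g \<in> bergman_space D" "h \<in> bergman_space D"
  shows "bergman_inner D (\<lambda>z. f z + g z) h = bergman_inner D f h + bergman_inner D g h"
  unfolding bergman_inner_def
  using set_integral_add(2)[OF bergman_product_integrable[OF assms(1,3)] bergman_product_integrable[OF assms(2,3)]]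
  by (simp add: distrib_right)

lemma bergman_inner_cmult_left: "bergman_inner D (\<lambda>z. c * f z) h = c * bergman_inner D f h"
  unfolding bergman_inner_def by (simp add: mult.assoc)

lemma bergman_inner_add_right:
  assumes "f \<in> bergman_space D" "g \<in> bergman_space D" "h \<in> bergman_space D"
  shows "bergman_inner D h (\<lambda>z. f z + g z) = bergman_inner D h f + bergman_inner D h g"
  using bergman_inner_add_left[OF assms] by (metis bergman_inner_cnj complex_cnj_add)

lemma bergman_inner_cmult_right: "bergman_inner D h (\<lambda>z. c * f z) = cnj c * bergman_inner D h f"
  by (metis bergman_inner_cmult_left bergman_inner_cnj complex_cnj_mult)

lemma bergman_norm2_cmult: "bergman_norm2 D (\<lambda>z. c * f z) = (cmod c)\<^sup>2 * bergman_norm2 D f"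
  by (simp add: bergman_norm2_def norm_mult power_mult_distrib)

lemma bergman_norm2_add:
  assumes "f \<in> bergman_space D" "g \<in> bergman_space D"
  shows "bergman_norm2 D (\<lambda>z. f z + c * g z) =
    bergman_norm2 D f + 2 * Re (cnj c * bergman_inner D f g) + (cmod c)\<^sup>2 * bergman_norm2 D g"
proof -
  note [simp] = assms bergman_cmult bergman_add
  have "complex_of_real (bergman_norm2 D (\<lambda>z. f z + c * g z)) =
      of_real (bergman_norm2 D f) + (cnj c * bergman_inner D f g + cnj (cnj c * bergman_inner D f g))
      + of_real ((cmod c)\<^sup>2 * bergman_norm2 D g)"
    unfolding bergman_inner_self[symmetric] bergman_norm2_cmult[symmetric]
    by (simp add: bergman_inner_add_left bergman_inner_add_right bergman_inner_cmult_left
        bergman_inner_cmult_right bergman_inner_cnj[of f g] distrib_left)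
  also have "\<dots> = of_real (bergman_norm2 D f + 2 * Re (cnj c * bergman_inner D f g)
      + (cmod c)\<^sup>2 * bergman_norm2 D g)"
    by (simp only: complex_add_cnj of_real_add)
  finally show ?thesis by (simp only: of_real_eq_iff)
qed

text \<open>The linear term dominates for small multiples \<open>c\<close> of \<open>- b\<close>.\<close>

lemma nonneg_quadratic_imp_zero:
  fixes b :: complex and G :: real
  assumes "\<And>c. 0 \<le> 2 * Re (cnj c * b) + (cmod c)\<^sup>2 * G" "G \<ge> 0"
  shows "b = 0"
proof (rule ccontr)
  assume "b \<noteq> 0"
  define t where "t = 1 / (G + 1)"
  have t: "t > 0" "t * G < 1" using assms(2) by (auto simp: t_def field_simps)
  have "cnj (of_real (- t) * b) * b = of_real (- t * (cmod b)\<^sup>2)"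
    by (simp add: complex_norm_square mult_ac del: of_real_power)
  then have "0 \<le> 2 * (- t * (cmod b)\<^sup>2) + (t * cmod b)\<^sup>2 * G"
    using assms(1)[of "of_real (- t) * b"] t by (simp add: norm_mult del: of_real_mult)
  also have "\<dots> = t * (cmod b)\<^sup>2 * (t * G - 2)" by (simp add: power2_eq_square algebra_simps)
  also have "\<dots> < 0" using t \<open>b \<noteq> 0\<close> by (intro mult_pos_neg) auto
  finally show False by simp
qed

lemma bergman_cauchy_schwarz:
  assumes "f \<in> bergman_space D" "g \<in> bergman_space D"
  shows "(cmod (bergman_inner D f g))\<^sup>2 \<le> bergman_norm2 D f * bergman_norm2 D g"
proof -
  define b F G where "b = bergman_inner D f g" and "F = bergman_norm2 D f" and "G = bergman_norm2 D g"
  have nn: "0 \<le> F + 2 * Re (cnj c * b) + (cmod c)\<^sup>2 * G" for c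
    using bergman_norm2_add[OF assms, of c] bergman_norm2_nonneg[of "\<lambda>z. f z + c * g z"]
    by (simp add: b_def F_def G_def)
  have FG: "F \<ge> 0" "G \<ge> 0" by (simp_all add: F_def G_def bergman_norm2_nonneg)
  have sq: "cnj (of_real t * b) * b = of_real (t * (cmod b)\<^sup>2)" for t
    by (simp add: complex_norm_square mult_ac del: of_real_power)
  have q: "0 \<le> F + 2 * (t * (cmod b)\<^sup>2) + t\<^sup>2 * (cmod b)\<^sup>2 * G" for t
    using nn[of "of_real t * b"] unfolding sq
    by (simp add: norm_mult power_mult_distrib del: of_real_mult)
  show ?thesis
  proof (cases "G = 0")
    case True
    have "cmod b = 0"
    proof (rule ccontr)
      assume "cmod b \<noteq> 0"
      then show False
        using q[of "- (F + 1) / (cmod b)\<^sup>2"] True FG by simp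
    qed
    then show ?thesis by (simp add: b_def[symmetric] F_def[symmetric] G_def[symmetric] True)
  next
    case False
    then have "G > 0" using FG by simp
    then have "0 \<le> F - (cmod b)\<^sup>2 / G"
      using q[of "- 1 / G"] by (simp add: power2_eq_square field_simps)
    then show ?thesis
      using \<open>G > 0\<close> by (simp add: b_def[symmetric] F_def[symmetric] G_def[symmetric] field_simps)
  qed
qed

text \<open>The mean value property of the holomorphic function \<open>f\<^sup>2\<close>.\<close>

lemma bergman_point_evaluation:
  assumes f: "f \<in> bergman_space D" and r: "cball p r \<subseteq> D" "r > 0"
  shows "(cmod (f p))\<^sup>2 \<le> bergman_norm2 D f / measure lborel (ball (0 :: complex^'n) r)"
proof -
  have V: "measure lborel (ball p r) = measure lborel (ball (0 :: complex^'n) r)"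
    "measure lborel (ball (0 :: complex^'n) r) > 0"
    using r(2) content_ball_conv_unit_ball[of r p] content_ball_conv_unit_ball[of r "0 :: complex^'n"]
      content_ball_pos[OF r(2)] by auto
  have hol: "holomorphic_fun D (\<lambda>z. f z * f z)"
    using bergman_holomorphic[OF f] by (intro holomorphic_fun_mult)
  note mv = ball_mean_value[OF open_D r hol]
  have sub: "ball p r \<subseteq> D" using r(1) ball_subset_cball by blast
  have "measure lborel (ball p r) * (cmod (f p))\<^sup>2 = cmod (LINT z:ball p r|lborel. f z * f z)"
    unfolding mv(2) by (simp add: norm_mult power2_eq_square)
  also have "\<dots> \<le> (LINT z:ball p r|lborel. cmod (f z * f z))"
    by (rule set_integral_norm_bound[OF mv(1)])
  also have "\<dots> = (LINT z:ball p r|lborel. (cmod (f z))\<^sup>2)"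
    by (simp add: norm_mult power2_eq_square)
  also have "\<dots> \<le> bergman_norm2 D f"
    unfolding bergman_norm2_def set_lebesgue_integral_def
  proof (rule integral_mono)
    show "integrable lborel (\<lambda>z. indicator D z *\<^sub>R (cmod (f z))\<^sup>2)"
      using bergman_square_integrable[OF f] by (simp add: set_integrable_def)
    show "integrable lborel (\<lambda>z. indicator (ball p r) z *\<^sub>R (cmod (f z))\<^sup>2)"
      using set_integrable_subset[OF bergman_square_integrable[OF f] _ sub] by (simp add: set_integrable_def)
  qed (use sub in \<open>auto simp: indicator_def\<close>)
  finally show ?thesis using V by (simp add: field_simps)
qed

text \<open>A function of least norm with value 1 at \<open>w\<close>.  By the parallelogram law a minimizing sequence is Cauchy
  in norm, hence locally uniformly Cauchy by the bound on point evaluations; its limit is holomorphic, and has least norm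
  by Fatou's lemma.\<close>

lemma bergman_minimizer:
  assumes w: "w \<in> D"
  obtains l where "l \<in> bergman_space D" "l w = 1"
    "\<And>f. f \<in> bergman_space D \<Longrightarrow> f w = 1 \<Longrightarrow> bergman_norm2 D l \<le> bergman_norm2 D f"
proof -
  define N where "N = {f \<in> bergman_space D. f w = 1}"
  define m where "m = Inf (bergman_norm2 D ` N)"
  have one: "(\<lambda>z. 1) \<in> N" using bergman_const by (simp add: N_def)
  have bddb: "bdd_below (bergman_norm2 D ` N)"
    using bergman_norm2_nonneg by (intro bdd_belowI[of _ 0]) auto
  have mle: "m \<le> bergman_norm2 D f" if "f \<in> N" for f
    unfolding m_def using that bddb by (intro cInf_lower) auto
  have "\<exists>f\<in>N. bergman_norm2 D f < m + 1 / real (Suc n)" for n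
    using cInf_lessD[of "bergman_norm2 D ` N" "m + 1 / real (Suc n)"] one
    unfolding m_def[symmetric] by auto
  then obtain f where f: "\<And>n. f n \<in> N" "\<And>n. bergman_norm2 D (f n) < m + 1 / real (Suc n)"
    by metis
  have fb: "f n \<in> bergman_space D" "f n w = 1" for n using f(1) by (auto simp: N_def)
  have parallelogram: "bergman_norm2 D (\<lambda>z. f n z - f k z) \<le> 2 / real (Suc n) + 2 / real (Suc k)" for n k
  proof -
    have "(\<lambda>z. (1/2) * (f n z + f k z)) \<in> N"
      using fb bergman_cmult[OF bergman_add[OF fb(1) fb(1)], of "1/2" n k] by (simp add: N_def)
    from mle[OF this] have "4 * m \<le> bergman_norm2 D (\<lambda>z. f n z + f k z)"
      using bergman_norm2_cmult[of "1/2" "\<lambda>z. f n z + f k z"] by (simp add: power2_eq_square)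
    moreover have "bergman_norm2 D (\<lambda>z. f n z - f k z) + bergman_norm2 D (\<lambda>z. f n z + f k z)
        = 2 * bergman_norm2 D (f n) + 2 * bergman_norm2 D (f k)"
      using bergman_norm2_add[OF fb(1) fb(1), of n 1 k] bergman_norm2_add[OF fb(1) fb(1), of n "-1" k]
      by simp
    moreover have "2 / real (Suc j) = 2 * (1 / real (Suc j))" for j by simp
    ultimately show ?thesis using f(2)[of n] f(2)[of k] by linarith
  qed
  have close: "(cmod (f n z - f k z))\<^sup>2 \<le> (2 / real (Suc n) + 2 / real (Suc k))
      / measure lborel (ball (0::complex^'n) r)" if "cball z r \<subseteq> D" "r > 0" for n k z r
    using bergman_point_evaluation[OF bergman_diff[OF fb(1) fb(1)] that, of n k] parallelogram[of n k]
      content_ball_pos[OF that(2), of "0::complex^'n"]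
    by (meson divide_right_mono less_imp_le order_trans)
  define l where "l z = lim (\<lambda>n. f n z)" for z
  have conv: "(\<lambda>n. f n z) \<longlonglongrightarrow> l z" if z: "z \<in> D" for z
  proof -
    obtain r where r: "r > 0" "cball z r \<subseteq> D" using open_D z open_contains_cball by blast
    define V where "V = measure lborel (ball (0::complex^'n) r)"
    have V: "V > 0" using content_ball_pos[OF r(1)] by (simp add: V_def)
    have "Cauchy (\<lambda>n. f n z)"
    proof (rule CauchyI)
      fix e :: real assume e: "e > 0"
      obtain M where M: "4 / (V * e\<^sup>2) < real M" using reals_Archimedean2 by blast
      have "norm (f n z - f k z) < e" if nk: "n \<ge> M" "k \<ge> M" for n k
      proof -
        have "0 < 4 / (V * e\<^sup>2)" using V e by simp
        then have "M > 0" using M by linarith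
        have "2 / real (Suc n) + 2 / real (Suc k) \<le> 2 / real M + 2 / real M"
          using nk \<open>M > 0\<close> by (intro add_mono divide_left_mono) auto
        then have "(2 / real (Suc n) + 2 / real (Suc k)) / V \<le> (4 / real M) / V"
          using V by (intro divide_right_mono) auto
        with close[OF r(2,1), of n k] have "(norm (f n z - f k z))\<^sup>2 \<le> (4 / real M) / V"
          unfolding V_def by (rule order_trans)
        also have "\<dots> < e\<^sup>2" using M V e \<open>M > 0\<close> by (simp add: field_simps)
        finally show ?thesis using e by (simp add: power2_less_imp_less)
      qed
      then show "\<exists>M. \<forall>n\<ge>M. \<forall>k\<ge>M. norm (f n z - f k z) < e" by blast
    qed
    then show ?thesis unfolding l_def by (simp add: Cauchy_convergent convergent_LIMSEQ_iff[symmetric])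
  qed
  have lim_close: "(cmod (f n z - l z))\<^sup>2 \<le> (2 / real (Suc n))
      / measure lborel (ball (0::complex^'n) r)" if "cball z r \<subseteq> D" "r > 0" for n z r
  proof -
    have "z \<in> D" using that by auto
    have "(\<lambda>k. (cmod (f n z - f k z))\<^sup>2) \<longlonglongrightarrow> (cmod (f n z - l z))\<^sup>2"
      by (intro tendsto_intros conv \<open>z \<in> D\<close>)
    moreover have "(\<lambda>k. (2 / real (Suc n) + 2 * inverse (real (Suc k))) / measure lborel (ball (0::complex^'n) r))
        \<longlonglongrightarrow> (2 / real (Suc n) + 2 * 0) / measure lborel (ball (0::complex^'n) r)"
      by (intro tendsto_intros LIMSEQ_inverse_real_of_nat)
        (use content_ball_pos[OF that(2), of "0::complex^'n"] in simp)
    ultimately show ?thesis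
      using close[OF that, of n] by (intro LIMSEQ_le) (auto simp: divide_inverse)
  qed
  have hol: "holomorphic_fun D l"
  proof (rule holomorphic_fun_locally_uniform_limit[of D f])
    show "holomorphic_fun D (f n)" for n using fb bergman_holomorphic by blast
    fix p assume "p \<in> D"
    then obtain r where r: "r > 0" "cball p r \<subseteq> D" using open_D open_contains_cball by blast
    define V where "V = measure lborel (ball (0::complex^'n) (r/2))"
    have V: "V > 0" using content_ball_pos[of "r/2"] r by (simp add: V_def)
    have near: "cball z (r/2) \<subseteq> D" if "z \<in> ball p (r/2)" for z
    proof
      fix x assume "x \<in> cball z (r/2)"
      then have "x \<in> cball p r" using that dist_triangle[of p x z] by simp
      then show "x \<in> D" using r(2) by blast
    qed
    have "uniform_limit (ball p (r/2)) f l sequentially"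
    proof (rule uniform_limitI)
      fix e :: real assume e: "e > 0"
      have "(\<lambda>n. (2 * inverse (real (Suc n))) / V) \<longlonglongrightarrow> (2 * 0) / V"
        using V by (intro tendsto_intros LIMSEQ_inverse_real_of_nat) auto
      then have "\<forall>\<^sub>F n in sequentially. (2 * inverse (real (Suc n))) / V < e\<^sup>2"
        using e by (intro order_tendstoD) auto
      then show "\<forall>\<^sub>F n in sequentially. \<forall>z\<in>ball p (r/2). dist (f n z) (l z) < e"
      proof eventually_elim
        case (elim n)
        show ?case
        proof
          fix z assume "z \<in> ball p (r/2)"
          then have "(cmod (f n z - l z))\<^sup>2 \<le> (2 / real (Suc n)) / V"
            using lim_close[OF near] r unfolding V_def by simp
          also have "\<dots> < e\<^sup>2" using elim by (simp add: divide_inverse)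
          finally show "dist (f n z) (l z) < e"
            using e by (simp add: dist_norm power2_less_imp_less)
        qed
      qed
    qed
    then show "\<exists>R>0. ball p R \<subseteq> D \<and> uniform_limit (ball p R) f l sequentially"
      using r ball_subset_cball[of p r] by (intro exI[of _ "r/2"]) auto
  qed
  have lw: "l w = 1"
    using conv[OF w] fb(2) by (simp add: LIMSEQ_const_iff)
  have meas: "(\<lambda>z. indicator D z * (cmod (g z))\<^sup>2) \<in> borel_measurable lborel"
    if "holomorphic_fun D g" for g
    using continuous_imp_set_borel_measurable[OF open_D, of "\<lambda>z. (cmod (g z))\<^sup>2"]
      holomorphic_fun_continuous[OF that]
    by (simp add: set_borel_measurable_def continuous_intros)
  have nn: "(\<integral>\<^sup>+z. ennreal (indicator D z * (cmod (f n z))\<^sup>2) \<partial>lborel) = ennreal (bergman_norm2 D (f n))" for n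
    unfolding bergman_norm2_def set_lebesgue_integral_def
    using bergman_square_integrable[OF fb(1), of n]
    by (subst nn_integral_eq_integral) (auto simp: set_integrable_def)
  have m0: "m \<ge> 0" unfolding m_def using one bergman_norm2_nonneg by (intro cInf_greatest) auto
  have "(\<integral>\<^sup>+z. ennreal (indicator D z * (cmod (l z))\<^sup>2) \<partial>lborel)
      = (\<integral>\<^sup>+z. liminf (\<lambda>n. ennreal (indicator D z * (cmod (f n z))\<^sup>2)) \<partial>lborel)"
  proof (intro nn_integral_cong)
    fix z
    have "(\<lambda>n. ennreal (indicator D z * (cmod (f n z))\<^sup>2)) \<longlonglongrightarrow> ennreal (indicator D z * (cmod (l z))\<^sup>2)"
    proof (cases "z \<in> D")
      case True
      then show ?thesis by (intro tendsto_intros conv) auto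
    qed simp
    then show "ennreal (indicator D z * (cmod (l z))\<^sup>2) = liminf (\<lambda>n. ennreal (indicator D z * (cmod (f n z))\<^sup>2))"
      by (rule lim_imp_Liminf[OF sequentially_bot, symmetric])
  qed
  also have "\<dots> \<le> liminf (\<lambda>n. (\<integral>\<^sup>+z. ennreal (indicator D z * (cmod (f n z))\<^sup>2) \<partial>lborel))"
    using fb bergman_holomorphic by (intro nn_integral_liminf measurable_compose[OF meas measurable_ennreal]) auto
  also have "\<dots> \<le> liminf (\<lambda>n. ennreal (m + 1 / real (Suc n)))"
    unfolding nn using f(2) by (intro Liminf_mono always_eventually allI ennreal_leI less_imp_le)
  also have "\<dots> = ennreal m"
  proof (rule lim_imp_Liminf[OF sequentially_bot])
    have "(\<lambda>n. m + inverse (real (Suc n))) \<longlonglongrightarrow> m + 0"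
      by (intro tendsto_intros LIMSEQ_inverse_real_of_nat)
    then show "(\<lambda>n. ennreal (m + 1 / real (Suc n))) \<longlonglongrightarrow> ennreal m"
      by (intro tendsto_ennrealI) (simp add: divide_inverse)
  qed
  finally have fatou: "(\<integral>\<^sup>+z. ennreal (indicator D z * (cmod (l z))\<^sup>2) \<partial>lborel) \<le> ennreal m" .
  have int: "set_integrable lborel D (\<lambda>z. (cmod (l z))\<^sup>2)"
    unfolding set_integrable_def real_scaleR_def
    by (rule integrableI_nonneg[OF meas[OF hol]])
      (use fatou in \<open>auto intro: le_less_trans simp: ennreal_less_top\<close>)
  have lb: "l \<in> bergman_space D" using hol int by (simp add: bergman_space_def)
  have "ennreal (bergman_norm2 D l) \<le> ennreal m"
    using fatou int unfolding bergman_norm2_def set_lebesgue_integral_def set_integrable_def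
    by (subst (asm) nn_integral_eq_integral) auto
  then have "bergman_norm2 D l \<le> m" using m0 by (simp add: ennreal_le_iff)
  then show ?thesis
    using that[OF lb lw] mle by (force simp: N_def)
qed

text \<open>Minimality makes \<open>l\<close> orthogonal to all functions vanishing at \<open>w\<close>, so evaluation at \<open>w\<close> is, up to
  normalization, the inner product with \<open>l\<close>.\<close>

lemma bergman_reproducing_exists:
  assumes w: "w \<in> D"
  shows "\<exists>k. k \<in> bergman_space D \<and> (\<forall>f\<in>bergman_space D. f w = bergman_inner D f k)"
proof -
  obtain l where l: "l \<in> bergman_space D" "l w = 1"
    "\<And>f. f \<in> bergman_space D \<Longrightarrow> f w = 1 \<Longrightarrow> bergman_norm2 D l \<le> bergman_norm2 D f"
    using bergman_minimizer[OF w] by blast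
  have orth: "bergman_inner D l g = 0" if g: "g \<in> bergman_space D" "g w = 0" for g
  proof (rule nonneg_quadratic_imp_zero)
    fix c
    have "(\<lambda>z. l z + c * g z) \<in> bergman_space D" using l(1) g(1) by (intro bergman_add bergman_cmult)
    from l(3)[OF this] show "0 \<le> 2 * Re (cnj c * bergman_inner D l g) + (cmod c)\<^sup>2 * bergman_norm2 D g"
      using l(2) g(2) bergman_norm2_add[OF l(1) g(1), of c] by simp
  qed (rule bergman_norm2_nonneg)
  obtain r where r: "r > 0" "cball w r \<subseteq> D" using open_D w open_contains_cball by blast
  have pos: "bergman_norm2 D l > 0"
  proof -
    have "measure lborel (ball (0::complex^'n) r) > 0" using content_ball_pos[OF r(1)] .
    then have "measure lborel (ball (0::complex^'n) r) \<le> bergman_norm2 D l"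
      using bergman_point_evaluation[OF l(1) r(2,1)] l(2) by (simp add: field_simps)
    then show ?thesis using \<open>measure lborel (ball (0::complex^'n) r) > 0\<close> by linarith
  qed
  have "f w = bergman_inner D f (\<lambda>z. of_real (1 / bergman_norm2 D l) * l z)" if f: "f \<in> bergman_space D" for f
  proof -
    have g: "(\<lambda>z. f z + (- f w) * l z) \<in> bergman_space D" using f l(1) by (intro bergman_add bergman_cmult)
    have "bergman_inner D l (\<lambda>z. f z + (- f w) * l z) = 0" by (rule orth[OF g]) (simp add: l(2))
    then have "bergman_inner D (\<lambda>z. f z + (- f w) * l z) l = 0"
      by (metis bergman_inner_cnj complex_cnj_zero)
    then have "bergman_inner D f l + (- f w) * bergman_inner D l l = 0"
      unfolding bergman_inner_add_left[OF f bergman_cmult[OF l(1)] l(1)] bergman_inner_cmult_left .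
    then have "bergman_inner D f l = f w * of_real (bergman_norm2 D l)"
      by (simp add: bergman_inner_self)
    then show ?thesis unfolding bergman_inner_cmult_right using pos by simp
  qed
  then show ?thesis using bergman_cmult[OF l(1)] by blast
qed

section \<open>The Bergman kernel\<close>

lemma bergman_kernel_reproducing:
  assumes "w \<in> D"
  shows "(\<lambda>z. bergman_kernel D z w) \<in> bergman_space D"
    and "f \<in> bergman_space D \<Longrightarrow> bergman_inner D f (\<lambda>z. bergman_kernel D z w) = f w"
proof -
  let ?P = "\<lambda>k. k \<in> bergman_space D \<and> (\<forall>f\<in>bergman_space D. f w = (LINT x:D|lborel. f x * cnj (k x)))"
  have "?P (\<lambda>z. bergman_kernel D z w)"
    unfolding bergman_kernel_def
    using bergman_reproducing_exists[OF assms] unfolding bergman_inner_def by (rule someI_ex)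
  then show "(\<lambda>z. bergman_kernel D z w) \<in> bergman_space D"
    "f \<in> bergman_space D \<Longrightarrow> bergman_inner D f (\<lambda>z. bergman_kernel D z w) = f w"
    by (auto simp: bergman_inner_def)
qed

lemma bergman_kernel_hermitian:
  assumes "z \<in> D" "w \<in> D"
  shows "bergman_kernel D w z = cnj (bergman_kernel D z w)"
  using bergman_kernel_reproducing(2)[OF assms(1) bergman_kernel_reproducing(1)[OF assms(2)]]
    bergman_kernel_reproducing(2)[OF assms(2) bergman_kernel_reproducing(1)[OF assms(1)]]
    bergman_inner_cnj[of "\<lambda>x. bergman_kernel D x z" "\<lambda>x. bergman_kernel D x w"]
  by metis

lemma bergman_kernel_diagonal:
  assumes "w \<in> D"
  shows "bergman_kernel D w w = of_real (bergman_norm2 D (\<lambda>z. bergman_kernel D z w))"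
  using bergman_kernel_reproducing[OF assms] bergman_inner_self[of "\<lambda>z. bergman_kernel D z w"] by metis

lemma bergman_kernel_evaluation:
  assumes "w \<in> D" "f \<in> bergman_space D"
  shows "(cmod (f w))\<^sup>2 \<le> bergman_norm2 D f * Re (bergman_kernel D w w)"
  using bergman_cauchy_schwarz[OF assms(2) bergman_kernel_reproducing(1)[OF assms(1)]]
    bergman_kernel_reproducing(2)[OF assms] bergman_kernel_diagonal[OF assms(1)] by simp

lemma bergman_kernel_positive:
  assumes "w \<in> D"
  shows "Re (bergman_kernel D w w) > 0" "Im (bergman_kernel D w w) = 0"
  using bergman_kernel_evaluation[OF assms bergman_const[of 1]] bergman_kernel_diagonal[OF assms]
    bergman_norm2_nonneg[of "\<lambda>z. bergman_kernel D z w"]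
  by (auto simp: less_le)

text \<open>On the diagonal the bound on point evaluations, applied to the kernel function itself, reads
  \<open>K\<^sup>2 \<le> K / V\<close>; the Cauchy-Schwarz inequality extends the bound off the diagonal.\<close>

lemma bergman_kernel_bound:
  assumes "z \<in> D" "w \<in> D" "cball z r \<subseteq> D" "cball w r \<subseteq> D" "r > 0"
  shows "cmod (bergman_kernel D z w) \<le> 1 / measure lborel (ball (0::complex^'n) r)"
proof -
  define V where "V = measure lborel (ball (0::complex^'n) r)"
  have V: "V > 0" using content_ball_pos[OF assms(5)] by (simp add: V_def)
  have diag: "Re (bergman_kernel D x x) \<le> 1 / V" if "x \<in> D" "cball x r \<subseteq> D" for x
  proof -
    have "(cmod (bergman_kernel D x x))\<^sup>2 \<le> Re (bergman_kernel D x x) / V"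
      using bergman_point_evaluation[OF bergman_kernel_reproducing(1)[OF that(1)] that(2) assms(5)]
        bergman_kernel_diagonal[OF that(1)] by (simp add: V_def)
    then have "Re (bergman_kernel D x x) * Re (bergman_kernel D x x) \<le> Re (bergman_kernel D x x) * (1 / V)"
      using bergman_kernel_positive[OF that(1)] by (simp add: cmod_eq_Re power2_eq_square)
    then show ?thesis using bergman_kernel_positive(1)[OF that(1)] by (rule mult_left_le_imp_le)
  qed
  have "(cmod (bergman_kernel D z w))\<^sup>2 \<le> Re (bergman_kernel D w w) * Re (bergman_kernel D z z)"
    using bergman_kernel_evaluation[OF assms(1) bergman_kernel_reproducing(1)[OF assms(2)]]
      bergman_kernel_diagonal[OF assms(2)] by simp
  also have "\<dots> \<le> (1 / V) * (1 / V)"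
    using diag assms V bergman_kernel_positive(1) by (intro mult_mono) (auto simp: less_imp_le)
  finally have "(cmod (bergman_kernel D z w))\<^sup>2 \<le> (1 / V)\<^sup>2" unfolding power2_eq_square[of "1 / V"] .
  then show ?thesis
    unfolding V_def[symmetric] by (rule power2_le_imp_le) (use V in simp)
qed

end

section \<open>Polarization\<close>

definition vcnj :: "complex^'n::finite \<Rightarrow> complex^'n" where
  "vcnj z = (\<chi> i. cnj (z $ i))"

lemma vcnj_simps [simp]: "vcnj (vcnj z) = z" "vcnj z $ i = cnj (z $ i)"
  "vcnj (c *s z) = cnj c *s vcnj z" "norm (vcnj z) = norm z"
  by (simp_all add: vcnj_def vec_eq_iff norm_vec_def)

lemma vcnj_add [simp]: "vcnj (z + w) = vcnj z + vcnj w" "vcnj (z - w) = vcnj z - vcnj w"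
  by (simp_all add: vcnj_def vec_eq_iff)

lemma bounded_linear_vcnj: "bounded_linear (vcnj :: complex^'n::finite \<Rightarrow> _)"
  by (rule bounded_linear_intro[of _ 1]) (auto simp: vec_eq_iff)

lemma bounded_linear_parts:
  "bounded_linear (left_part :: complex^('n::finite + 'm::finite) \<Rightarrow> _)"
  "bounded_linear (right_part :: complex^('n::finite + 'm::finite) \<Rightarrow> _)"
  by (rule bounded_linear_intro[of _ 1], simp add: left_part_def vec_eq_iff,
      simp add: left_part_def vec_eq_iff, simp add: norm_parts,
      rule bounded_linear_intro[of _ 1], simp add: right_part_def vec_eq_iff,
      simp add: right_part_def vec_eq_iff, simp add: norm_parts)

lemma holomorphic_fun_vcnj:
  assumes "holomorphic_fun S f"
  shows "holomorphic_fun {y. vcnj y \<in> S} (\<lambda>y. cnj (f (vcnj y)))"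
  unfolding holomorphic_fun_def
proof
  fix p assume "p \<in> {y. vcnj y \<in> S}"
  then have p: "vcnj p \<in> S" by simp
  note d = has_complex_differential(1)[OF assms p]
  have "((cnj \<circ> (f \<circ> vcnj)) has_derivative (cnj \<circ> (complex_differential f (vcnj p) \<circ> vcnj))) (at p)"
    by (intro diff_chain_at bounded_linear_imp_has_derivative bounded_linear_vcnj d bounded_linear_cnj)
  then show "\<exists>f'. ((\<lambda>y. cnj (f (vcnj y))) has_derivative f') (at p) \<and> (\<forall>c v. f' (c *s v) = c * f' v)"
    by (intro exI[of _ "cnj \<circ> (complex_differential f (vcnj p) \<circ> vcnj)"])
      (simp add: o_def complex_differential_scale)
qed

text \<open>The kernel is antiholomorphic in its second variable.  Conjugating that variable makes it a holomorphic function on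
  this subset of \<open>complex^('n + 'n)\<close>.\<close>

definition doubled :: "(complex^'n::finite) set \<Rightarrow> (complex^('n + 'n)) set" where
  "doubled D = {\<zeta>. left_part \<zeta> \<in> D \<and> vcnj (right_part \<zeta>) \<in> D}"

lemma open_doubled: "open D \<Longrightarrow> open (doubled D)"
proof -
  assume D: "open D"
  have "open (left_part -` D \<inter> (vcnj \<circ> right_part) -` D :: (complex^('a + 'a)) set)"
    by (intro open_Int open_vimage D linear_continuous_on bounded_linear_parts)
      (auto simp: o_def intro!: bounded_linear_compose[OF bounded_linear_vcnj bounded_linear_parts(2)] linear_continuous_on)
  then show ?thesis by (simp add: doubled_def vimage_def Collect_conj_eq[symmetric])
qed

lemma join_in_doubled [simp]: "join x y \<in> doubled D \<longleftrightarrow> x \<in> D \<and> vcnj y \<in> D"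
  by (simp add: doubled_def)

definition polarized_kernel :: "(complex^'n::finite) set \<Rightarrow> complex^('n + 'n) \<Rightarrow> complex" where
  "polarized_kernel D \<zeta> = bergman_kernel D (left_part \<zeta>) (vcnj (right_part \<zeta>))"

text \<open>Separately holomorphic by Hermitian symmetry and locally bounded, hence jointly holomorphic.\<close>

lemma polarized_kernel_holomorphic:
  assumes D: "bounded_domain D"
  shows "holomorphic_fun (doubled D) (polarized_kernel D)"
proof (rule holomorphic_fun_separately)
  fix \<zeta> assume "\<zeta> \<in> doubled D"
  then have z: "left_part \<zeta> \<in> D" "vcnj (right_part \<zeta>) \<in> D" by (auto simp: doubled_def)
  obtain r1 where r1: "r1 > 0" "cball (left_part \<zeta>) r1 \<subseteq> D"
    using z(1) open_D[OF D] open_contains_cball by blast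
  obtain r2 where r2: "r2 > 0" "cball (vcnj (right_part \<zeta>)) r2 \<subseteq> D"
    using z(2) open_D[OF D] open_contains_cball by blast
  define r where "r = min r1 r2 / 2"
  have r: "r > 0" "cball (left_part \<zeta>) (2 * r) \<subseteq> D" "cball (vcnj (right_part \<zeta>)) (2 * r) \<subseteq> D"
    using r1 r2 by (auto simp: r_def)
  have near: "cball (left_part \<xi>) r \<subseteq> D \<and> cball (vcnj (right_part \<xi>)) r \<subseteq> D" if "\<xi> \<in> ball \<zeta> r" for \<xi>
  proof -
    have "dist (left_part \<zeta>) (left_part \<xi>) \<le> r"
      using norm_parts(1)[of "\<zeta> - \<xi>"] that by (simp add: dist_norm parts_diff)
    moreover have "dist (vcnj (right_part \<zeta>)) (vcnj (right_part \<xi>)) \<le> r"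
      using norm_parts(2)[of "\<zeta> - \<xi>"] that
      by (simp add: dist_norm parts_diff flip: vcnj_add(2))
    ultimately have "cball (left_part \<xi>) r \<subseteq> cball (left_part \<zeta>) (2 * r)"
      "cball (vcnj (right_part \<xi>)) r \<subseteq> cball (vcnj (right_part \<zeta>)) (2 * r)"
      by (auto simp: cball_subset_cball_iff dist_commute)
    then show ?thesis using r by blast
  qed
  have mem: "left_part \<xi> \<in> D" "vcnj (right_part \<xi>) \<in> D" if "\<xi> \<in> ball \<zeta> r" for \<xi>
    using near[OF that] r(1) by auto
  show "\<exists>R>0. \<exists>M. ball \<zeta> R \<subseteq> doubled D \<and> (\<forall>\<xi>\<in>ball \<zeta> R. norm (polarized_kernel D \<xi>) \<le> M)"
    using mem near r(1) bergman_kernel_bound[OF D, of _ _ r]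
    by (intro exI[of _ r] conjI exI[of _ "1 / measure lborel (ball (0::complex^'a) r)"] ballI)
      (auto simp: polarized_kernel_def doubled_def)
next
  fix y
  show "holomorphic_fun {x. join x y \<in> doubled D} (\<lambda>x. polarized_kernel D (join x y))"
  proof (cases "vcnj y \<in> D")
    case True
    then show ?thesis
      using bergman_holomorphic[OF D bergman_kernel_reproducing(1)[OF D True]]
      by (simp add: polarized_kernel_def)
  qed (simp add: holomorphic_fun_def)
next
  fix x
  show "holomorphic_fun {y. join x y \<in> doubled D} (\<lambda>y. polarized_kernel D (join x y))"
  proof (cases "x \<in> D")
    case True
    have o: "open {y. vcnj y \<in> D}"
      using open_vimage[OF open_D[OF D] linear_continuous_on[OF bounded_linear_vcnj]]
      by (simp add: vimage_def)
    have "holomorphic_fun {y. vcnj y \<in> D} (\<lambda>y. cnj (bergman_kernel D (vcnj y) x))"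
      by (rule holomorphic_fun_vcnj[OF bergman_holomorphic[OF D bergman_kernel_reproducing(1)[OF D True]]])
    then have "holomorphic_fun {y. vcnj y \<in> D} (\<lambda>y. bergman_kernel D x (vcnj y))"
      by (rule holomorphic_fun_cong[OF o, rotated])
        (simp only: mem_Collect_eq bergman_kernel_hermitian[OF D _ True, symmetric])
    then show ?thesis using True by (simp add: polarized_kernel_def)
  qed (simp add: holomorphic_fun_def)
qed

lemma wirtinger_cong:
  assumes "open S" "p \<in> S" "\<And>z. z \<in> S \<Longrightarrow> f z = g z"
  shows "wirtinger j f p = wirtinger j g p" "wirtinger_bar j f p = wirtinger_bar j g p"
proof -
  have "(f has_derivative f') (at p) \<longleftrightarrow> (g has_derivative f') (at p)" for f'
    using has_derivative_transform_within_open[OF _ assms(1,2)] assms(3) by metis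
  then have "frechet_derivative f (at p) = frechet_derivative g (at p)"
    by (simp add: frechet_derivative_def)
  then show "wirtinger j f p = wirtinger j g p" "wirtinger_bar j f p = wirtinger_bar j g p"
    by (simp_all add: wirtinger_def wirtinger_bar_def)
qed

lemma wirtinger_join_left:
  assumes "open S" "holomorphic_fun S H" "join x y \<in> S"
  shows "wirtinger j (\<lambda>x. H (join x y)) x = wirtinger (Inl j) H (join x y)"
proof -
  have "((\<lambda>x. join x y) has_derivative (\<lambda>v. join v 0)) (at x)"
  proof (rule has_derivative_vec)
    fix i :: "'a + 'b"
    show "((\<lambda>x. join x y $ i) has_derivative (\<lambda>v. join v 0 $ i)) (at x)"
      by (cases i) (auto intro!: bounded_linear_imp_has_derivative bounded_linear_vec_nth)
  qed
  from diff_chain_at[OF this has_complex_differential(1)[OF assms(2,3)]]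
  have *: "((\<lambda>x. H (join x y)) has_derivative (\<lambda>v. complex_differential H (join x y) (join v 0))) (at x)"
    by (simp add: o_def)
  have "join (axis j c) (0 :: complex^'b) = c *s axis (Inl j) 1" for c
    by (auto simp: join_def axis_def vec_eq_iff split: sum.splits)
  then show ?thesis
    by (simp add: wirtinger_eq[OF *] complex_differential_scale has_complex_differential(2)[OF assms(2,3)]
        field_simps)
qed

text \<open>Let \<open>\<Phi>\<close> be the error of the difference quotient in the second variable.  It is of first order in the step width,
  uniformly and holomorphically in the first variable, so its own difference quotient there tends to 0; what is left is the
  difference quotient of the derivative \<open>D2\<close>.\<close>

lemma mixed_second_difference:
  fixes H :: "complex^('n::finite + 'm::finite) \<Rightarrow> complex" and e :: "nat \<Rightarrow> real"
  assumes S: "open S" and H: "holomorphic_fun S H" and pq: "join p q \<in> S"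
    and e: "\<And>n. e n > 0" "e \<longlonglongrightarrow> 0"
  shows "(\<lambda>n. (H (join (p + of_real (e n) *s v) (q + of_real (e n) *s w))
       - H (join (p + of_real (e n) *s v) q) - H (join p (q + of_real (e n) *s w)) + H (join p q))
       / of_real (e n) / of_real (e n))
    \<longlonglongrightarrow> (\<Sum>\<alpha>\<in>UNIV. \<Sum>\<beta>\<in>UNIV. v $ \<alpha> * w $ \<beta> * wirtinger (Inl \<alpha>) (wirtinger (Inr \<beta>) H) (join p q))"
proof -
  obtain R where R: "R > 0" "cball (join p q) (2 * R) \<subseteq> S"
    using S pq open_contains_cball[of S]
    by (metis field_sum_of_halves mult_2 half_gt_zero)
  obtain M where M: "\<And>\<zeta>. \<zeta> \<in> cball (join p q) (2 * R) \<Longrightarrow> norm (H \<zeta>) \<le> M"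
    using holomorphic_fun_bounded_on_cball[OF H R(2)] by blast
  define D2 where "D2 x = (\<Sum>\<beta>\<in>UNIV. w $ \<beta> * wirtinger (Inr \<beta>) H (join x q))" for x
  have norm_j: "norm (join x (0::complex^'m)) = norm x" "norm (join (0::complex^'n) y) = norm y" for x y
    using norm_join[of x "0::complex^'m"] norm_join[of "0::complex^'n" y] by simp_all
  have inS: "join x q \<in> ball (join p q) R" if "x \<in> ball p R" for x
    using that by (simp add: dist_norm join_diff norm_j)
  have inS2: "ball \<zeta> R \<subseteq> cball (join p q) (2 * R)" if "\<zeta> \<in> ball (join p q) R" for \<zeta>
    using that by (auto simp: subset_iff dist_commute intro: order_trans[OF dist_triangle[of _ _ \<zeta>]])
  have inS3: "join x q \<in> S" if "x \<in> ball p R" for x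
    using inS[OF that] R inS2 by auto
  have hol_left: "holomorphic_fun {x. join x y \<in> S} (\<lambda>x. F (join x y))" if "holomorphic_fun S F"
    for F and y :: "complex^'m"
  proof (rule holomorphic_fun_compose[OF _ that])
    show "holomorphic_map {x. join x y \<in> S} (\<lambda>x. join x y)"
      unfolding holomorphic_map_def
    proof
      fix i :: "'n + 'm"
      show "holomorphic_fun {x. join x y \<in> S} (\<lambda>x. join x y $ i)"
        by (cases i) (auto intro: holomorphic_fun_coordinate holomorphic_fun_const)
    qed
  qed auto
  have D2: "holomorphic_fun (ball p R) D2"
    unfolding D2_def
    by (intro holomorphic_fun_sum holomorphic_fun_cmult
        holomorphic_fun_subset[OF hol_left[OF holomorphic_fun_wirtinger[OF S H]]]) (use inS3 in auto)
  define C where "C = 32 * M * (norm w)\<^sup>2 / R\<^sup>2"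
  have C0: "C \<ge> 0"
    using M[of "join p q"] R(1) by (smt (verit) C_def centre_in_cball divide_nonneg_nonneg
        mult_nonneg_nonneg norm_ge_zero zero_le_power2)
  define \<Phi> where "\<Phi> \<epsilon> x = (H (join x (q + of_real \<epsilon> *s w)) - H (join x q)) / of_real \<epsilon> - D2 x" for \<epsilon> :: real and x
  have \<Phi>_bound: "norm (\<Phi> \<epsilon> x) \<le> C * \<epsilon>" if x: "x \<in> ball p R" and \<epsilon>: "\<epsilon> > 0" "\<epsilon> * norm w \<le> R / 2" for \<epsilon> x
  proof -
    let ?t = "join (0::complex^'n) (of_real \<epsilon> *s w)"
    have nt: "norm ?t = \<epsilon> * norm w" using \<epsilon> by (simp add: norm_j norm_scale_vec)
    have hb: "holomorphic_fun (ball (join x q) R) H"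
      by (rule holomorphic_fun_subset[OF H]) (use inS2[OF inS[OF x]] R(2) in blast)
    have "norm (H (join x q + ?t) - H (join x q) - complex_differential H (join x q) ?t) \<le> 32 * M * (norm ?t)\<^sup>2 / R\<^sup>2"
      using \<epsilon> M inS2[OF inS[OF x]]
      by (intro holomorphic_fun_estimates(2)[OF hb R(1)]) (auto simp: nt)
    moreover have "complex_differential H (join x q) ?t = of_real \<epsilon> * D2 x"
      by (simp add: complex_differential_def sum_UNIV_plus D2_def sum_distrib_left mult_ac)
    moreover have "join x q + ?t = join x (q + of_real \<epsilon> *s w)" by (simp add: join_add)
    ultimately have *: "norm (H (join x (q + of_real \<epsilon> *s w)) - H (join x q) - of_real \<epsilon> * D2 x) \<le> C * \<epsilon>\<^sup>2"
      by (simp add: nt C_def power_mult_distrib mult_ac)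
    have "\<Phi> \<epsilon> x = (H (join x (q + of_real \<epsilon> *s w)) - H (join x q) - of_real \<epsilon> * D2 x) / of_real \<epsilon>"
      using \<epsilon> by (simp add: \<Phi>_def field_simps)
    then have "norm (\<Phi> \<epsilon> x) = norm (H (join x (q + of_real \<epsilon> *s w)) - H (join x q) - of_real \<epsilon> * D2 x) / \<epsilon>"
      using \<epsilon> by (simp add: norm_divide)
    also have "\<dots> \<le> C * \<epsilon>\<^sup>2 / \<epsilon>" using * \<epsilon> by (intro divide_right_mono) auto
    finally show ?thesis using \<epsilon> by (simp add: power2_eq_square)
  qed
  have \<Phi>_hol: "holomorphic_fun (ball p R) (\<Phi> \<epsilon>)" if \<epsilon>: "\<epsilon> > 0" "\<epsilon> * norm w \<le> R / 2" for \<epsilon>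
  proof -
    have "join x (q + of_real \<epsilon> *s w) \<in> S" if "x \<in> ball p R" for x
    proof -
      have "join x (q + of_real \<epsilon> *s w) = join x q + join 0 (of_real \<epsilon> *s w)" by (simp add: join_add)
      moreover have "norm (join (0::complex^'n) (of_real \<epsilon> *s w)) < R"
        using \<epsilon> R(1) by (simp add: norm_j norm_scale_vec)
      ultimately have "join x (q + of_real \<epsilon> *s w) \<in> ball (join x q) R" by (simp add: dist_norm)
      then show ?thesis using inS2[OF inS[OF that]] R(2) by blast
    qed
    then have "holomorphic_fun (ball p R)
        (\<lambda>x. inverse (of_real \<epsilon>) * (H (join x (q + of_real \<epsilon> *s w)) - H (join x q)) - D2 x)"
      using inS3 by (intro holomorphic_fun_diff holomorphic_fun_cmult D2
          holomorphic_fun_subset[OF hol_left[OF H]]) auto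
    then show ?thesis by (simp add: \<Phi>_def[abs_def] divide_inverse mult.commute)
  qed
  have ev: "\<forall>\<^sub>F n in sequentially. e n * norm v < R / 2 \<and> e n * norm w < R / 2"
  proof (intro eventually_conj)
    have "(\<lambda>n. e n * norm v) \<longlonglongrightarrow> 0 * norm v" "(\<lambda>n. e n * norm w) \<longlonglongrightarrow> 0 * norm w"
      by (intro tendsto_intros e)+
    then show "\<forall>\<^sub>F n in sequentially. e n * norm v < R / 2" "\<forall>\<^sub>F n in sequentially. e n * norm w < R / 2"
      using R(1) by (auto dest!: order_tendstoD(2)[of _ _ _ "R / 2"])
  qed
  have "(\<lambda>n. (\<Phi> (e n) (p + of_real (e n) *s v) - \<Phi> (e n) p) / of_real (e n)) \<longlonglongrightarrow> 0"
  proof (rule Lim_null_comparison)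
    show "\<forall>\<^sub>F n in sequentially. norm ((\<Phi> (e n) (p + of_real (e n) *s v) - \<Phi> (e n) p) / of_real (e n))
        \<le> 4 * C / R * norm v * e n"
      using ev
    proof eventually_elim
      case (elim n)
      have en: "e n > 0" "e n * norm w \<le> R / 2" using e(1) elim by auto
      have "norm (\<Phi> (e n) (p + of_real (e n) *s v) - \<Phi> (e n) p)
          \<le> 4 * (C * e n) / R * norm (p + of_real (e n) *s v - p)"
        by (rule holomorphic_fun_lipschitz[OF \<Phi>_hol[OF en] R(1) \<Phi>_bound[OF _ en]])
          (use elim e(1)[of n] R(1) in \<open>auto simp: dist_norm norm_scale_vec\<close>)
      then have "norm (\<Phi> (e n) (p + of_real (e n) *s v) - \<Phi> (e n) p) / e n
          \<le> 4 * (C * e n) / R * (e n * norm v) / e n"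
        using e(1)[of n] by (intro divide_right_mono) (auto simp: norm_scale_vec)
      then show ?case using e(1)[of n] by (simp add: norm_divide mult_ac)
    qed
    have "(\<lambda>n. 4 * C / R * norm v * e n) \<longlonglongrightarrow> 4 * C / R * norm v * 0"
      by (intro tendsto_intros e)
    then show "(\<lambda>n. 4 * C / R * norm v * e n) \<longlonglongrightarrow> 0" by simp
  qed
  moreover have "(\<lambda>n. (D2 (p + of_real (e n) *s v) - D2 p) / of_real (e n)) \<longlonglongrightarrow> complex_differential D2 p v"
  proof -
    have "((\<lambda>\<zeta>. D2 (p + \<zeta> *s v)) has_field_derivative complex_differential D2 (p + 0 *s v) v) (at 0)"
      by (rule slice_has_field_derivative[OF D2]) (use R(1) in simp)
    then have "((\<lambda>h. (D2 (p + h *s v) - D2 p) / h) \<longlongrightarrow> complex_differential D2 p v) (at 0)"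
      by (simp add: has_field_derivative_iff)
    moreover have "filterlim (\<lambda>n. complex_of_real (e n)) (at 0) sequentially"
      using e(1) tendsto_of_real[OF e(2), where 'a = complex]
      by (auto simp: filterlim_at less_imp_neq[THEN not_sym] intro!: always_eventually)
    ultimately show ?thesis by (rule filterlim_compose)
  qed
  ultimately have "(\<lambda>n. (\<Phi> (e n) (p + of_real (e n) *s v) - \<Phi> (e n) p) / of_real (e n)
       + (D2 (p + of_real (e n) *s v) - D2 p) / of_real (e n)) \<longlonglongrightarrow> 0 + complex_differential D2 p v"
    by (rule tendsto_add)
  moreover have "(\<Phi> (e n) (p + of_real (e n) *s v) - \<Phi> (e n) p) / of_real (e n)
       + (D2 (p + of_real (e n) *s v) - D2 p) / of_real (e n)
     = (H (join (p + of_real (e n) *s v) (q + of_real (e n) *s w))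
       - H (join (p + of_real (e n) *s v) q) - H (join p (q + of_real (e n) *s w)) + H (join p q))
       / of_real (e n) / of_real (e n)" for n
    using e(1)[of n] by (simp add: \<Phi>_def field_simps)
  moreover have "complex_differential D2 p v =
     (\<Sum>\<alpha>\<in>UNIV. \<Sum>\<beta>\<in>UNIV. v $ \<alpha> * w $ \<beta> * wirtinger (Inl \<alpha>) (wirtinger (Inr \<beta>) H) (join p q))"
  proof -
    have "wirtinger \<alpha> D2 p = (\<Sum>\<beta>\<in>UNIV. w $ \<beta> * wirtinger (Inl \<alpha>) (wirtinger (Inr \<beta>) H) (join p q))" for \<alpha>
    proof -
      have d: "((\<lambda>x. wirtinger (Inr \<beta>) H (join x q)) has_derivative
          complex_differential (\<lambda>x. wirtinger (Inr \<beta>) H (join x q)) p) (at p)" for \<beta>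
        using has_complex_differential(1)[OF hol_left[OF holomorphic_fun_wirtinger[OF S H]]] pq by blast
      have pR: "p \<in> ball p R" using R(1) by simp
      have "(D2 has_derivative (\<lambda>v. \<Sum>\<beta>\<in>UNIV. w $ \<beta> *
          complex_differential (\<lambda>x. wirtinger (Inr \<beta>) H (join x q)) p v)) (at p)"
        unfolding D2_def by (intro has_derivative_sum has_derivative_mult_right d)
      from has_derivative_unique[OF has_complex_differential(1)[OF D2 pR] this]
      have "complex_differential D2 p (axis \<alpha> 1) = (\<Sum>\<beta>\<in>UNIV. w $ \<beta> *
          complex_differential (\<lambda>x. wirtinger (Inr \<beta>) H (join x q)) p (axis \<alpha> 1))"
        by (rule fun_cong)
      moreover have "complex_differential (\<lambda>x. wirtinger (Inr \<beta>) H (join x q)) p (axis \<alpha> 1)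
          = wirtinger (Inl \<alpha>) (wirtinger (Inr \<beta>) H) (join p q)" for \<beta>
        unfolding wirtinger_join_left[OF S holomorphic_fun_wirtinger[OF S H] pq, symmetric]
        by (rule has_complex_differential(2)[OF hol_left[OF holomorphic_fun_wirtinger[OF S H]]])
          (simp add: pq)
      ultimately show ?thesis
        using has_complex_differential(2)[OF D2, of p \<alpha>] R(1) by simp
    qed
    then show ?thesis
      by (simp add: complex_differential_def sum_distrib_left mult.assoc)
  qed
  ultimately show ?thesis by simp
qed

section \<open>Wirtinger calculus\<close>

text \<open>The real differential of \<open>f\<close> is the sum of \<open>a j dz\<^sub>j + b j d\<close>(conjugate \<open>z\<^sub>j\<close>).  This form makes the calculus rules for
  \<open>wirtinger\<close> and \<open>wirtinger_bar\<close> available together with differentiability.\<close>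

definition has_wirtinger ::
    "(complex^'n::finite \<Rightarrow> complex) \<Rightarrow> ('n \<Rightarrow> complex) \<Rightarrow> ('n \<Rightarrow> complex) \<Rightarrow> complex^'n \<Rightarrow> bool" where
  "has_wirtinger f a b p \<longleftrightarrow>
     (f has_derivative (\<lambda>v. (\<Sum>j\<in>UNIV. v $ j * a j) + (\<Sum>j\<in>UNIV. cnj (v $ j) * b j))) (at p)"

lemma has_wirtinger_imp:
  assumes "has_wirtinger f a b p"
  shows "wirtinger j f p = a j" "wirtinger_bar j f p = b j"
proof -
  have s: "(\<Sum>i\<in>UNIV. axis j c $ i * h i) = c * h j" "(\<Sum>i\<in>UNIV. cnj (axis j c $ i) * h i) = cnj c * h j"
    for h and c :: complex
    by (simp_all add: axis_def if_distrib[of cnj] if_distrib[of "\<lambda>x. x * _"] cong: if_cong)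
  show "wirtinger j f p = a j" "wirtinger_bar j f p = b j"
    unfolding wirtinger_eq[OF assms[unfolded has_wirtinger_def]] s by (simp_all add: field_simps)
qed

lemma has_wirtinger_differentiable:
  fixes f :: "complex^'n::finite \<Rightarrow> complex"
  assumes "f differentiable (at p)"
  shows "has_wirtinger f (\<lambda>j. wirtinger j f p) (\<lambda>j. wirtinger_bar j f p) p"
proof -
  obtain f' where f': "(f has_derivative f') (at p)" using assms by (auto simp: differentiable_def)
  have lin: "linear f'" using f' has_derivative_linear by blast
  have ax: "f' (axis j c) = Re c *\<^sub>R f' (axis j 1) + Im c *\<^sub>R f' (axis j \<i>)" for j c
  proof -
    have "axis j c = Re c *\<^sub>R axis j 1 + Im c *\<^sub>R axis j \<i>"
      by (auto simp: vec_eq_iff axis_def complex_eq_iff)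
    then show ?thesis using lin by (simp add: linear_add linear_scale)
  qed
  have "f' v = (\<Sum>j\<in>UNIV. v $ j * wirtinger j f p) + (\<Sum>j\<in>UNIV. cnj (v $ j) * wirtinger_bar j f p)" for v
  proof -
    have "f' v = (\<Sum>j\<in>UNIV. f' (axis j (v $ j)))"
      by (subst vec_eq_sum_axis[of v]) (simp add: linear_sum[OF lin] flip: axis_scale)
    also have "\<dots> = (\<Sum>j\<in>UNIV. v $ j * wirtinger j f p + cnj (v $ j) * wirtinger_bar j f p)"
    proof (intro sum.cong refl)
      fix j
      have "v $ j = of_real (Re (v $ j)) + \<i> * of_real (Im (v $ j))" by (rule complex_eq)
      then show "f' (axis j (v $ j)) = v $ j * wirtinger j f p + cnj (v $ j) * wirtinger_bar j f p"
        unfolding wirtinger_eq[OF f'] ax[of j "v $ j"] scaleR_conv_of_real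
        by (simp add: complex_eq_iff field_simps)
    qed
    finally show ?thesis by (simp add: sum.distrib)
  qed
  then show ?thesis using f' unfolding has_wirtinger_def by presburger
qed

lemma has_wirtinger_imp_differentiable: "has_wirtinger f a b p \<Longrightarrow> f differentiable (at p)"
  by (auto simp: has_wirtinger_def differentiable_def)

lemma has_wirtinger_const: "has_wirtinger (\<lambda>_. c) (\<lambda>_. 0) (\<lambda>_. 0) p"
  by (simp add: has_wirtinger_def)

lemma has_wirtinger_add:
  "has_wirtinger f a b p \<Longrightarrow> has_wirtinger g a' b' p \<Longrightarrow>
    has_wirtinger (\<lambda>z. f z + g z) (\<lambda>j. a j + a' j) (\<lambda>j. b j + b' j) p"
  unfolding has_wirtinger_def
  by (drule (1) has_derivative_add) (simp add: algebra_simps sum.distrib)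

lemma has_wirtinger_mult:
  "has_wirtinger f a b p \<Longrightarrow> has_wirtinger g a' b' p \<Longrightarrow>
    has_wirtinger (\<lambda>z. f z * g z) (\<lambda>j. a j * g p + f p * a' j) (\<lambda>j. b j * g p + f p * b' j) p"
  unfolding has_wirtinger_def
  by (drule (1) has_derivative_mult)
    (simp add: algebra_simps sum.distrib sum_distrib_left)

lemma has_wirtinger_cmult:
  "has_wirtinger f a b p \<Longrightarrow> has_wirtinger (\<lambda>z. c * f z) (\<lambda>j. c * a j) (\<lambda>j. c * b j) p"
  using has_wirtinger_mult[OF has_wirtinger_const[of c]] by fastforce

lemma has_wirtinger_diff:
  "has_wirtinger f a b p \<Longrightarrow> has_wirtinger g a' b' p \<Longrightarrow>
    has_wirtinger (\<lambda>z. f z - g z) (\<lambda>j. a j - a' j) (\<lambda>j. b j - b' j) p"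
  using has_wirtinger_add[OF _ has_wirtinger_cmult[of g a' b' p "-1"], of f a b] by simp

lemma has_wirtinger_compose_field:
  assumes "has_wirtinger f a b p" "(F has_field_derivative F') (at (f p))"
  shows "has_wirtinger (\<lambda>z. F (f z)) (\<lambda>j. F' * a j) (\<lambda>j. F' * b j) p"
  using diff_chain_at[OF assms(1)[unfolded has_wirtinger_def] assms(2)[unfolded has_field_derivative_def]]
  by (simp add: has_wirtinger_def o_def distrib_left sum_distrib_left mult_ac)

lemma has_wirtinger_inverse:
  "has_wirtinger f a b p \<Longrightarrow> f p \<noteq> 0 \<Longrightarrow>
    has_wirtinger (\<lambda>z. inverse (f z)) (\<lambda>j. - a j / (f p)\<^sup>2) (\<lambda>j. - b j / (f p)\<^sup>2) p"
  using has_wirtinger_compose_field[of f a b p "\<lambda>x. inverse x" "- (inverse (f p) ^ 2)"] DERIV_inverse[of "f p"]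
  by (simp add: field_simps power2_eq_square)

lemma has_wirtinger_cnj:
  assumes "has_wirtinger f a b p"
  shows "has_wirtinger (\<lambda>z. cnj (f z)) (\<lambda>j. cnj (b j)) (\<lambda>j. cnj (a j)) p"
  using bounded_linear.has_derivative[OF bounded_linear_cnj assms[unfolded has_wirtinger_def]]
  by (simp add: has_wirtinger_def add.commute)

lemma has_wirtinger_sum:
  "(\<And>i. i \<in> I \<Longrightarrow> has_wirtinger (f i) (a i) (b i) p) \<Longrightarrow>
     has_wirtinger (\<lambda>z. \<Sum>i\<in>I. f i z) (\<lambda>j. \<Sum>i\<in>I. a i j) (\<lambda>j. \<Sum>i\<in>I. b i j) p"
  by (induction I rule: infinite_finite_induct)
    (auto intro: has_wirtinger_const has_wirtinger_add)

lemma has_wirtinger_holomorphic: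
  assumes "holomorphic_fun S f" "p \<in> S"
  shows "has_wirtinger f (\<lambda>j. wirtinger j f p) (\<lambda>_. 0) p"
  using has_complex_differential(1)[OF assms]
  by (simp add: has_wirtinger_def complex_differential_def[abs_def])

lemma has_wirtinger_compose_map:
  assumes F: "holomorphic_map S F" "p \<in> S" and g: "has_wirtinger g a b (F p)"
  shows "has_wirtinger (\<lambda>z. g (F z)) (\<lambda>j. \<Sum>i\<in>UNIV. a i * jacobian F p $ i $ j)
     (\<lambda>j. \<Sum>i\<in>UNIV. b i * cnj (jacobian F p $ i $ j)) p"
proof -
  have 1: "(\<Sum>i\<in>UNIV. (\<Sum>j\<in>UNIV. A i j * v j) * c i) = (\<Sum>j\<in>UNIV. v j * (\<Sum>i\<in>UNIV. c i * A i j))"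
    for A :: "_ \<Rightarrow> _ \<Rightarrow> complex" and v c
    by (simp add: sum_distrib_left sum_distrib_right mult_ac) (rule sum.swap)
  from diff_chain_at[OF has_derivative_jacobian[OF F] g[unfolded has_wirtinger_def]]
  show ?thesis
    by (simp add: has_wirtinger_def o_def matrix_vector_mult_def 1)
qed

lemma has_wirtinger_cong:
  assumes "open S" "p \<in> S" "\<And>z. z \<in> S \<Longrightarrow> f z = g z" "has_wirtinger f a b p"
  shows "has_wirtinger g a b p"
  using has_derivative_transform_within_open[OF assms(4)[unfolded has_wirtinger_def] assms(1,2)] assms(3)
  by (simp add: has_wirtinger_def)

section \<open>Polarizable functions\<close>

text \<open>Restrictions of holomorphic functions of \<open>(z, w)\<close> to \<open>w = vcnj z\<close>.  The class contains the kernel on the diagonal and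
  is stable under both kinds of Wirtinger derivatives, so its members are smooth.\<close>

definition polarizable :: "(complex^'n::finite) set \<Rightarrow> (complex^'n \<Rightarrow> complex) \<Rightarrow> bool" where
  "polarizable D u \<longleftrightarrow>
     (\<exists>H. holomorphic_fun (doubled D) H \<and> (\<forall>z\<in>D. u z = H (join z (vcnj z))))"

lemma has_wirtinger_polarized:
  assumes D: "open D" "p \<in> D" and H: "holomorphic_fun (doubled D) H" "\<And>z. z \<in> D \<Longrightarrow> u z = H (join z (vcnj z))"
  shows "has_wirtinger u (\<lambda>j. wirtinger (Inl j) H (join p (vcnj p))) (\<lambda>j. wirtinger (Inr j) H (join p (vcnj p))) p"
proof -
  have "((\<lambda>z. join z (vcnj z)) has_derivative (\<lambda>v. join v (vcnj v))) (at p)"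
  proof (rule has_derivative_vec)
    fix i :: "'a + 'a"
    show "((\<lambda>z. join z (vcnj z) $ i) has_derivative (\<lambda>v. join v (vcnj v) $ i)) (at p)"
      by (cases i) (auto intro!: bounded_linear_imp_has_derivative bounded_linear_vec_nth
          bounded_linear_compose[OF bounded_linear_cnj])
  qed
  moreover have "(H has_derivative complex_differential H (join p (vcnj p))) (at (join p (vcnj p)))"
    by (rule has_complex_differential(1)[OF H(1)]) (simp add: D)
  ultimately have "has_wirtinger (\<lambda>z. H (join z (vcnj z)))
      (\<lambda>j. wirtinger (Inl j) H (join p (vcnj p))) (\<lambda>j. wirtinger (Inr j) H (join p (vcnj p))) p"
    unfolding has_wirtinger_def
    by (auto dest: diff_chain_at simp: o_def complex_differential_def sum_UNIV_plus)
  then show ?thesis by (rule has_wirtinger_cong[OF D, rotated]) (simp add: H(2))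
qed

lemma polarizable_differentiable:
  assumes "open D" "p \<in> D" "polarizable D u"
  shows "has_wirtinger u (\<lambda>j. wirtinger j u p) (\<lambda>j. wirtinger_bar j u p) p"
  using assms has_wirtinger_polarized[OF assms(1,2)]
  by (metis has_wirtinger_differentiable has_wirtinger_imp_differentiable polarizable_def)

lemma polarizable_wirtinger:
  assumes D: "open D" and u: "polarizable D u"
  shows "polarizable D (wirtinger j u)" "polarizable D (wirtinger_bar j u)"
proof -
  obtain H where H: "holomorphic_fun (doubled D) H" "\<And>z. z \<in> D \<Longrightarrow> u z = H (join z (vcnj z))"
    using u by (auto simp: polarizable_def)
  note w = has_wirtinger_imp[OF has_wirtinger_polarized[OF D _ H]]
  show "polarizable D (wirtinger j u)" "polarizable D (wirtinger_bar j u)"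
    unfolding polarizable_def
    using w holomorphic_fun_wirtinger[OF open_doubled[OF D] H(1)] by blast+
qed

lemma polarizable_bergman_kernel:
  assumes "bounded_domain D"
  shows "polarizable D (\<lambda>z. bergman_kernel D z z)"
  unfolding polarizable_def
  using polarized_kernel_holomorphic[OF assms] by (auto simp: polarized_kernel_def intro!: exI)

section \<open>Symmetries of a bounded domain\<close>

context
  fixes D :: "(complex^'n::finite) set" and s :: "complex^'n \<Rightarrow> complex^'n"
  assumes D: "bounded_domain D" and s: "holomorphic_map D s" "s ` D \<subseteq> D"
    and inv: "\<And>z. z \<in> D \<Longrightarrow> s (s z) = z"
begin

lemma involution_mem: "z \<in> D \<Longrightarrow> s z \<in> D"
  using s(2) by blast

lemma involution_image: "s ` D = D" and involution_inj: "inj_on s D"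
proof -
  show "s ` D = D" using s(2) inv by (force simp: image_iff)
  show "inj_on s D" using inv by (metis inj_onI)
qed

text \<open>The chain rule for \<open>s \<circ> s\<close>, which is the identity near \<open>z\<close>.\<close>

lemma jacobian_involution: "jacobian s (s z) ** jacobian s z = mat 1" if z: "z \<in> D"
proof -
  have "((s \<circ> s) has_derivative ((*v) (jacobian s (s z)) \<circ> (*v) (jacobian s z))) (at z)"
    by (intro diff_chain_at has_derivative_jacobian[OF s(1)] z involution_mem)
  then have "((\<lambda>z. z) has_derivative ((*v) (jacobian s (s z)) \<circ> (*v) (jacobian s z))) (at z)"
    by (rule has_derivative_transform_within_open[OF _ open_D[OF D] z]) (simp add: inv)
  from has_derivative_unique[OF this has_derivative_ident]
  have "(jacobian s (s z) ** jacobian s z) *v v = mat 1 *v v" for v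
    by (simp add: fun_eq_iff matrix_vector_mul_assoc)
  then show ?thesis by (simp add: matrix_eq)
qed

lemma det_jacobian_involution: "det (jacobian s (s z)) * det (jacobian s z) = 1" if "z \<in> D"
  using jacobian_involution[OF that] by (metis det_I det_mul)

lemma det_jacobian_nonzero: "det (jacobian s z) \<noteq> 0" if "z \<in> D"
  using det_jacobian_involution[OF that] by auto

text \<open>The weight makes this a unitary operator on the Bergman space, by the change of variables formula; it is an
  involution because \<open>s\<close> is one.\<close>

definition pullback :: "(complex^'n \<Rightarrow> complex) \<Rightarrow> complex^'n \<Rightarrow> complex" where
  "pullback f z = det (jacobian s z) * f (s z)"

lemma pullback_bergman:
  assumes f: "f \<in> bergman_space D"
  shows "pullback f \<in> bergman_space D"
proof -
  have "holomorphic_fun D (pullback f)"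
    unfolding pullback_def
    by (intro holomorphic_fun_mult holomorphic_fun_det_jacobian open_D[OF D] s(1)
        holomorphic_fun_compose[OF s(1) bergman_holomorphic[OF D f] s(2)])
  moreover have "set_integrable lborel D (\<lambda>z. (cmod (det (jacobian s z)))\<^sup>2 * (cmod (f (s z)))\<^sup>2)"
    using holomorphic_fun_continuous[OF bergman_holomorphic[OF D f]] bergman_square_integrable[OF D f]
    by (intro real_change_of_variables(1)[OF open_D[OF D] s(1) involution_inj det_jacobian_nonzero,
          unfolded involution_image] open_D[OF D] continuous_intros) auto
  ultimately show ?thesis
    by (simp add: bergman_space_def pullback_def norm_mult power_mult_distrib)
qed

lemma pullback_unitary:
  assumes f: "f \<in> bergman_space D" and g: "g \<in> bergman_space D"
  shows "bergman_inner D (pullback f) (pullback g) = bergman_inner D f g"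
proof -
  have c: "continuous_on D (\<lambda>z. f z * cnj (g z))"
    using f g bergman_holomorphic[OF D] holomorphic_fun_continuous by (intro continuous_intros) auto
  have "bergman_inner D f g
      = (LINT z:D|lborel. of_real ((cmod (det (jacobian s z)))\<^sup>2) * (f (s z) * cnj (g (s z))))"
    unfolding bergman_inner_def
    using holomorphic_change_of_variables(2)[OF open_D[OF D] s(1) involution_inj det_jacobian_nonzero,
        unfolded involution_image, OF _ open_D[OF D] c bergman_product_integrable[OF D f g]]
    by simp
  then show ?thesis
    unfolding bergman_inner_def pullback_def complex_norm_square by (simp add: mult_ac)
qed

lemma bergman_inner_cong: "(\<And>z. z \<in> D \<Longrightarrow> f z = f' z) \<Longrightarrow> bergman_inner D f g = bergman_inner D f' g"
  unfolding bergman_inner_def set_lebesgue_integral_def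
  by (intro Bochner_Integration.integral_cong) (auto simp: indicator_def)

text \<open>The right-hand side, as a function of \<open>z\<close>, reproduces the value at \<open>w\<close>, since \<open>pullback\<close> is unitary and an
  involution; and such a function is unique.\<close>

lemma bergman_kernel_transformation:
  assumes z: "z \<in> D" and w: "w \<in> D"
  shows "bergman_kernel D z w =
    det (jacobian s z) * bergman_kernel D (s z) (s w) * cnj (det (jacobian s w))"
proof -
  let ?J = "\<lambda>z. det (jacobian s z)"
  let ?k = "\<lambda>z. bergman_kernel D z (s w)"
  define k where "k z = cnj (?J w) * pullback ?k z" for z
  have kb: "?k \<in> bergman_space D" using bergman_kernel_reproducing(1)[OF D involution_mem[OF w]] .
  have k: "k \<in> bergman_space D"
    unfolding k_def by (rule bergman_cmult[OF D pullback_bergman[OF kb]])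
  have rep: "bergman_inner D f k = f w" if f: "f \<in> bergman_space D" for f
  proof -
    have JJ: "?J u * ?J (s u) = 1" if "u \<in> D" for u
      using det_jacobian_involution[OF that] by (simp add: mult.commute)
    have "bergman_inner D f k = ?J w * bergman_inner D f (pullback ?k)"
      unfolding k_def[abs_def] bergman_inner_cmult_right[OF D] by simp
    also have "bergman_inner D f (pullback ?k) = bergman_inner D (pullback (pullback f)) (pullback ?k)"
      by (rule bergman_inner_cong) (simp add: pullback_def inv JJ flip: mult.assoc)
    also have "\<dots> = bergman_inner D (pullback f) ?k"
      by (rule pullback_unitary[OF pullback_bergman[OF f] kb])
    also have "\<dots> = ?J (s w) * f w"
      using bergman_kernel_reproducing(2)[OF D involution_mem[OF w] pullback_bergman[OF f]]
      by (simp add: pullback_def inv w)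
    finally show ?thesis using JJ[OF w] by (simp flip: mult.assoc)
  qed
  have "k z = bergman_inner D k (\<lambda>x. bergman_kernel D x z)"
    using bergman_kernel_reproducing(2)[OF D z k] by simp
  also have "\<dots> = cnj (bergman_inner D (\<lambda>x. bergman_kernel D x z) k)"
    by (rule bergman_inner_cnj[OF D])
  also have "\<dots> = cnj (bergman_kernel D w z)"
    using rep[OF bergman_kernel_reproducing(1)[OF D z]] by simp
  also have "\<dots> = bergman_kernel D z w"
    using bergman_kernel_hermitian[OF D w z] by simp
  finally show ?thesis by (simp add: k_def pullback_def mult_ac)
qed

text \<open>The map \<open>\<psi>\<close> conjugates \<open>s\<close> to its linear part \<open>A\<close>, as \<open>A\<^sup>2 = 1\<close>, and as its derivative at \<open>p\<close> is 2, it
  is injective near \<open>p\<close> and takes all values near 0.  A fixed vector \<open>u\<close> of \<open>A\<close> would give fixed points of \<open>s\<close> arbitrarily close to \<open>p\<close>.\<close>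

lemma involution_jacobian_fixed_point:
  assumes p: "p \<in> D" "s p = p" and iso: "e > 0" "\<And>z. z \<in> D \<inter> ball p e \<Longrightarrow> s z = z \<Longrightarrow> z = p"
  shows "jacobian s p *v v = - v"
proof (rule ccontr)
  assume neq: "jacobian s p *v v \<noteq> - v"
  define A where "A = jacobian s p"
  have AA: "A *v (A *v x) = x" for x
    using jacobian_involution[OF p(1)] p(2) by (simp add: A_def matrix_vector_mul_assoc)
  define u where "u = v + A *v v"
  have u: "u \<noteq> 0" "A *v u = u"
    using neq AA[of v] by (auto simp: u_def A_def[symmetric] matrix_vector_right_distrib eq_neg_iff_add_eq_0 add.commute)
  define \<psi> where "\<psi> z = (z - p) + A *v (s z - p)" for z
  have bl: "bounded_linear ((*v) A)"
    using linear_matrix_vector linear_conv_bounded_linear by blast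
  have der_s: "(s has_derivative (*v) (jacobian s z)) (at z)" if "z \<in> D" for z
    using has_derivative_jacobian[OF s(1) that] .
  have \<psi>': "(\<psi> has_derivative (\<lambda>v. v + A *v (jacobian s z *v v))) (at z)" if "z \<in> D" for z
  proof -
    have "(\<psi> has_derivative (\<lambda>v. (v - 0) + A *v (jacobian s z *v v - 0))) (at z)"
      unfolding \<psi>_def
      by (intro has_derivative_add has_derivative_diff has_derivative_ident has_derivative_const
          bounded_linear.has_derivative[OF bl] der_s that)
    then show ?thesis by simp
  qed
  have conj: "\<psi> (s z) = A *v \<psi> z" if "z \<in> D" for z
    using inv[OF that] AA by (simp add: \<psi>_def matrix_vector_right_distrib)
  have "\<exists>\<delta>>0. ball p \<delta> \<subseteq> D \<and> inj_on \<psi> (ball p \<delta>)"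
  proof -
    \<comment> \<open>the nonlinear part of \<psi> vanishes to second order, so it is a contraction on small balls\<close>
    define N where "N i z = \<psi> z $ i - 2 * (z $ i - p $ i)" for i z
    obtain r where r: "r > 0" "cball p r \<subseteq> D" using open_D[OF D] p(1) open_contains_cball by blast
    have holN: "holomorphic_fun D (N i)" for i
      unfolding N_def \<psi>_def using s(1)
      by (auto simp: matrix_vector_mult_def holomorphic_map_def
          intro!: holomorphic_fun_diff holomorphic_fun_add holomorphic_fun_cmult holomorphic_fun_sum
            holomorphic_fun_coordinate holomorphic_fun_const)
    have N0: "N i p = 0" for i by (simp add: N_def \<psi>_def p(2))
    have dN: "complex_differential (N i) p v = 0" for i v
    proof -
      have "(N i has_derivative (\<lambda>v. (v + A *v (jacobian s p *v v)) $ i - 2 * (v $ i - 0))) (at p)"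
        unfolding N_def
        by (intro has_derivative_diff has_derivative_mult_right has_derivative_const
            bounded_linear_imp_has_derivative bounded_linear_vec_nth
            bounded_linear.has_derivative[OF bounded_linear_vec_nth \<psi>'[OF p(1)]])
      from has_derivative_unique[OF has_complex_differential(1)[OF holN p(1)] this]
      show ?thesis by (simp add: AA A_def[symmetric])
    qed
    have "\<exists>M. \<forall>i. \<forall>z\<in>cball p r. norm (N i z) \<le> M"
    proof -
      have "\<exists>M. \<forall>z\<in>cball p r. norm (N i z) \<le> M" for i
        using holomorphic_fun_bounded_on_cball[OF holN r(2)] by metis
      then obtain M where M: "\<And>i z. z \<in> cball p r \<Longrightarrow> norm (N i z) \<le> M i" by metis
      have "norm (N i z) \<le> (\<Sum>i\<in>UNIV. M i)" if "z \<in> cball p r" for i z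
      proof -
        have "M i \<ge> 0" for i using M[OF that, of i] norm_ge_zero order_trans by blast
        then have "M i \<le> (\<Sum>i\<in>UNIV. M i)" by (intro member_le_sum) auto
        then show ?thesis using M[OF that, of i] by linarith
      qed
      then show ?thesis by blast
    qed
    then obtain M where M: "\<And>i z. z \<in> cball p r \<Longrightarrow> norm (N i z) \<le> M" by blast
    have M0: "M \<ge> 0" using M[of p] r(1) norm_ge_zero order_trans by (metis centre_in_cball less_imp_le)
    \<comment> \<open>c * \<delta> bounds the Lipschitz constant of the nonlinear part on the ball of radius \<delta>/2\<close>
    define c where "c = 128 * M / r\<^sup>2 * real CARD('n)"
    define \<delta> where "\<delta> = min (r / 2) (1 / (c + 1))"
    have c0: "c \<ge> 0" using M0 by (simp add: c_def)
    have \<delta>: "\<delta> > 0" "\<delta> \<le> r / 2" "c * \<delta> < 1"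
    proof -
      show "\<delta> > 0" "\<delta> \<le> r / 2" using r(1) c0 by (auto simp: \<delta>_def)
      have "c * \<delta> \<le> c * (1 / (c + 1))" using c0 by (intro mult_left_mono) (auto simp: \<delta>_def)
      also have "\<dots> < 1" using c0 by (simp add: field_simps)
      finally show "c * \<delta> < 1" .
    qed
    have sub: "ball p \<delta> \<subseteq> cball p r" using \<delta>(2) r(1) by auto
    have small: "norm (N i z) \<le> 32 * M * \<delta>\<^sup>2 / r\<^sup>2" if z: "z \<in> ball p \<delta>" for i z
    proof -
      have nz: "norm (z - p) \<le> \<delta>" using z by (simp add: dist_norm norm_minus_commute)
      have hb: "holomorphic_fun (ball p r) (N i)"
        by (rule holomorphic_fun_subset[OF holN]) (use r(2) ball_subset_cball in blast)
      have "norm (N i (p + (z - p)) - N i p - complex_differential (N i) p (z - p)) \<le> 32 * M * (norm (z - p))\<^sup>2 / r\<^sup>2"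
        using nz \<delta>(2) M by (intro holomorphic_fun_estimates(2)[OF hb r(1)]) auto
      also have "\<dots> \<le> 32 * M * \<delta>\<^sup>2 / r\<^sup>2"
        using nz M0 by (intro divide_right_mono mult_left_mono power_mono) auto
      finally show ?thesis by (simp add: N0 dN)
    qed
    have lip: "norm (N i x - N i y) \<le> 128 * M / r\<^sup>2 * \<delta> * norm (x - y)"
      if "x \<in> ball p (\<delta>/2)" "y \<in> ball p (\<delta>/2)" for i x y
    proof -
      have hb: "holomorphic_fun (ball p \<delta>) (N i)"
        by (rule holomorphic_fun_subset[OF holN]) (use sub r(2) in blast)
      have "norm (N i x - N i y) \<le> 4 * (32 * M * \<delta>\<^sup>2 / r\<^sup>2) / \<delta> * norm (x - y)"
        by (rule holomorphic_fun_lipschitz[OF hb \<delta>(1) small that])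
      then show ?thesis using \<delta>(1) by (simp add: power2_eq_square field_simps)
    qed
    have "inj_on \<psi> (ball p (\<delta>/2))"
    proof (rule inj_onI)
      fix x y assume xy: "x \<in> ball p (\<delta>/2)" "y \<in> ball p (\<delta>/2)" "\<psi> x = \<psi> y"
      have "2 * norm (x - y) \<le> 2 * (\<Sum>i\<in>UNIV. norm ((x - y) $ i))"
        using L2_set_le_sum[of UNIV "\<lambda>i. norm ((x - y) $ i)"] by (simp add: norm_vec_def)
      also have "\<dots> = (\<Sum>i\<in>UNIV. norm (N i x - N i y))"
      proof -
        have "N i x - N i y = - 2 * (x - y) $ i" for i
          using xy(3) by (simp add: N_def)
        then have "norm (N i x - N i y) = 2 * norm ((x - y) $ i)" for i
          by (simp only: norm_mult) simp
        then show ?thesis by (simp add: sum_distrib_left)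
      qed
      also have "\<dots> \<le> (\<Sum>i\<in>(UNIV::'n set). 128 * M / r\<^sup>2 * \<delta> * norm (x - y))"
        by (intro sum_mono lip xy)
      also have "\<dots> = c * \<delta> * norm (x - y)" by (simp add: c_def)
      also have "\<dots> \<le> 1 * norm (x - y)" using \<delta>(3) by (intro mult_right_mono) auto
      finally show "x = y" by simp
    qed
    moreover have "ball p (\<delta>/2) \<subseteq> ball p \<delta>"
      by (rule subset_ball) (use \<delta>(1) in simp)
    then have "ball p (\<delta>/2) \<subseteq> D" using sub r(2) by blast
    ultimately show ?thesis using \<delta>(1) by (intro exI[of _ "\<delta>/2"]) auto
  qed
  then obtain \<delta> where \<delta>: "\<delta> > 0" "ball p \<delta> \<subseteq> D" "inj_on \<psi> (ball p \<delta>)" by blast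
  have "continuous (at p) s" using der_s[OF p(1)] has_derivative_continuous by blast
  then obtain \<rho> where \<rho>: "\<rho> > 0" "\<And>z. dist z p < \<rho> \<Longrightarrow> dist (s z) p < \<delta>"
    using \<delta>(1) p(2) unfolding continuous_at_eps_delta by metis
  define m where "m = min \<rho> (min \<delta> e)"
  have m: "m > 0" using \<rho>(1) \<delta>(1) iso(1) by (simp add: m_def)
  have "\<psi> p \<in> interior (\<psi> ` ball p m)"
  proof (rule sussmann_open_mapping[OF open_D[OF D] _ p(1) \<psi>'[OF p(1)]])
    show "continuous_on D \<psi>"
      using \<psi>' by (meson continuous_at_imp_continuous_on has_derivative_continuous)
    show "bounded_linear (\<lambda>x :: complex^'n. (1/2) *\<^sub>R x)" by (rule bounded_linear_scaleR_right)
    show "(\<lambda>v. v + A *v (jacobian s p *v v)) \<circ> (\<lambda>x. (1/2) *\<^sub>R x) = id"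
      by (simp add: fun_eq_iff AA A_def[symmetric] scaleR_2[symmetric])
    show "ball p m \<subseteq> D" using \<delta>(2) by (auto simp: m_def subset_iff)
    show "p \<in> interior (ball p m)" using m by (simp add: interior_open)
  qed
  then obtain \<epsilon> where \<epsilon>: "\<epsilon> > 0" "ball (\<psi> p) \<epsilon> \<subseteq> \<psi> ` ball p m"
    unfolding mem_interior by blast
  define t where "t = \<epsilon> / (2 * norm u)"
  have t: "t > 0" "t * norm u < \<epsilon>" using \<epsilon>(1) u(1) by (auto simp: t_def)
  have "\<psi> p = 0" by (simp add: \<psi>_def p(2))
  then have "t *\<^sub>R u \<in> ball (\<psi> p) \<epsilon>" using t by simp
  then obtain z where z: "z \<in> ball p m" "\<psi> z = t *\<^sub>R u" using \<epsilon>(2) by force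
  have zD: "z \<in> ball p \<delta>" "z \<in> D" "z \<in> ball p e" "dist z p < \<rho>"
    using z(1) \<delta>(2) by (auto simp: m_def dist_commute)
  have "\<psi> (s z) = \<psi> z"
    using conj[OF zD(2)] z(2) u(2) linear_scale[OF linear_matrix_vector, of A t u] by simp
  moreover have "s z \<in> ball p \<delta>" using \<rho>(2)[OF zD(4)] by (simp add: dist_commute)
  ultimately have "s z = z" using \<delta>(3) zD(1) by (meson inj_onD)
  then have "z = p" using iso(2) zD by blast
  then show False using z(2) \<open>\<psi> p = 0\<close> t(1) u(1) by simp
qed

end

section \<open>The Bergman metric\<close>

definition log_kernel :: "(complex^'n::finite) set \<Rightarrow> complex^'n \<Rightarrow> complex" where
  "log_kernel D z = of_real (ln (Re (bergman_kernel D z z)))"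

lemma bergman_metric_entry: "bergman_metric D p $ \<alpha> $ \<beta> = wirtinger \<alpha> (wirtinger_bar \<beta> (log_kernel D)) p"
  by (simp add: bergman_metric_def metric_of_potential_def log_kernel_def[abs_def])

context
  fixes D :: "(complex^'n::finite) set"
  assumes D: "bounded_domain D"
begin

abbreviation diagonal_kernel where "diagonal_kernel \<equiv> (\<lambda>z. bergman_kernel D z z)"

lemma diagonal_kernel_wirtinger: "p \<in> D \<Longrightarrow> has_wirtinger diagonal_kernel (\<lambda>j. wirtinger j diagonal_kernel p) (\<lambda>j. wirtinger_bar j diagonal_kernel p) p"
  by (rule polarizable_differentiable[OF open_D[OF D] _ polarizable_bergman_kernel[OF D]])

lemma diagonal_kernel_bar_wirtinger: "p \<in> D \<Longrightarrow> has_wirtinger (wirtinger_bar i diagonal_kernel)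
    (\<lambda>j. wirtinger j (wirtinger_bar i diagonal_kernel) p) (\<lambda>j. wirtinger_bar j (wirtinger_bar i diagonal_kernel) p) p"
  by (intro polarizable_differentiable[OF open_D[OF D]] polarizable_wirtinger
      polarizable_bergman_kernel D open_D[OF D])

lemma diagonal_kernel_nonzero: "p \<in> D \<Longrightarrow> diagonal_kernel p \<noteq> 0"
  using bergman_kernel_positive(1)[OF D] by force

lemma diagonal_kernel_real: "p \<in> D \<Longrightarrow> diagonal_kernel p = of_real (Re (diagonal_kernel p))"
  using bergman_kernel_positive(2)[OF D] by (simp add: complex_eq_iff)

lemma log_kernel_wirtinger:
  assumes p: "p \<in> D"
  shows "has_wirtinger (log_kernel D) (\<lambda>j. wirtinger j diagonal_kernel p / diagonal_kernel p) (\<lambda>j. wirtinger_bar j diagonal_kernel p / diagonal_kernel p) p"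
proof -
  have pos: "diagonal_kernel z \<notin> \<real>\<^sub>\<le>\<^sub>0" if "z \<in> D" for z
    using bergman_kernel_positive[OF D that] by (auto simp: complex_nonpos_Reals_iff)
  have "has_wirtinger (\<lambda>z. Ln (diagonal_kernel z)) (\<lambda>j. inverse (diagonal_kernel p) * wirtinger j diagonal_kernel p)
      (\<lambda>j. inverse (diagonal_kernel p) * wirtinger_bar j diagonal_kernel p) p"
    by (rule has_wirtinger_compose_field[OF diagonal_kernel_wirtinger[OF p]])
      (rule has_field_derivative_Ln[OF pos[OF p]])
  then have "has_wirtinger (log_kernel D) (\<lambda>j. inverse (diagonal_kernel p) * wirtinger j diagonal_kernel p)
      (\<lambda>j. inverse (diagonal_kernel p) * wirtinger_bar j diagonal_kernel p) p"
  proof (rule has_wirtinger_cong[OF open_D[OF D] p, rotated])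
    fix z assume z: "z \<in> D"
    show "Ln (diagonal_kernel z) = log_kernel D z"
      unfolding log_kernel_def using bergman_kernel_positive(1)[OF D z]
      by (subst diagonal_kernel_real[OF z]) (simp add: Ln_of_real)
  qed
  then show ?thesis by (simp add: divide_inverse mult.commute)
qed

lemma log_kernel_bar: "p \<in> D \<Longrightarrow> wirtinger_bar j (log_kernel D) p = wirtinger_bar j diagonal_kernel p / diagonal_kernel p"
  using has_wirtinger_imp(2)[OF log_kernel_wirtinger] .

lemma log_kernel_bar_wirtinger:
  assumes p: "p \<in> D"
  shows "has_wirtinger (wirtinger_bar j (log_kernel D))
     (\<lambda>i. wirtinger i (wirtinger_bar j diagonal_kernel) p / diagonal_kernel p - wirtinger i diagonal_kernel p * wirtinger_bar j diagonal_kernel p / (diagonal_kernel p)\<^sup>2)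
     (\<lambda>i. wirtinger_bar i (wirtinger_bar j diagonal_kernel) p / diagonal_kernel p - wirtinger_bar i diagonal_kernel p * wirtinger_bar j diagonal_kernel p / (diagonal_kernel p)\<^sup>2) p"
proof (rule has_wirtinger_cong[OF open_D[OF D] p])
  show "wirtinger_bar j diagonal_kernel z * inverse (diagonal_kernel z) = wirtinger_bar j (log_kernel D) z" if "z \<in> D" for z
    by (simp add: log_kernel_bar[OF that] divide_inverse)
  show "has_wirtinger (\<lambda>z. wirtinger_bar j diagonal_kernel z * inverse (diagonal_kernel z))
     (\<lambda>i. wirtinger i (wirtinger_bar j diagonal_kernel) p / diagonal_kernel p - wirtinger i diagonal_kernel p * wirtinger_bar j diagonal_kernel p / (diagonal_kernel p)\<^sup>2)
     (\<lambda>i. wirtinger_bar i (wirtinger_bar j diagonal_kernel) p / diagonal_kernel p - wirtinger_bar i diagonal_kernel p * wirtinger_bar j diagonal_kernel p / (diagonal_kernel p)\<^sup>2) p"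
    using has_wirtinger_mult[OF diagonal_kernel_bar_wirtinger[OF p] has_wirtinger_inverse[OF diagonal_kernel_wirtinger[OF p] diagonal_kernel_nonzero[OF p]], of j]
    by (simp add: divide_inverse mult_ac)
qed

lemma bergman_metric_formula:
  assumes p: "p \<in> D"
  shows "bergman_metric D p $ i $ j
    = wirtinger i (wirtinger_bar j diagonal_kernel) p / diagonal_kernel p - wirtinger i diagonal_kernel p * wirtinger_bar j diagonal_kernel p / (diagonal_kernel p)\<^sup>2"
  unfolding bergman_metric_entry by (rule has_wirtinger_imp(1)[OF log_kernel_bar_wirtinger[OF p]])

lemma polarizable_diagonal_kernel_derivatives: "polarizable D (wirtinger_bar j diagonal_kernel)" "polarizable D (wirtinger j diagonal_kernel)"
  "polarizable D (wirtinger i (wirtinger_bar j diagonal_kernel))"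
  by (intro polarizable_wirtinger polarizable_bergman_kernel D open_D[OF D])+

lemma differentiable_polarizable: "polarizable D u \<Longrightarrow> p \<in> D \<Longrightarrow> u differentiable (at p)"
  using polarizable_differentiable[OF open_D[OF D]] has_wirtinger_imp_differentiable by blast

lemma bergman_metric_differentiable:
  assumes p: "p \<in> D"
  shows "(\<lambda>z. bergman_metric D z $ i $ j) differentiable (at p)"
proof -
  have kd: "diagonal_kernel differentiable (at p)"
    using differentiable_polarizable[OF polarizable_bergman_kernel[OF D] p] .
  have "(\<lambda>z. wirtinger i (wirtinger_bar j diagonal_kernel) z / diagonal_kernel z - wirtinger i diagonal_kernel z * wirtinger_bar j diagonal_kernel z / (diagonal_kernel z)\<^sup>2)
      differentiable (at p)"
    by (intro differentiable_diff differentiable_divide differentiable_mult differentiable_power kd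
        differentiable_polarizable[OF _ p] polarizable_diagonal_kernel_derivatives) (use diagonal_kernel_nonzero[OF p] in auto)
  then obtain f' where "((\<lambda>z. wirtinger i (wirtinger_bar j diagonal_kernel) z / diagonal_kernel z - wirtinger i diagonal_kernel z * wirtinger_bar j diagonal_kernel z / (diagonal_kernel z)\<^sup>2)
      has_derivative f') (at p)" by (auto simp: differentiable_def)
  then have "((\<lambda>z. bergman_metric D z $ i $ j) has_derivative f') (at p)"
    by (rule has_derivative_transform_within_open[OF _ open_D[OF D] p]) (simp add: bergman_metric_formula)
  then show ?thesis by (auto simp: differentiable_def)
qed

text \<open>Let \<open>f\<close> be in the Bergman space and \<open>\<kappa>\<close> a complex number.  The functional that takes \<open>f\<close> to its derivative at
  \<open>p\<close> along \<open>v\<close> minus \<open>\<kappa> f(p)\<close> is a limit of inner products with combinations of kernel functions at \<open>p\<close> and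
  \<open>p + \<epsilon> v\<close>.  The squared norms of these combinations converge to \<open>G\<close>, by the limits of the first and mixed second
  difference quotients of the kernel.  For \<open>\<kappa> = K\<^sub>v / K\<close>, which minimizes it, \<open>G\<close> is \<open>K(p,p)\<close> times the
  Bergman metric on \<open>v\<close>.  So a single \<open>f\<close> on which the functional does not vanish shows positivity, and the
  linear function \<open>z \<mapsto> \<langle>z - p, v\<rangle>\<close>, which lies in the Bergman space because the domain is bounded, is one.\<close>

lemma bergman_metric_form_positive:
  assumes p: "p \<in> D" and v: "v \<noteq> 0"
  shows "Im (sesquilinear_form (bergman_metric D p) v v) = 0
    \<and> Re (sesquilinear_form (bergman_metric D p) v v) > 0"
proof -
  define H where "H = polarized_kernel D"
  have H: "holomorphic_fun (doubled D) H" "\<And>z. z \<in> D \<Longrightarrow> diagonal_kernel z = H (join z (vcnj z))"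
    using polarized_kernel_holomorphic[OF D] by (auto simp: H_def polarized_kernel_def)
  have oD: "open (doubled D)" by (rule open_doubled[OF open_D[OF D]])
  have HK: "H (join x (vcnj y)) = bergman_kernel D x y" for x y by (simp add: H_def polarized_kernel_def)
  define q where "q = vcnj p"
  have pq: "join p q \<in> doubled D" using p by (simp add: q_def)
  define kv where "kv = (\<Sum>i\<in>UNIV. v $ i * wirtinger i diagonal_kernel p)"
  define kw where "kw = (\<Sum>j\<in>UNIV. cnj (v $ j) * wirtinger_bar j diagonal_kernel p)"
  define kvw where "kvw = (\<Sum>i\<in>UNIV. \<Sum>j\<in>UNIV. v $ i * cnj (v $ j) * wirtinger i (wirtinger_bar j diagonal_kernel) p)"
  have form: "sesquilinear_form (bergman_metric D p) v v = kvw / diagonal_kernel p - kv * kw / (diagonal_kernel p)\<^sup>2"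
    unfolding sesquilinear_form_def bergman_metric_formula[OF p] kvw_def kv_def kw_def sum_product
    by (simp add: sum_divide_distrib sum_subtractf[symmetric] algebra_simps)
  have w1: "wirtinger i diagonal_kernel z = wirtinger (Inl i) H (join z (vcnj z))"
    "wirtinger_bar i diagonal_kernel z = wirtinger (Inr i) H (join z (vcnj z))" if "z \<in> D" for i z
    using has_wirtinger_imp[OF has_wirtinger_polarized[OF open_D[OF D] that H]] by auto
  have w2: "wirtinger i (wirtinger_bar j diagonal_kernel) p = wirtinger (Inl i) (wirtinger (Inr j) H) (join p q)" for i j
    unfolding q_def
    by (rule has_wirtinger_imp(1)[OF has_wirtinger_polarized[OF open_D[OF D] p
            holomorphic_fun_wirtinger[OF oD H(1)]]]) (rule w1(2))
  define e where "e n = inverse (real (Suc n))" for n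
  have e: "e n > 0" "e \<longlonglongrightarrow> 0" for n
    using LIMSEQ_inverse_real_of_nat by (simp_all add: e_def[abs_def])
  define x where "x n = p + of_real (e n) *s v" for n
  have xc: "vcnj (x n) = q + of_real (e n) *s vcnj v" for n by (simp add: x_def q_def)
  have x_lim: "x \<longlonglongrightarrow> p"
  proof -
    have "(\<lambda>n. p + of_real (e n) *s v) \<longlonglongrightarrow> p + of_real 0 *s v"
      by (intro tendsto_add tendsto_const bounded_linear.tendsto[OF bounded_linear_scale_vec] tendsto_of_real e)
    then show ?thesis by (simp add: x_def[abs_def])
  qed
  have xD: "\<forall>\<^sub>F n in sequentially. x n \<in> D"
    using topological_tendstoD[OF x_lim open_D[OF D] p] .
  define \<kappa> where "\<kappa> = kv / diagonal_kernel p"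
  have filt: "filterlim (\<lambda>n. complex_of_real (e n)) (at 0) sequentially"
    using e(1) tendsto_of_real[OF e(2), where 'a = complex]
    by (auto simp: filterlim_at less_imp_neq[THEN not_sym] intro!: always_eventually)
  have slice: "(\<lambda>n. (F (\<xi> + of_real (e n) *s y) - F \<xi>) / of_real (e n)) \<longlonglongrightarrow> complex_differential F \<xi> y"
    if "holomorphic_fun S F" "\<xi> \<in> S" for S and F :: "complex^'m::finite \<Rightarrow> complex" and \<xi> y
  proof -
    have "((\<lambda>\<zeta>. F (\<xi> + \<zeta> *s y)) has_field_derivative complex_differential F (\<xi> + 0 *s y) y) (at 0)"
      by (rule slice_has_field_derivative[OF that(1)]) (use that(2) in simp)
    then have "((\<lambda>h. (F (\<xi> + h *s y) - F \<xi>) / h) \<longlongrightarrow> complex_differential F \<xi> y) (at 0)"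
      by (simp add: has_field_derivative_iff)
    then show ?thesis using filt by (rule filterlim_compose)
  qed
  have scale: "c *s join a b = join (c *s a) (c *s b)" for c and a b :: "complex^'n"
    by (auto simp: join_def vec_eq_iff split: sum.splits)
  have joint: "(\<lambda>n. (H (join (p + of_real (e n) *s a) (q + of_real (e n) *s b)) - H (join p q)) / of_real (e n))
      \<longlonglongrightarrow> complex_differential H (join p q) (join a b)" for a b
    using slice[OF H(1) pq, of "join a b"] unfolding scale join_add .
  have Hpq: "H (join p q) = diagonal_kernel p" by (simp add: q_def HK)
  have l1: "(\<lambda>n. (bergman_kernel D (x n) p - diagonal_kernel p) / of_real (e n)) \<longlonglongrightarrow> kv"
  proof -
    have "complex_differential H (join p q) (join v 0) = kv"
      by (simp add: complex_differential_def sum_UNIV_plus kv_def w1 p q_def)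
    moreover have "H (join (p + of_real (e n) *s v) (q + of_real (e n) *s 0)) = bergman_kernel D (x n) p" for n
      by (simp add: q_def HK x_def)
    ultimately show ?thesis using joint[of v 0] unfolding Hpq by simp
  qed
  have l2: "(\<lambda>n. (bergman_kernel D p (x n) - diagonal_kernel p) / of_real (e n)) \<longlonglongrightarrow> kw"
  proof -
    have "complex_differential H (join p q) (join 0 (vcnj v)) = kw"
      by (simp add: complex_differential_def sum_UNIV_plus kw_def w1 p q_def)
    moreover have "H (join (p + of_real (e n) *s 0) (q + of_real (e n) *s vcnj v)) = bergman_kernel D p (x n)" for n
      unfolding xc[symmetric] HK by simp
    ultimately show ?thesis using joint[of 0 "vcnj v"] unfolding Hpq by simp
  qed
  have l3: "(\<lambda>n. (diagonal_kernel (x n) - bergman_kernel D (x n) p - bergman_kernel D p (x n) + diagonal_kernel p)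
      / of_real (e n) / of_real (e n)) \<longlonglongrightarrow> kvw"
    using mixed_second_difference[OF oD H(1) pq e, of v "vcnj v"]
    unfolding xc[symmetric] unfolding x_def[symmetric] unfolding HK kvw_def w2 unfolding q_def HK
    by simp
  have ineq: "(cmod ((f (x n) - f p) / of_real (e n) - \<kappa> * f p))\<^sup>2 \<le> bergman_norm2 D f *
      Re ((diagonal_kernel (x n) - bergman_kernel D (x n) p - bergman_kernel D p (x n) + diagonal_kernel p) / of_real (e n) / of_real (e n)
        - cnj \<kappa> * ((bergman_kernel D (x n) p - diagonal_kernel p) / of_real (e n))
        - \<kappa> * ((bergman_kernel D p (x n) - diagonal_kernel p) / of_real (e n)) + of_real ((cmod \<kappa>)\<^sup>2) * diagonal_kernel p)"
    if f: "f \<in> bergman_space D" and xn: "x n \<in> D" for f n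
  proof -
    \<comment> \<open>conjugated coefficients, as the inner product is antilinear in its second argument\<close>
    define a b where "a = complex_of_real (inverse (e n))" and "b = - complex_of_real (inverse (e n)) - cnj \<kappa>"
    let ?kx = "\<lambda>z. bergman_kernel D z (x n)" and ?kp = "\<lambda>z. bergman_kernel D z p"
    define E where "E z = a * ?kx z + b * ?kp z" for z
    have kx: "?kx \<in> bergman_space D" "?kp \<in> bergman_space D"
      using bergman_kernel_reproducing(1)[OF D] xn p by auto
    have E: "E \<in> bergman_space D"
      unfolding E_def by (intro bergman_add bergman_cmult D kx)
    have inner: "bergman_inner D h E = cnj a * h (x n) + cnj b * h p" if "h \<in> bergman_space D" for h
      unfolding E_def[abs_def]
      using bergman_inner_add_right[OF D bergman_cmult[OF D kx(1)] bergman_cmult[OF D kx(2)] that]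
        bergman_kernel_reproducing(2)[OF D xn that] bergman_kernel_reproducing(2)[OF D p that]
      by (simp add: bergman_inner_cmult_right[OF D])
    have "bergman_inner D f E = (f (x n) - f p) / of_real (e n) - \<kappa> * f p"
      unfolding inner[OF f] a_def b_def by (simp add: divide_inverse algebra_simps)
    moreover have "complex_of_real (bergman_norm2 D E) =
        (diagonal_kernel (x n) - bergman_kernel D (x n) p - bergman_kernel D p (x n) + diagonal_kernel p) / of_real (e n) / of_real (e n)
        - cnj \<kappa> * ((bergman_kernel D (x n) p - diagonal_kernel p) / of_real (e n))
        - \<kappa> * ((bergman_kernel D p (x n) - diagonal_kernel p) / of_real (e n)) + of_real ((cmod \<kappa>)\<^sup>2) * diagonal_kernel p"
      unfolding bergman_inner_self[OF D, symmetric] inner[OF E] complex_norm_square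
      by (simp add: E_def a_def b_def divide_inverse algebra_simps)
    ultimately show ?thesis
      using bergman_cauchy_schwarz[OF D f E] by (metis Re_complex_of_real)
  qed
  have kcnj: "kw = cnj kv"
  proof (rule LIMSEQ_unique[OF l2])
    have "(\<lambda>n. cnj ((bergman_kernel D (x n) p - diagonal_kernel p) / of_real (e n))) \<longlonglongrightarrow> cnj kv"
      by (intro tendsto_cnj l1)
    moreover have "\<forall>\<^sub>F n in sequentially. cnj ((bergman_kernel D (x n) p - diagonal_kernel p) / of_real (e n))
        = (bergman_kernel D p (x n) - diagonal_kernel p) / of_real (e n)"
      using xD by eventually_elim
        (use bergman_kernel_hermitian[OF D _ p] bergman_kernel_hermitian[OF D p p] in simp)
    ultimately show "(\<lambda>n. (bergman_kernel D p (x n) - diagonal_kernel p) / of_real (e n)) \<longlonglongrightarrow> cnj kv"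
      by (rule Lim_transform_eventually)
  qed
  define G where "G = kvw - cnj \<kappa> * kv - \<kappa> * kw + of_real ((cmod \<kappa>)\<^sup>2) * diagonal_kernel p"
  have limit_ineq: "(cmod (complex_differential f p v - \<kappa> * f p))\<^sup>2 \<le> bergman_norm2 D f * Re G"
    if f: "f \<in> bergman_space D" for f
  proof (rule tendsto_le[OF sequentially_bot])
    show "(\<lambda>n. (cmod ((f (x n) - f p) / of_real (e n) - \<kappa> * f p))\<^sup>2)
        \<longlonglongrightarrow> (cmod (complex_differential f p v - \<kappa> * f p))\<^sup>2"
      unfolding x_def
      by (intro tendsto_intros slice[OF bergman_holomorphic[OF D f] p])
    show "(\<lambda>n. bergman_norm2 D f *
      Re ((diagonal_kernel (x n) - bergman_kernel D (x n) p - bergman_kernel D p (x n) + diagonal_kernel p) / of_real (e n) / of_real (e n)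
        - cnj \<kappa> * ((bergman_kernel D (x n) p - diagonal_kernel p) / of_real (e n))
        - \<kappa> * ((bergman_kernel D p (x n) - diagonal_kernel p) / of_real (e n)) + of_real ((cmod \<kappa>)\<^sup>2) * diagonal_kernel p))
      \<longlonglongrightarrow> bergman_norm2 D f * Re G"
      unfolding G_def by (intro tendsto_intros l1 l2 l3)
    show "\<forall>\<^sub>F n in sequentially. (cmod ((f (x n) - f p) / of_real (e n) - \<kappa> * f p))\<^sup>2 \<le> bergman_norm2 D f *
      Re ((diagonal_kernel (x n) - bergman_kernel D (x n) p - bergman_kernel D p (x n) + diagonal_kernel p) / of_real (e n) / of_real (e n)
        - cnj \<kappa> * ((bergman_kernel D (x n) p - diagonal_kernel p) / of_real (e n))
        - \<kappa> * ((bergman_kernel D p (x n) - diagonal_kernel p) / of_real (e n)) + of_real ((cmod \<kappa>)\<^sup>2) * diagonal_kernel p)"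
      using xD by eventually_elim (rule ineq[OF f])
  qed
  have Im3: "Im kvw = 0"
  proof -
    have 1: "(\<lambda>n. Im ((diagonal_kernel (x n) - bergman_kernel D (x n) p - bergman_kernel D p (x n) + diagonal_kernel p)
      / of_real (e n) / of_real (e n))) \<longlonglongrightarrow> Im kvw"
      by (intro tendsto_Im l3)
    have "\<forall>\<^sub>F n in sequentially. Im ((diagonal_kernel (x n) - bergman_kernel D (x n) p - bergman_kernel D p (x n) + diagonal_kernel p)
      / of_real (e n) / of_real (e n)) = 0"
      using xD
    proof eventually_elim
      case (elim n)
      show ?case
        using bergman_kernel_positive(2)[OF D elim] bergman_kernel_positive(2)[OF D p]
        by (simp add: bergman_kernel_hermitian[OF D elim p])
    qed
    from LIMSEQ_unique[OF 1 tendsto_eventually[OF this]] show ?thesis .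
  qed
  obtain r where r: "diagonal_kernel p = of_real r" "r > 0"
    using diagonal_kernel_real[OF p] bergman_kernel_positive(1)[OF D p] by blast
  have kk: "kv * cnj kv = of_real ((cmod kv)\<^sup>2)" by (simp add: complex_norm_square del: of_real_power)
  have G: "G = of_real r * sesquilinear_form (bergman_metric D p) v v"
    "sesquilinear_form (bergman_metric D p) v v = kvw / of_real r - of_real ((cmod kv)\<^sup>2 / r\<^sup>2)"
  proof -
    show 1: "sesquilinear_form (bergman_metric D p) v v = kvw / of_real r - of_real ((cmod kv)\<^sup>2 / r\<^sup>2)"
      unfolding form kcnj kk r(1) by simp
    have \<kappa>: "\<kappa> = kv / of_real r" by (simp add: \<kappa>_def r(1))
    have "cnj \<kappa> * kv = (kv * cnj kv) / of_real r" "\<kappa> * kw = (kv * cnj kv) / of_real r"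
      unfolding \<kappa> kcnj by simp_all
    then have "cnj \<kappa> * kv = of_real ((cmod kv)\<^sup>2 / r)" "\<kappa> * kw = of_real ((cmod kv)\<^sup>2 / r)"
      unfolding kk by simp_all
    moreover have "(cmod \<kappa>)\<^sup>2 = (cmod kv)\<^sup>2 / r\<^sup>2"
      unfolding \<kappa> using r(2) by (simp add: norm_divide power_divide)
    moreover have "((cmod kv)\<^sup>2 / r\<^sup>2) * r = (cmod kv)\<^sup>2 / r" using r(2) by (simp add: power2_eq_square)
    ultimately have "G = kvw - of_real ((cmod kv)\<^sup>2 / r) - of_real ((cmod kv)\<^sup>2 / r) + of_real ((cmod kv)\<^sup>2 / r)"
      unfolding G_def r(1) by (simp only: of_real_mult[symmetric])
    then show "G = of_real r * sesquilinear_form (bergman_metric D p) v v"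
      unfolding 1 using r(2) by (simp add: field_simps power2_eq_square)
  qed
  have Im0: "Im (sesquilinear_form (bergman_metric D p) v v) = 0"
    unfolding G(2) using Im3 by (simp add: Im_divide_of_real)
  have "Re G > 0"
  proof -
    define f where "f z = (\<Sum>i\<in>UNIV. cnj (v $ i) * (z $ i + - (p $ i)))" for z
    have f: "f \<in> bergman_space D"
    proof -
      have "(\<lambda>z. \<Sum>i\<in>I. cnj (v $ i) * (z $ i + - (p $ i))) \<in> bergman_space D" if "finite I" for I
        using that by induction
          (auto intro!: bergman_const[OF D] bergman_add[OF D] bergman_cmult[OF D] bergman_diff[OF D] bergman_coordinate[OF D])
      then show ?thesis by (simp add: f_def[abs_def])
    qed
    have f0: "f p = 0" by (simp add: f_def)
    have "complex_differential f p v = of_real ((norm v)\<^sup>2)"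
    proof -
      have "(f has_derivative (\<lambda>u. \<Sum>i\<in>UNIV. cnj (v $ i) * (u $ i + 0))) (at p)"
        unfolding f_def
        by (intro has_derivative_sum has_derivative_mult_right has_derivative_add has_derivative_const
            bounded_linear_imp_has_derivative bounded_linear_vec_nth)
      from has_derivative_unique[OF has_complex_differential(1)[OF bergman_holomorphic[OF D f] p] this]
      have "complex_differential f p v = (\<Sum>i\<in>UNIV. v $ i * cnj (v $ i))"
        by (simp add: mult.commute)
      also have "\<dots> = of_real ((norm v)\<^sup>2)"
        by (simp add: norm_vec_def L2_set_def sum_nonneg complex_norm_square del: of_real_power)
      finally show ?thesis .
    qed
    then have "0 < (cmod (complex_differential f p v - \<kappa> * f p))\<^sup>2"
      using v by (simp add: f0 del: of_real_power)
    also have "\<dots> \<le> bergman_norm2 D f * Re G" by (rule limit_ineq[OF f])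
    finally show ?thesis using bergman_norm2_nonneg[OF D, of f] by (simp add: zero_less_mult_iff)
  qed
  then have "r * Re (sesquilinear_form (bergman_metric D p) v v) > 0"
    unfolding G(1) by simp
  then show ?thesis using Im0 r(2) by (simp add: zero_less_mult_iff)
qed

end

section \<open>The Bergman metric of a symmetric domain is Einstein\<close>

context
  fixes D :: "(complex^'n::finite) set" and s :: "complex^'n \<Rightarrow> complex^'n"
  assumes D: "bounded_domain D" and s: "holomorphic_map D s" "s ` D \<subseteq> D"
    and inv: "\<And>z. z \<in> D \<Longrightarrow> s (s z) = z"
begin

text \<open>The logarithmic derivative of \<open>K(z,z) = J(z) K(s z, s z) cnj (J z)\<close>.\<close>

lemma log_kernel_bar_transformation:
  assumes z: "z \<in> D"
  shows "wirtinger_bar \<beta> (log_kernel D) z =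
    cnj (wirtinger \<beta> (\<lambda>z. det (jacobian s z)) z * inverse (det (jacobian s z)))
    + (\<Sum>i\<in>UNIV. wirtinger_bar i (log_kernel D) (s z) * cnj (jacobian s z $ i $ \<beta>))"
proof -
  let ?J = "\<lambda>z. det (jacobian s z)" and ?k = "\<lambda>z. bergman_kernel D z z"
  have sz: "s z \<in> D" using z s(2) by blast
  have J: "has_wirtinger ?J (\<lambda>j. wirtinger j ?J z) (\<lambda>_. 0) z"
    by (rule has_wirtinger_holomorphic[OF holomorphic_fun_det_jacobian[OF open_D[OF D] s(1)] z])
  note ks = has_wirtinger_compose_map[OF s(1) z diagonal_kernel_wirtinger[OF D sz]]
  note prod = has_wirtinger_mult[OF J has_wirtinger_mult[OF ks has_wirtinger_cnj[OF J]]]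
  have kJ: "?k x = ?J x * (?k (s x) * cnj (?J x))" if "x \<in> D" for x
    using bergman_kernel_transformation[OF D s inv that that] by (simp add: mult.assoc)
  have "wirtinger_bar \<beta> ?k z = wirtinger_bar \<beta> (\<lambda>x. ?J x * (?k (s x) * cnj (?J x))) z"
    by (rule wirtinger_cong(2)[OF open_D[OF D] z kJ])
  also have "\<dots> = ?J z * ((\<Sum>i\<in>UNIV. wirtinger_bar i ?k (s z) * cnj (jacobian s z $ i $ \<beta>)) * cnj (?J z)
      + ?k (s z) * cnj (wirtinger \<beta> ?J z))"
    unfolding has_wirtinger_imp(2)[OF prod] by simp
  finally have bar: "wirtinger_bar \<beta> ?k z = ?J z * ((\<Sum>i\<in>UNIV. wirtinger_bar i ?k (s z)
      * cnj (jacobian s z $ i $ \<beta>)) * cnj (?J z) + ?k (s z) * cnj (wirtinger \<beta> ?J z))" .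
  have nz: "?J z \<noteq> 0" "?k (s z) \<noteq> 0"
    using det_jacobian_nonzero[OF D s inv z] diagonal_kernel_nonzero[OF D sz] by auto
  have "wirtinger_bar \<beta> (log_kernel D) z =
      (\<Sum>i\<in>UNIV. wirtinger_bar i ?k (s z) * cnj (jacobian s z $ i $ \<beta>)) / ?k (s z)
      + cnj (wirtinger \<beta> ?J z) / cnj (?J z)"
    unfolding log_kernel_bar[OF D z] bar kJ[OF z] using nz by (simp add: field_simps)
  also have "(\<Sum>i\<in>UNIV. wirtinger_bar i ?k (s z) * cnj (jacobian s z $ i $ \<beta>)) / ?k (s z)
      = (\<Sum>i\<in>UNIV. wirtinger_bar i (log_kernel D) (s z) * cnj (jacobian s z $ i $ \<beta>))"
    by (simp add: log_kernel_bar[OF D sz] sum_divide_distrib)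
  finally show ?thesis by (simp add: divide_inverse)
qed

text \<open>In the formula for the antiholomorphic derivative the term with \<open>J\<close> is antiholomorphic, so it is lost in the next
  differentiation.\<close>

lemma bergman_metric_transformation:
  assumes z: "z \<in> D"
  shows "bergman_metric D z =
    transpose (jacobian s z) ** (bergman_metric D (s z) ** (\<chi> i j. cnj (jacobian s z $ i $ j)))"
proof -
  let ?J = "\<lambda>z. det (jacobian s z)"
  have sz: "s z \<in> D" using z s(2) by blast
  have holJ: "holomorphic_fun D ?J"
    by (rule holomorphic_fun_det_jacobian[OF open_D[OF D] s(1)])
  have "bergman_metric D z $ \<alpha> $ \<beta> = (\<Sum>i\<in>UNIV. (\<Sum>j\<in>UNIV. bergman_metric D (s z) $ j $ i * jacobian s z $ j $ \<alpha>)
      * cnj (jacobian s z $ i $ \<beta>))" for \<alpha> \<beta>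
  proof -
    have nz: "?J z \<noteq> 0" using det_jacobian_nonzero[OF D s inv z] .
    note h1 = has_wirtinger_mult[OF
        has_wirtinger_holomorphic[OF holomorphic_fun_wirtinger[OF open_D[OF D] holJ, of \<beta>] z]
        has_wirtinger_inverse[OF has_wirtinger_holomorphic[OF holJ z] nz]]
    note a1 = has_wirtinger_cnj[OF h1]
    have hs: "holomorphic_fun D (\<lambda>z. jacobian s z $ i $ \<beta>)" for i
      unfolding jacobian_def using s(1)
      by (simp add: holomorphic_map_def holomorphic_fun_wirtinger[OF open_D[OF D]])
    define F where "F i z = wirtinger_bar i (log_kernel D) (s z) * cnj (jacobian s z $ i $ \<beta>)" for i z
    have Fw: "has_wirtinger (F i) (\<lambda>j. wirtinger j (F i) z) (\<lambda>j. wirtinger_bar j (F i) z) z"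
      "wirtinger \<alpha> (F i) z = (\<Sum>j\<in>UNIV. bergman_metric D (s z) $ j $ i * jacobian s z $ j $ \<alpha>)
          * cnj (jacobian s z $ i $ \<beta>)" for i
    proof -
      note a2 = has_wirtinger_mult[OF
            has_wirtinger_compose_map[OF s(1) z log_kernel_bar_wirtinger[OF D sz, of i]]
            has_wirtinger_cnj[OF has_wirtinger_holomorphic[OF hs[of i] z]], folded F_def]
      show "has_wirtinger (F i) (\<lambda>j. wirtinger j (F i) z) (\<lambda>j. wirtinger_bar j (F i) z) z"
        by (rule has_wirtinger_differentiable[OF has_wirtinger_imp_differentiable[OF a2]])
      show "wirtinger \<alpha> (F i) z = (\<Sum>j\<in>UNIV. bergman_metric D (s z) $ j $ i * jacobian s z $ j $ \<alpha>)
          * cnj (jacobian s z $ i $ \<beta>)"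
        unfolding has_wirtinger_imp(1)[OF a2] bergman_metric_formula[OF D sz] by simp
    qed
    have "bergman_metric D z $ \<alpha> $ \<beta> = wirtinger \<alpha> (\<lambda>x. cnj (wirtinger \<beta> ?J x * inverse (?J x)) + (\<Sum>i\<in>UNIV. F i x)) z"
      unfolding bergman_metric_entry[of D z] F_def
      by (rule wirtinger_cong(1)[OF open_D[OF D] z log_kernel_bar_transformation])
    also have "\<dots> = (\<Sum>i\<in>UNIV. wirtinger \<alpha> (F i) z)"
      unfolding has_wirtinger_imp(1)[OF has_wirtinger_add[OF a1 has_wirtinger_sum[of UNIV, OF Fw(1)]]] by simp
    finally show ?thesis by (simp only: Fw(2))
  qed
  then show ?thesis
    by (simp add: vec_eq_iff matrix_matrix_mult_def transpose_def sum_distrib_left sum_distrib_right mult_ac)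
       (auto intro: sum.swap)
qed

lemma volume_density_invariant:
  assumes z: "z \<in> D"
  shows "det (bergman_metric D z) / bergman_kernel D z z
    = det (bergman_metric D (s z)) / bergman_kernel D (s z) (s z)"
proof -
  let ?J = "det (jacobian s z)"
  have J: "?J \<noteq> 0" using det_jacobian_nonzero[OF D s inv z] .
  have "det (bergman_metric D z) = ?J * (det (bergman_metric D (s z)) * cnj ?J)"
    by (subst bergman_metric_transformation[OF z]) (simp add: det_mul cnj_det)
  then show ?thesis
    using bergman_kernel_transformation[OF D s inv z z] J by (simp add: field_simps)
qed

end

lemma differentiable_prod:
  fixes f :: "'i \<Rightarrow> 'a::real_normed_vector \<Rightarrow> complex"
  shows "(\<And>i. i \<in> I \<Longrightarrow> f i differentiable (at p)) \<Longrightarrow> (\<lambda>z. \<Prod>i\<in>I. f i z) differentiable (at p)"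
  by (induction I rule: infinite_finite_induct) (auto intro: differentiable_mult)

lemma differentiable_det:
  fixes A :: "'a::real_normed_vector \<Rightarrow> complex^'n::finite^'n"
  assumes "\<And>i j. (\<lambda>z. A z $ i $ j) differentiable (at p)"
  shows "(\<lambda>z. det (A z)) differentiable (at p)"
  unfolding det_def
  by (intro differentiable_sum differentiable_mult differentiable_const differentiable_prod assms ballI)
    (simp_all add: finite_permutations)

text \<open>The quotient of the two sides is invariant under the symmetry at any point \<open>p\<close>, whose derivative is \<open>-1\<close> at \<open>p\<close>; so its
  derivative vanishes everywhere.\<close>

theorem bergman_metric_einstein:
  fixes D :: "(complex^'n::finite) set"
  assumes "bounded_symmetric_domain D"
  shows "\<exists>c>0. \<forall>p\<in>D. det (bergman_metric D p) = of_real c * bergman_kernel D p p"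
proof -
  have D: "bounded_domain D" using assms by (simp add: bounded_symmetric_domain_def)
  define h where "h z = det (bergman_metric D z) / bergman_kernel D z z" for z
  have "(h has_derivative (\<lambda>v. 0)) (at p)" if p: "p \<in> D" for p
  proof -
    obtain s e where s: "holomorphic_map D s" "s ` D \<subseteq> D" "\<forall>z\<in>D. s (s z) = z" "s p = p"
      and e: "e > 0" "\<forall>z\<in>D \<inter> ball p e. s z = z \<longrightarrow> z = p"
    proof -
      have "\<exists>s. holomorphic_map D s \<and> s ` D \<subseteq> D \<and> (\<forall>z\<in>D. s (s z) = z) \<and> s p = p \<and>
        (\<exists>e>0. \<forall>z\<in>D \<inter> ball p e. s z = z \<longrightarrow> z = p)"
        using assms p unfolding bounded_symmetric_domain_def by blast
      then show ?thesis using that by blast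
    qed
    have "h differentiable (at p)"
      unfolding h_def
      by (intro differentiable_divide differentiable_det bergman_metric_differentiable[OF D p]
          differentiable_polarizable[OF D polarizable_bergman_kernel[OF D] p] diagonal_kernel_nonzero[OF D p])
    then obtain h' where h': "(h has_derivative h') (at p)" by (auto simp: differentiable_def)
    have "(s has_derivative (\<lambda>v. - v)) (at p)"
      using has_derivative_jacobian[OF s(1) p]
        involution_jacobian_fixed_point[OF D s(1,2) _ p s(4) e(1)] s(3) e(2) by simp
    from diff_chain_at[OF this] h' s(4)
    have "((\<lambda>z. h (s z)) has_derivative (\<lambda>v. h' (- v))) (at p)"
      by (auto simp: o_def)
    then have "(h has_derivative (\<lambda>v. h' (- v))) (at p)"
      by (rule has_derivative_transform_within_open[OF _ open_D[OF D] p])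
        (use volume_density_invariant[OF D s(1,2)] s(3) in \<open>simp add: h_def\<close>)
    from has_derivative_unique[OF this h'] have "h' (- v) = h' v" for v by (rule fun_cong)
    moreover have "h' (- v) = - h' v" for v
      using h' by (simp add: has_derivative_linear linear_neg)
    ultimately have "h' = (\<lambda>v. 0)" by (simp add: fun_eq_iff)
    then show ?thesis using h' by simp
  qed
  note h' = this
  obtain p where p: "p \<in> D" using D_nonempty[OF D] by blast
  define c where "c = h p"
  have c: "h z = c" if "z \<in> D" for z
    unfolding c_def
    by (rule has_derivative_zero_unique_connected[OF open_D[OF D] connected_D[OF D] h' that p])
  have det: "Im (det (bergman_metric D p)) = 0 \<and> Re (det (bergman_metric D p)) > 0"
    by (rule det_pos_if_pos_form) (rule bergman_metric_form_positive[OF D p])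
  obtain r where r: "bergman_kernel D p p = of_real r" "r > 0"
    using diagonal_kernel_real[OF D p] bergman_kernel_positive(1)[OF D p] by blast
  have "c = of_real (Re (det (bergman_metric D p)) / r)"
    using c[OF p] det by (simp add: h_def r(1) complex_eq_iff Im_divide_of_real Re_divide_of_real)
  moreover have "Re (det (bergman_metric D p)) / r > 0" using det r(2) by simp
  moreover have "det (bergman_metric D z) = c * bergman_kernel D z z" if "z \<in> D" for z
    using c[OF that] diagonal_kernel_nonzero[OF D that] by (simp add: h_def field_simps)
  ultimately show ?thesis by blast
qed

section \<open>Cartan--Hartogs domains\<close>

lemma genus_positive: "genus D > 0"
  by (simp add: genus_def Let_def)

lemma matrix_inv_eq:
  fixes A B :: "'a::field^'n::finite^'n"
  assumes "B ** A = mat 1"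
  shows "matrix_inv A = B"
proof -
  have "A ** B = mat 1" using assms matrix_left_right_inverse by blast
  have "A ** matrix_inv A = mat 1 \<and> matrix_inv A ** A = mat 1"
    unfolding matrix_inv_def using \<open>A ** B = mat 1\<close> assms by (rule_tac someI_ex) blast
  then show ?thesis
    using assms by (metis matrix_mul_assoc matrix_mul_lid matrix_mul_rid)
qed

definition lift_index :: "('d \<Rightarrow> complex) \<Rightarrow> complex \<Rightarrow> 'd option \<Rightarrow> complex" where
  "lift_index a c \<alpha> = (case \<alpha> of None \<Rightarrow> c | Some i \<Rightarrow> a i)"

lemma lift_index_simps [simp]: "lift_index a c None = c" "lift_index a c (Some i) = a i"
  by (simp_all add: lift_index_def)

lemma bounded_linear_base_part: "bounded_linear (base_part :: complex^('d::finite option) \<Rightarrow> complex^'d)"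
proof (rule bounded_linear_intro[of _ 1])
  fix x :: "complex^('d option)"
  have "(norm x)\<^sup>2 = (cmod (x $ None))\<^sup>2 + (norm (base_part x))\<^sup>2"
    by (simp add: norm_vec_def L2_set_def sum_nonneg sum_UNIV_option base_part_def)
  then show "norm (base_part x) \<le> norm x * 1" by (simp add: power2_le_imp_le)
qed (simp_all add: base_part_def vec_eq_iff)

lemma has_wirtinger_base_part:
  assumes "has_wirtinger u a b (base_part p)"
  shows "has_wirtinger (\<lambda>p. u (base_part p)) (lift_index a 0) (lift_index b 0) p"
  using diff_chain_at[OF bounded_linear_imp_has_derivative[OF bounded_linear_base_part]
      assms[unfolded has_wirtinger_def]]
  by (simp add: has_wirtinger_def o_def sum_UNIV_option) (simp add: base_part_def)

lemma has_wirtinger_fibre_part: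
  "has_wirtinger fibre_part (lift_index (\<lambda>_. 0) 1) (lift_index (\<lambda>_. 0) 0) p"
proof -
  have "(fibre_part has_derivative fibre_part) (at p)"
    unfolding fibre_part_def by (intro bounded_linear_imp_has_derivative bounded_linear_vec_nth)
  then show ?thesis by (simp add: has_wirtinger_def sum_UNIV_option fibre_part_def[abs_def])
qed

lemma has_wirtinger_eqI:
  "has_wirtinger f a b p \<Longrightarrow> (\<And>j. a j = a' j) \<Longrightarrow> (\<And>j. b j = b' j) \<Longrightarrow> has_wirtinger f a' b' p"
  by (simp add: has_wirtinger_def)

text \<open>If \<open>a\<close> and \<open>b\<close> have entry 1 at \<open>None\<close>, the outer factors have determinant 1, and the rank-one term
  \<open>c a b\<^sup>T\<close> enters the determinant through the corner entry \<open>c\<close> alone.\<close>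

lemma rank_one_update_factorization:
  "(replace_column None a ** option_block A c ** transpose (replace_column None b)) $ \<alpha> $ \<beta>
    = option_block A 0 $ \<alpha> $ \<beta> + c * a $ \<alpha> * b $ \<beta>"
proof -
  have rc: "replace_column None x $ \<gamma> $ None = x $ \<gamma>"
    "replace_column None x $ \<gamma> $ Some k = (if \<gamma> = Some k then 1 else 0)" for x \<gamma> k
    by (simp_all add: replace_column_def mat_def)
  let ?N = "replace_column None a ** option_block A c"
  have N: "?N $ \<alpha> $ None = a $ \<alpha> * c"
    "?N $ \<alpha> $ Some j = (case \<alpha> of None \<Rightarrow> 0 | Some i \<Rightarrow> A $ i $ j)" for j
    by (simp add: matrix_matrix_mult_def sum_UNIV_option rc option_block_def)
      (cases \<alpha>; simp add: matrix_matrix_mult_def sum_UNIV_option rc option_block_def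
        if_distrib[of "\<lambda>x. x * _"] cong: if_cong)
  have "(?N ** transpose (replace_column None b)) $ \<alpha> $ \<beta> =
      ?N $ \<alpha> $ None * b $ \<beta> + (\<Sum>k\<in>UNIV. ?N $ \<alpha> $ Some k * (if \<beta> = Some k then 1 else 0))"
    unfolding matrix_matrix_mult_def[of ?N]
    by (simp add: sum_UNIV_option transpose_def rc)
  also have "\<dots> = ?N $ \<alpha> $ None * b $ \<beta> + (case \<beta> of None \<Rightarrow> 0 | Some k \<Rightarrow> ?N $ \<alpha> $ Some k)"
    by (cases \<beta>) (simp_all add: if_distrib cong: if_cong)
  also have "\<dots> = option_block A 0 $ \<alpha> $ \<beta> + c * a $ \<alpha> * b $ \<beta>"
    unfolding N by (cases \<alpha>; cases \<beta>) (simp_all add: option_block_def mult_ac)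
  finally show ?thesis .
qed

context
  fixes \<Omega> :: "(complex^'d::finite) set" and \<mu> :: real
  assumes sym: "bounded_symmetric_domain \<Omega>" and \<mu>: "\<mu> > 0"
begin

lemma base_bounded_domain: "bounded_domain \<Omega>"
  using sym by (simp add: bounded_symmetric_domain_def)

definition exponent :: real where "exponent = \<mu> / real (genus \<Omega>)"

lemma exponent_pos: "exponent > 0"
  using \<mu> genus_positive[of \<Omega>] by (simp add: exponent_def)

text \<open>The potential \<open>\<phi> = - log N\<^sup>\<mu>\<close> on the base, see \<open>generic_norm_powr\<close>; it is complex-valued so that Wirtinger
  derivatives apply.\<close>

definition pot :: "complex^'d \<Rightarrow> complex" where
  "pot z = of_real exponent * (of_real (ln (measure lborel \<Omega>)) + log_kernel \<Omega> z)"

definition pot1 :: "'d \<Rightarrow> complex^'d \<Rightarrow> complex" where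
  "pot1 i z = of_real exponent * wirtinger i (log_kernel \<Omega>) z"

definition pot1_bar :: "'d \<Rightarrow> complex^'d \<Rightarrow> complex" where
  "pot1_bar j z = of_real exponent * wirtinger_bar j (log_kernel \<Omega>) z"

definition pot2 :: "complex^'d \<Rightarrow> complex^'d^'d" where
  "pot2 z = (\<chi> i j. of_real exponent * bergman_metric \<Omega> z $ i $ j)"

lemma volume_pos: "measure lborel \<Omega> > 0"
proof -
  obtain p r where "r > 0" "ball p r \<subseteq> \<Omega>"
    using open_D[OF base_bounded_domain] D_nonempty[OF base_bounded_domain] open_contains_ball by blast
  moreover have "\<Omega> \<in> fmeasurable lborel"
    using open_D[OF base_bounded_domain] emeasure_bounded_finite[OF bounded_D[OF base_bounded_domain]] by (intro fmeasurableI) auto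
  ultimately have "measure lborel (ball p r) \<le> measure lborel \<Omega>"
    by (intro measure_mono_fmeasurable) auto
  then show ?thesis using content_ball_pos[OF \<open>r > 0\<close>, of p] by linarith
qed

lemma pot_wirtinger:
  assumes z: "z \<in> \<Omega>"
  shows "has_wirtinger pot (\<lambda>i. pot1 i z) (\<lambda>j. pot1_bar j z) z"
proof -
  note l = has_wirtinger_differentiable[OF has_wirtinger_imp_differentiable[OF log_kernel_wirtinger[OF base_bounded_domain z]]]
  show ?thesis
    unfolding pot_def pot1_def pot1_bar_def
    using has_wirtinger_cmult[OF has_wirtinger_add[OF has_wirtinger_const l]] by fastforce
qed

lemma pot1_bar_wirtinger:
  assumes z: "z \<in> \<Omega>"
  obtains b where "has_wirtinger (pot1_bar j) (\<lambda>i. pot2 z $ i $ j) b z"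
proof -
  note l = has_wirtinger_cmult[OF has_wirtinger_differentiable[OF has_wirtinger_imp_differentiable[OF
          log_kernel_bar_wirtinger[OF base_bounded_domain z]]], of "of_real exponent" j]
  have "has_wirtinger (pot1_bar j) (\<lambda>i. pot2 z $ i $ j)
      (\<lambda>i. of_real exponent * wirtinger_bar i (wirtinger_bar j (log_kernel \<Omega>)) z) z"
    using l by (simp add: pot1_bar_def[abs_def] pot2_def bergman_metric_entry)
  then show ?thesis by (rule that)
qed

lemma pot_real: "pot z = of_real (exponent * (ln (measure lborel \<Omega>) + ln (Re (bergman_kernel \<Omega> z z))))"
  by (simp add: pot_def log_kernel_def)

lemma generic_norm_powr:
  assumes z: "z \<in> \<Omega>"
  shows "of_real (generic_norm \<Omega> z powr \<mu>) = exp (- pot z)"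
proof -
  have k: "Re (bergman_kernel \<Omega> z z) > 0" using bergman_kernel_positive(1)[OF base_bounded_domain z] .
  have "generic_norm \<Omega> z powr \<mu> = (measure lborel \<Omega> * Re (bergman_kernel \<Omega> z z)) powr (- exponent)"
    by (simp add: generic_norm_def powr_powr exponent_def)
  also have "\<dots> = exp (- exponent * (ln (measure lborel \<Omega>) + ln (Re (bergman_kernel \<Omega> z z))))"
    using k volume_pos by (simp add: powr_def ln_mult)
  finally show ?thesis by (simp add: pot_real exp_of_real flip: of_real_minus of_real_mult of_real_add)
qed

text \<open>The function \<open>N\<^sup>\<mu>\<close>, as the exponential of \<open>-\<phi>\<close>.\<close>

definition fibre_radius2 :: "complex^('d option) \<Rightarrow> complex" where
  "fibre_radius2 p = exp (- pot (base_part p))"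

definition fibre_gap :: "complex^('d option) \<Rightarrow> complex" where
  "fibre_gap p = fibre_radius2 p - fibre_part p * cnj (fibre_part p)"

abbreviation "CH \<equiv> cartan_hartogs \<Omega> \<mu>"
abbreviation "gCH \<equiv> cartan_hartogs_metric \<Omega> \<mu>"

lemma fibre_radius2_real: "base_part p \<in> \<Omega> \<Longrightarrow> fibre_radius2 p = of_real (generic_norm \<Omega> (base_part p) powr \<mu>)"
  by (simp add: fibre_radius2_def generic_norm_powr)

lemma fibre_gap_real: "base_part p \<in> \<Omega> \<Longrightarrow>
    fibre_gap p = of_real (generic_norm \<Omega> (base_part p) powr \<mu> - (cmod (fibre_part p))\<^sup>2)"
  by (simp add: fibre_gap_def fibre_radius2_real complex_norm_square del: of_real_power)

lemma CH_iff: "p \<in> CH \<longleftrightarrow> base_part p \<in> \<Omega> \<and> Re (fibre_gap p) > 0"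
  by (auto simp: cartan_hartogs_def fibre_gap_real)

lemma CH_real_values:
  assumes "p \<in> CH"
  obtains e r where "fibre_radius2 p = of_real e" "fibre_gap p = of_real r" "e > 0" "r > 0"
proof -
  have "base_part p \<in> \<Omega>" "Re (fibre_gap p) > 0" using assms by (auto simp: CH_iff)
  moreover have "fibre_radius2 p = of_real (exp (- Re (pot (base_part p))))"
    by (simp only: fibre_radius2_def pot_real Re_complex_of_real of_real_minus[symmetric] exp_of_real)
  ultimately show ?thesis
    using that[of "exp (- Re (pot (base_part p)))" "Re (fibre_gap p)"] fibre_gap_real by (metis Re_complex_of_real exp_gt_zero)
qed

lemma fibre_radius2_nonzero: "fibre_radius2 p \<noteq> 0"
  by (simp add: fibre_radius2_def)

lemma fibre_gap_nonzero: "p \<in> CH \<Longrightarrow> fibre_gap p \<noteq> 0"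
  by (auto simp: CH_iff)

abbreviation "pot_grad p \<equiv> (\<lambda>i. pot1 i (base_part p))"
abbreviation "pot_grad_bar p \<equiv> (\<lambda>j. pot1_bar j (base_part p))"

lemma pot_lift: "base_part p \<in> \<Omega> \<Longrightarrow>
    has_wirtinger (\<lambda>p. pot (base_part p)) (lift_index (pot_grad p) 0) (lift_index (pot_grad_bar p) 0) p"
  by (rule has_wirtinger_base_part[OF pot_wirtinger])

lemma fibre_radius2_wirtinger:
  assumes "base_part p \<in> \<Omega>"
  shows "has_wirtinger fibre_radius2 (lift_index (\<lambda>i. - fibre_radius2 p * pot_grad p i) 0) (lift_index (\<lambda>j. - fibre_radius2 p * pot_grad_bar p j) 0) p"
proof -
  have "((\<lambda>x. exp (- x)) has_field_derivative - exp (- x)) (at x)" for x :: complex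
    by (auto intro!: derivative_eq_intros)
  from has_wirtinger_compose_field[OF pot_lift[OF assms] this]
  show ?thesis
    unfolding fibre_radius2_def by (rule has_wirtinger_eqI) (auto simp: lift_index_def split: option.splits)
qed

lemma fibre_gap_wirtinger:
  assumes "base_part p \<in> \<Omega>"
  shows "has_wirtinger fibre_gap (lift_index (\<lambda>i. - fibre_radius2 p * pot_grad p i) (- cnj (fibre_part p)))
     (lift_index (\<lambda>j. - fibre_radius2 p * pot_grad_bar p j) (- fibre_part p)) p"
  unfolding fibre_gap_def
  by (rule has_wirtinger_eqI[OF has_wirtinger_diff[OF fibre_radius2_wirtinger[OF assms]
      has_wirtinger_mult[OF has_wirtinger_fibre_part has_wirtinger_cnj[OF has_wirtinger_fibre_part]]]])
    (auto simp: lift_index_def split: option.splits)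

lemma open_base: "open {p. base_part p \<in> \<Omega>}"
  using open_vimage[OF open_D[OF base_bounded_domain] linear_continuous_on[OF bounded_linear_base_part]]
  by (simp add: vimage_def)

lemma open_CH: "open CH"
proof -
  have "continuous_on {p. base_part p \<in> \<Omega>} fibre_gap"
    using fibre_gap_wirtinger unfolding has_wirtinger_def
    by (intro continuous_at_imp_continuous_on ballI) (blast dest: has_derivative_continuous)
  then have "open ({p. base_part p \<in> \<Omega>} \<inter> fibre_gap -` {c. Re c > 0})"
    by (intro continuous_open_preimage open_base open_halfspace_Re_gt)
  moreover have "{p. base_part p \<in> \<Omega>} \<inter> fibre_gap -` {c. Re c > 0} = CH" by (auto simp: CH_iff)
  ultimately show ?thesis by simp
qed

definition Phi :: "complex^('d option) \<Rightarrow> complex" where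
  "Phi p = of_real (- ln (generic_norm \<Omega> (base_part p) powr \<mu> - (cmod (fibre_part p))\<^sup>2))"

lemma gCH_entry: "gCH p $ \<alpha> $ \<beta> = wirtinger \<alpha> (wirtinger_bar \<beta> Phi) p"
  by (simp add: cartan_hartogs_metric_def metric_of_potential_def Phi_def[abs_def])

lemma Phi_Ln:
  assumes "p \<in> CH"
  shows "Phi p = - Ln (fibre_gap p)"
proof -
  have "fibre_gap p = of_real (generic_norm \<Omega> (base_part p) powr \<mu> - (cmod (fibre_part p))\<^sup>2)"
    "generic_norm \<Omega> (base_part p) powr \<mu> - (cmod (fibre_part p))\<^sup>2 > 0"
    using assms by (auto simp: CH_iff fibre_gap_real)
  then show ?thesis by (simp only: Phi_def) (simp add: Ln_of_real flip: of_real_diff del: of_real_diff)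
qed

lemma Phi_wirtinger:
  assumes p: "p \<in> CH"
  shows "has_wirtinger Phi (lift_index (\<lambda>i. fibre_radius2 p * pot_grad p i / fibre_gap p) (cnj (fibre_part p) / fibre_gap p))
     (lift_index (\<lambda>j. fibre_radius2 p * pot_grad_bar p j / fibre_gap p) (fibre_part p / fibre_gap p)) p"
proof (rule has_wirtinger_cong[OF open_CH p])
  show "- Ln (fibre_gap q) = Phi q" if "q \<in> CH" for q using Phi_Ln[OF that] by simp
  have base: "base_part p \<in> \<Omega>" using p by (simp add: CH_iff)
  have "fibre_gap p \<notin> \<real>\<^sub>\<le>\<^sub>0" using p by (auto simp: CH_iff complex_nonpos_Reals_iff)
  then have "((\<lambda>x. - Ln x) has_field_derivative - inverse (fibre_gap p)) (at (fibre_gap p))"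
    by (auto intro!: derivative_eq_intros)
  from has_wirtinger_compose_field[OF fibre_gap_wirtinger[OF base] this]
  show "has_wirtinger (\<lambda>q. - Ln (fibre_gap q)) (lift_index (\<lambda>i. fibre_radius2 p * pot_grad p i / fibre_gap p) (cnj (fibre_part p) / fibre_gap p))
     (lift_index (\<lambda>j. fibre_radius2 p * pot_grad_bar p j / fibre_gap p) (fibre_part p / fibre_gap p)) p"
    by (rule has_wirtinger_eqI) (auto simp: lift_index_def divide_inverse split: option.splits)
qed

lemma Phi_bar:
  assumes "p \<in> CH"
  shows "wirtinger_bar (Some j) Phi p = fibre_radius2 p * pot1_bar j (base_part p) * inverse (fibre_gap p)"
    and "wirtinger_bar None Phi p = fibre_part p * inverse (fibre_gap p)"
  using has_wirtinger_imp(2)[OF Phi_wirtinger[OF assms]] by (simp_all add: divide_inverse)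

definition avec :: "complex^('d option) \<Rightarrow> complex^('d option)" where
  "avec p = (\<chi> \<alpha>. lift_index (\<lambda>i. pot_grad p i * fibre_part p) 1 \<alpha>)"

definition bvec :: "complex^('d option) \<Rightarrow> complex^('d option)" where
  "bvec p = (\<chi> \<beta>. lift_index (\<lambda>j. pot_grad_bar p j * cnj (fibre_part p)) 1 \<beta>)"

lemma Phi_bar_wirtinger:
  assumes p: "p \<in> CH"
  shows "has_wirtinger (wirtinger_bar \<beta> Phi) (\<lambda>\<alpha>. wirtinger \<alpha> (wirtinger_bar \<beta> Phi) p)
      (\<lambda>\<alpha>. wirtinger_bar \<alpha> (wirtinger_bar \<beta> Phi) p) p"
    and "wirtinger \<alpha> (wirtinger_bar \<beta> Phi) p = fibre_radius2 p / fibre_gap p * option_block (pot2 (base_part p)) 0 $ \<alpha> $ \<beta>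
      + fibre_radius2 p / (fibre_gap p)\<^sup>2 * avec p $ \<alpha> * bvec p $ \<beta>"
proof -
  have base: "base_part p \<in> \<Omega>" using p by (simp add: CH_iff)
  have EP: "fibre_radius2 p = fibre_gap p + fibre_part p * cnj (fibre_part p)" by (simp add: fibre_gap_def)
  note invP = has_wirtinger_inverse[OF fibre_gap_wirtinger[OF base] fibre_gap_nonzero[OF p]]
  have "(wirtinger_bar \<beta> Phi) differentiable (at p) \<and>
    wirtinger \<alpha> (wirtinger_bar \<beta> Phi) p = fibre_radius2 p / fibre_gap p * option_block (pot2 (base_part p)) 0 $ \<alpha> $ \<beta>
      + fibre_radius2 p / (fibre_gap p)\<^sup>2 * avec p $ \<alpha> * bvec p $ \<beta>"
  proof (cases \<beta>)
    case None
    note m = has_wirtinger_mult[OF has_wirtinger_fibre_part invP]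
    have eq: "wirtinger \<alpha> (wirtinger_bar None Phi) p = wirtinger \<alpha> (\<lambda>q. fibre_part q * inverse (fibre_gap q)) p"
      by (rule wirtinger_cong(1)[OF open_CH p Phi_bar(2)])
    have "wirtinger_bar None Phi differentiable (at p)"
      by (rule has_wirtinger_imp_differentiable[OF has_wirtinger_cong[OF open_CH p Phi_bar(2)[symmetric] m]])
    moreover have "wirtinger \<alpha> (wirtinger_bar None Phi) p = fibre_radius2 p / fibre_gap p * option_block (pot2 (base_part p)) 0 $ \<alpha> $ None
      + fibre_radius2 p / (fibre_gap p)\<^sup>2 * avec p $ \<alpha> * bvec p $ None"
      unfolding eq has_wirtinger_imp(1)[OF m] using fibre_gap_nonzero[OF p]
      by (cases \<alpha>) (simp_all add: avec_def bvec_def option_block_def EP field_simps power2_eq_square)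
    ultimately show ?thesis unfolding None by blast
  next
    case (Some j)
    obtain b where b: "has_wirtinger (pot1_bar j) (\<lambda>i. pot2 (base_part p) $ i $ j) b (base_part p)"
      using pot1_bar_wirtinger[OF base] by blast
    note m = has_wirtinger_mult[OF has_wirtinger_mult[OF fibre_radius2_wirtinger[OF base] has_wirtinger_base_part[OF b]] invP]
    have *: "(- (e * a) * b + e * g) * inverse q + e * b * (- (- (e * a)) / q\<^sup>2)
        = e / q * g + e / q\<^sup>2 * (a * w) * (b * w')"
      if "e = q + w * w'" "q \<noteq> 0" for e a b g q w w' :: complex
      using that by (simp add: field_simps power2_eq_square)
    have eq: "wirtinger \<alpha> (wirtinger_bar (Some j) Phi) p
        = wirtinger \<alpha> (\<lambda>q. fibre_radius2 q * pot1_bar j (base_part q) * inverse (fibre_gap q)) p"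
      by (rule wirtinger_cong(1)[OF open_CH p Phi_bar(1)])
    have "wirtinger_bar (Some j) Phi differentiable (at p)"
      by (rule has_wirtinger_imp_differentiable[OF has_wirtinger_cong[OF open_CH p Phi_bar(1)[symmetric] m]])
    moreover have "wirtinger \<alpha> (wirtinger_bar (Some j) Phi) p
      = fibre_radius2 p / fibre_gap p * option_block (pot2 (base_part p)) 0 $ \<alpha> $ Some j
        + fibre_radius2 p / (fibre_gap p)\<^sup>2 * avec p $ \<alpha> * bvec p $ Some j"
    proof (cases \<alpha>)
      case None
      show ?thesis
        unfolding eq has_wirtinger_imp(1)[OF m]
        by (simp add: None avec_def bvec_def option_block_def divide_inverse mult_ac)
    next
      case (Some i)
      show ?thesis
        unfolding eq has_wirtinger_imp(1)[OF m]
        using *[OF EP fibre_gap_nonzero[OF p], of "pot_grad p i" "pot1_bar j (base_part p)" "pot2 (base_part p) $ i $ j"]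
        by (simp add: Some avec_def bvec_def option_block_def)
    qed
    ultimately show ?thesis unfolding Some by blast
  qed
  then show "has_wirtinger (wirtinger_bar \<beta> Phi) (\<lambda>\<alpha>. wirtinger \<alpha> (wirtinger_bar \<beta> Phi) p)
      (\<lambda>\<alpha>. wirtinger_bar \<alpha> (wirtinger_bar \<beta> Phi) p) p"
    "wirtinger \<alpha> (wirtinger_bar \<beta> Phi) p = fibre_radius2 p / fibre_gap p * option_block (pot2 (base_part p)) 0 $ \<alpha> $ \<beta>
      + fibre_radius2 p / (fibre_gap p)\<^sup>2 * avec p $ \<alpha> * bvec p $ \<beta>"
    by (simp_all add: has_wirtinger_differentiable)
qed

text \<open>The vectors \<open>avec\<close> and \<open>bvec\<close> arise because \<open>-log P = \<phi> - log (1 - |w|\<^sup>2 e\<^sup>\<phi>)\<close> depends on \<open>w\<close> only through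
  \<open>log |w|\<^sup>2 + \<phi>\<close>: up to the factors \<open>w\<close> and its conjugate they are the differentials of that function.\<close>

lemma gCH_formula:
  assumes "p \<in> CH"
  shows "gCH p $ \<alpha> $ \<beta> = fibre_radius2 p / fibre_gap p * option_block (pot2 (base_part p)) 0 $ \<alpha> $ \<beta>
    + fibre_radius2 p / (fibre_gap p)\<^sup>2 * avec p $ \<alpha> * bvec p $ \<beta>"
  unfolding gCH_entry by (rule Phi_bar_wirtinger(2)[OF assms])

definition einstein_constant :: real where
  "einstein_constant = (SOME c. c > 0 \<and> (\<forall>z\<in>\<Omega>. det (bergman_metric \<Omega> z) = of_real c * bergman_kernel \<Omega> z z))"

lemma einstein_constant: "einstein_constant > 0"
  "z \<in> \<Omega> \<Longrightarrow> det (bergman_metric \<Omega> z) = of_real einstein_constant * bergman_kernel \<Omega> z z"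
proof -
  have "einstein_constant > 0 \<and>
      (\<forall>z\<in>\<Omega>. det (bergman_metric \<Omega> z) = of_real einstein_constant * bergman_kernel \<Omega> z z)"
    unfolding einstein_constant_def by (rule someI_ex) (rule bergman_metric_einstein[OF sym])
  then show "einstein_constant > 0"
    "z \<in> \<Omega> \<Longrightarrow> det (bergman_metric \<Omega> z) = of_real einstein_constant * bergman_kernel \<Omega> z z"
    by blast+
qed

lemma det_scaled: "det (\<chi> i j. c * A $ i $ j) = c ^ CARD('n) * det A" for A :: "complex^'n::finite^'n"
proof -
  have "det (\<chi> i. c *s A $ i) = (\<Prod>i\<in>(UNIV::'n set). c) * det (\<chi> i. A $ i)"
    by (rule det_rows_mul)
  moreover have "(\<chi> i. c *s A $ i) = (\<chi> i j. c * A $ i $ j)" by (simp add: vec_eq_iff)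
  ultimately show ?thesis by simp
qed

lemma det_pot2:
  assumes "z \<in> \<Omega>"
  shows "det (pot2 z) = of_real (exponent ^ CARD('d) * einstein_constant) * bergman_kernel \<Omega> z z"
  unfolding pot2_def det_scaled einstein_constant(2)[OF assms] by simp

lemma pot2_invertible: "z \<in> \<Omega> \<Longrightarrow> invertible (pot2 z)"
  using det_pot2 diagonal_kernel_nonzero[OF base_bounded_domain] exponent_pos einstein_constant(1) by (simp add: invertible_det_nz)

lemma gCH_factorization:
  assumes p: "p \<in> CH"
  shows "gCH p = replace_column None (avec p)
    ** option_block (\<chi> i j. fibre_radius2 p / fibre_gap p * pot2 (base_part p) $ i $ j) (fibre_radius2 p / (fibre_gap p)\<^sup>2)
    ** transpose (replace_column None (bvec p))"
proof -
  have "gCH p $ \<alpha> $ \<beta> = (replace_column None (avec p)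
    ** option_block (\<chi> i j. fibre_radius2 p / fibre_gap p * pot2 (base_part p) $ i $ j) (fibre_radius2 p / (fibre_gap p)\<^sup>2)
    ** transpose (replace_column None (bvec p))) $ \<alpha> $ \<beta>" for \<alpha> \<beta>
    unfolding gCH_formula[OF p] rank_one_update_factorization
    by (simp add: option_block_def split: option.splits)
  then show ?thesis by (simp add: vec_eq_iff)
qed

lemma det_gCH:
  assumes p: "p \<in> CH"
  shows "det (gCH p) = (fibre_radius2 p / fibre_gap p) ^ CARD('d) * (fibre_radius2 p / (fibre_gap p)\<^sup>2)
     * (of_real (exponent ^ CARD('d) * einstein_constant) * bergman_kernel \<Omega> (base_part p) (base_part p))"
proof -
  have base: "base_part p \<in> \<Omega>" using p by (simp add: CH_iff)
  have inv: "invertible (\<chi> i j. fibre_radius2 p / fibre_gap p * pot2 (base_part p) $ i $ j)"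
    using pot2_invertible[OF base] fibre_radius2_nonzero fibre_gap_nonzero[OF p]
    unfolding invertible_det_nz det_scaled by simp
  show ?thesis
    unfolding gCH_factorization[OF p] det_mul det_transpose det_replace_column det_option_block[OF inv]
      det_scaled det_pot2[OF base]
    by (simp add: avec_def bvec_def)
qed

text \<open>The constant \<open>c = d + 1 - \<gamma>/\<mu>\<close> in the Ricci tensor.\<close>

definition einstein_defect :: real where "einstein_defect = real CARD('d) + 1 - 1 / exponent"

text \<open>As the Bergman metric is Einstein, \<open>det (\<partial>\<partial>-bar \<phi>)\<close> is a constant multiple of \<open>exp (\<gamma>/\<mu> \<phi>)\<close>; all other factors of
  \<open>det g\<close> are powers of \<open>N\<^sup>\<mu> = exp (- \<phi>)\<close> and of \<open>P\<close>.\<close>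

lemma ln_det_gCH:
  "\<exists>c. \<forall>p\<in>CH. ln (det (gCH p)) = c - of_real einstein_defect * pot (base_part p) + of_real (real CARD('d) + 2) * Phi p"
proof -
  define c where "c = real CARD('d) * ln exponent + ln einstein_constant - ln (measure lborel \<Omega>)"
  have "ln (det (gCH p)) = of_real c - of_real einstein_defect * pot (base_part p) + of_real (real CARD('d) + 2) * Phi p"
    if p: "p \<in> CH" for p
  proof -
    have base: "base_part p \<in> \<Omega>" using p by (simp add: CH_iff)
    obtain e r where er: "fibre_radius2 p = of_real e" "fibre_gap p = of_real r" "e > 0" "r > 0" using CH_real_values[OF p] .
    define kr where "kr = Re (bergman_kernel \<Omega> (base_part p) (base_part p))"
    have k: "bergman_kernel \<Omega> (base_part p) (base_part p) = of_real kr" "kr > 0"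
      using diagonal_kernel_real[OF base_bounded_domain base] bergman_kernel_positive(1)[OF base_bounded_domain base] by (simp_all add: kr_def)
    define x where "x = ln (measure lborel \<Omega>) + ln kr"
    have potx: "pot (base_part p) = of_real (exponent * x)" by (simp add: pot_real x_def kr_def)
    have lne: "ln e = - (exponent * x)"
    proof -
      have "of_real e = exp (- complex_of_real (exponent * x))" using er(1) by (simp add: fibre_radius2_def potx)
      then have "e = exp (- (exponent * x))" by (metis exp_of_real of_real_eq_iff of_real_minus)
      then show ?thesis by simp
    qed
    have Phir: "Phi p = of_real (- ln r)"
      unfolding Phi_Ln[OF p] er(2) using er(4) by (simp add: Ln_of_real)
    let ?d = "(e / r) ^ CARD('d) * (e / r\<^sup>2) * (exponent ^ CARD('d) * einstein_constant * kr)"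
    have pos: "?d > 0" using er(3,4) k(2) exponent_pos einstein_constant(1) by simp
    have "det (gCH p) = of_real ?d" unfolding det_gCH[OF p] er(1,2) k(1) by simp
    then have "ln (det (gCH p)) = of_real (ln ?d)" using pos by (simp only: Ln_of_real)
    also have "ln ?d = real CARD('d) * (ln e - ln r) + (ln e - 2 * ln r)
        + (real CARD('d) * ln exponent + ln einstein_constant + ln kr)"
      using er(3,4) k(2) exponent_pos einstein_constant(1)
      by (simp add: ln_mult ln_div ln_realpow)
    also have "\<dots> = c - einstein_defect * (exponent * x) + (real CARD('d) + 2) * (- ln r)"
    proof -
      have "einstein_defect * (exponent * x) = (real CARD('d) + 1) * (exponent * x) - x"
        using exponent_pos by (simp add: einstein_defect_def field_simps)
      moreover have "ln kr = x - ln (measure lborel \<Omega>)" by (simp add: x_def)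
      ultimately show ?thesis unfolding lne c_def by (simp add: algebra_simps)
    qed
    finally show ?thesis unfolding potx Phir by simp
  qed
  then show ?thesis by blast
qed

lemma ricci_gCH:
  assumes p: "p \<in> CH"
  shows "ricci gCH p $ \<alpha> $ \<beta> = of_real einstein_defect * option_block (pot2 (base_part p)) 0 $ \<alpha> $ \<beta>
     - of_real (real CARD('d) + 2) * gCH p $ \<alpha> $ \<beta>"
proof -
  obtain c where c: "\<And>p. p \<in> CH \<Longrightarrow>
     ln (det (gCH p)) = c - of_real einstein_defect * pot (base_part p) + of_real (real CARD('d) + 2) * Phi p"
    using ln_det_gCH by blast
  define n2 where "n2 = complex_of_real (real CARD('d) + 2)"
  have bar: "wirtinger_bar \<beta> (\<lambda>q. ln (det (gCH q))) q
      = of_real (- einstein_defect) * lift_index (\<lambda>j. pot1_bar j (base_part q)) 0 \<beta> + n2 * wirtinger_bar \<beta> Phi q"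
    if q: "q \<in> CH" for q
  proof -
    have base: "base_part q \<in> \<Omega>" using q by (simp add: CH_iff)
    note w = has_wirtinger_add[OF has_wirtinger_diff[OF has_wirtinger_const has_wirtinger_cmult[OF pot_lift[OF base]]]
        has_wirtinger_cmult[OF has_wirtinger_differentiable[OF has_wirtinger_imp_differentiable[OF Phi_wirtinger[OF q]]]]]
    have "wirtinger_bar \<beta> (\<lambda>q. ln (det (gCH q))) q
        = wirtinger_bar \<beta> (\<lambda>q. c - of_real einstein_defect * pot (base_part q) + n2 * Phi q) q"
      by (rule wirtinger_cong(2)[OF open_CH q]) (simp add: c n2_def)
    also have "\<dots> = of_real (- einstein_defect) * lift_index (\<lambda>j. pot1_bar j (base_part q)) 0 \<beta> + n2 * wirtinger_bar \<beta> Phi q"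
      unfolding has_wirtinger_imp(2)[OF w] by simp
    finally show ?thesis .
  qed
  have base: "base_part p \<in> \<Omega>" using p by (simp add: CH_iff)
  obtain b where b: "has_wirtinger (\<lambda>q. lift_index (\<lambda>j. pot1_bar j (base_part q)) 0 \<beta>)
      (\<lambda>\<alpha>. option_block (pot2 (base_part p)) 0 $ \<alpha> $ \<beta>) b p"
  proof (cases \<beta>)
    case None
    have "(\<lambda>\<alpha>. option_block (pot2 (base_part p)) 0 $ \<alpha> $ None) = (\<lambda>_. 0)"
      by (auto simp: option_block_def fun_eq_iff split: option.splits)
    then show ?thesis using that[of "\<lambda>_. 0"] None has_wirtinger_const[of 0 p] by simp
  next
    case (Some j)
    obtain b where b: "has_wirtinger (pot1_bar j) (\<lambda>i. pot2 (base_part p) $ i $ j) b (base_part p)"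
      using pot1_bar_wirtinger[OF base] by blast
    show ?thesis
    proof (rule that)
      show "has_wirtinger (\<lambda>q. lift_index (\<lambda>j. pot1_bar j (base_part q)) 0 \<beta>)
          (\<lambda>\<alpha>. option_block (pot2 (base_part p)) 0 $ \<alpha> $ \<beta>) (lift_index b 0) p"
        unfolding Some lift_index_simps
        by (rule has_wirtinger_eqI[OF has_wirtinger_base_part[OF b]])
          (auto simp: option_block_def lift_index_def split: option.splits)
    qed
  qed
  note b' = Phi_bar_wirtinger(1)[OF p, of \<beta>, folded gCH_entry]
  note w = has_wirtinger_add[OF has_wirtinger_cmult[OF b, of "of_real (- einstein_defect)"] has_wirtinger_cmult[OF b', of n2]]
  have "ricci gCH p $ \<alpha> $ \<beta> = - wirtinger \<alpha> (\<lambda>q. of_real (- einstein_defect) * lift_index (\<lambda>j. pot1_bar j (base_part q)) 0 \<beta>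
        + n2 * wirtinger_bar \<beta> Phi q) p"
    unfolding ricci_def by (simp del: of_real_minus) (rule wirtinger_cong(1)[OF open_CH p bar])
  also have "\<dots> = of_real einstein_defect * option_block (pot2 (base_part p)) 0 $ \<alpha> $ \<beta> - n2 * gCH p $ \<alpha> $ \<beta>"
    unfolding has_wirtinger_imp(1)[OF w] by simp
  finally show ?thesis by (simp only: n2_def)
qed

lemma einstein_if: "einstein_defect = 0 \<Longrightarrow> kaehler_einstein CH gCH"
  unfolding kaehler_einstein_def
  by (intro exI[of _ "- (real CARD('d) + 2)"] ballI allI) (simp add: ricci_gCH algebra_simps)

definition pot2_inv :: "complex^('d option) \<Rightarrow> complex^'d^'d" where
  "pot2_inv p = matrix_inv (transpose (pot2 (base_part p)))"

lemma pot2_inv_right: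
  assumes "p \<in> CH"
  shows "(\<Sum>j\<in>UNIV. pot2_inv p $ i $ j * pot2 (base_part p) $ k $ j) = (if i = k then 1 else 0)"
proof -
  have "invertible (transpose (pot2 (base_part p)))"
    using assms pot2_invertible by (simp add: CH_iff invertible_det_nz)
  then obtain B where "B ** transpose (pot2 (base_part p)) = mat 1" unfolding invertible_def by blast
  then have "pot2_inv p ** transpose (pot2 (base_part p)) = mat 1"
    unfolding pot2_inv_def using matrix_inv_eq by metis
  then have "(pot2_inv p ** transpose (pot2 (base_part p))) $ i $ k = mat 1 $ i $ k" by simp
  then show ?thesis by (simp add: matrix_matrix_mult_def transpose_def mat_def)
qed

text \<open>The inverse of the factorization of the metric, multiplied out.\<close>

definition metric_inv :: "complex^('d option) \<Rightarrow> complex^('d option)^('d option)" where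
  "metric_inv p = (\<chi> \<alpha> \<beta>. case \<alpha> of
     Some i \<Rightarrow> (case \<beta> of Some j \<Rightarrow> fibre_gap p / fibre_radius2 p * pot2_inv p $ i $ j
                 | None \<Rightarrow> - (fibre_gap p / fibre_radius2 p) * (\<Sum>j\<in>UNIV. pot2_inv p $ i $ j * bvec p $ Some j))
   | None \<Rightarrow> (case \<beta> of Some j \<Rightarrow> - (fibre_gap p / fibre_radius2 p) * (\<Sum>i\<in>UNIV. avec p $ Some i * pot2_inv p $ i $ j)
                 | None \<Rightarrow> (fibre_gap p)\<^sup>2 / fibre_radius2 p + fibre_gap p / fibre_radius2 p * (\<Sum>i\<in>UNIV. \<Sum>j\<in>UNIV. avec p $ Some i * pot2_inv p $ i $ j * bvec p $ Some j)))"

lemma metric_inv_bvec: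
  "(\<Sum>\<beta>\<in>UNIV. metric_inv p $ \<alpha> $ \<beta> * bvec p $ \<beta>) = (if \<alpha> = None then (fibre_gap p)\<^sup>2 / fibre_radius2 p else 0)"
proof -
  have b: "bvec p $ None = 1" by (simp add: bvec_def)
  show ?thesis
  proof (cases \<alpha>)
    case None
    have "(\<Sum>j\<in>UNIV. - (fibre_gap p / fibre_radius2 p) * (\<Sum>i\<in>UNIV. avec p $ Some i * pot2_inv p $ i $ j) * bvec p $ Some j)
      = - (fibre_gap p / fibre_radius2 p) * (\<Sum>i\<in>UNIV. \<Sum>j\<in>UNIV. avec p $ Some i * pot2_inv p $ i $ j * bvec p $ Some j)"
      unfolding sum_distrib_right sum_distrib_left mult.assoc by (rule sum.swap)
    then show ?thesis unfolding sum_UNIV_option None by (simp add: metric_inv_def b)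
  next
    case (Some i)
    have "(\<Sum>j\<in>UNIV. fibre_gap p / fibre_radius2 p * pot2_inv p $ i $ j * bvec p $ Some j)
      = fibre_gap p / fibre_radius2 p * (\<Sum>j\<in>UNIV. pot2_inv p $ i $ j * bvec p $ Some j)"
      unfolding sum_distrib_left mult.assoc ..
    then show ?thesis unfolding sum_UNIV_option Some by (simp add: metric_inv_def b)
  qed
qed

lemma metric_inv_block:
  assumes p: "p \<in> CH"
  shows "(\<Sum>\<beta>\<in>UNIV. metric_inv p $ \<alpha> $ \<beta> * option_block (pot2 (base_part p)) 0 $ \<sigma> $ \<beta>)
    = fibre_gap p / fibre_radius2 p * (case \<sigma> of None \<Rightarrow> 0 | Some k \<Rightarrow>
        (case \<alpha> of None \<Rightarrow> - avec p $ Some k | Some i \<Rightarrow> if i = k then 1 else 0))"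
proof (cases \<sigma>)
  case None
  then show ?thesis by (simp add: option_block_def sum_UNIV_option)
next
  case (Some k)
  let ?B = "pot2 (base_part p)"
  show ?thesis
  proof (cases \<alpha>)
    case None
    have "(\<Sum>j\<in>UNIV. - (fibre_gap p / fibre_radius2 p) * (\<Sum>i\<in>UNIV. avec p $ Some i * pot2_inv p $ i $ j) * ?B $ k $ j)
        = - (fibre_gap p / fibre_radius2 p) * (\<Sum>i\<in>UNIV. avec p $ Some i * (\<Sum>j\<in>UNIV. pot2_inv p $ i $ j * ?B $ k $ j))"
      unfolding sum_distrib_right sum_distrib_left mult.assoc by (rule sum.swap)
    also have "\<dots> = - (fibre_gap p / fibre_radius2 p) * avec p $ Some k"
      by (simp add: pot2_inv_right[OF p] if_distrib cong: if_cong)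
    finally show ?thesis unfolding sum_UNIV_option Some None
      by (simp add: metric_inv_def option_block_def)
  next
    case (Some i)
    have "(\<Sum>j\<in>UNIV. fibre_gap p / fibre_radius2 p * pot2_inv p $ i $ j * ?B $ k $ j)
        = fibre_gap p / fibre_radius2 p * (\<Sum>j\<in>UNIV. pot2_inv p $ i $ j * ?B $ k $ j)"
      unfolding sum_distrib_left mult.assoc ..
    then show ?thesis using pot2_inv_right[OF p, of i k]
      unfolding sum_UNIV_option \<open>\<sigma> = Some k\<close> Some by (simp add: metric_inv_def option_block_def)
  qed
qed

lemma metric_inv_metric:
  assumes p: "p \<in> CH"
  shows "(\<Sum>\<beta>\<in>UNIV. metric_inv p $ \<alpha> $ \<beta> * gCH p $ \<sigma> $ \<beta>) = (if \<alpha> = \<sigma> then 1 else 0)"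
proof -
  have "(\<Sum>\<beta>\<in>UNIV. metric_inv p $ \<alpha> $ \<beta> * gCH p $ \<sigma> $ \<beta>)
      = fibre_radius2 p / fibre_gap p * (\<Sum>\<beta>\<in>UNIV. metric_inv p $ \<alpha> $ \<beta> * option_block (pot2 (base_part p)) 0 $ \<sigma> $ \<beta>)
      + fibre_radius2 p / (fibre_gap p)\<^sup>2 * avec p $ \<sigma> * (\<Sum>\<beta>\<in>UNIV. metric_inv p $ \<alpha> $ \<beta> * bvec p $ \<beta>)"
    unfolding gCH_formula[OF p] sum_distrib_left sum.distrib[symmetric]
    by (intro sum.cong) (simp_all add: algebra_simps)
  also have "\<dots> = (if \<alpha> = \<sigma> then 1 else 0)"
    unfolding metric_inv_block[OF p] metric_inv_bvec using fibre_radius2_nonzero fibre_gap_nonzero[OF p]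
    by (cases \<alpha>; cases \<sigma>) (simp_all add: avec_def)
  finally show ?thesis .
qed

lemma inverse_metric_gCH:
  assumes p: "p \<in> CH"
  shows "inverse_metric gCH p = metric_inv p"
  unfolding inverse_metric_def
proof (rule matrix_inv_eq)
  show "metric_inv p ** transpose (gCH p) = mat 1"
    using metric_inv_metric[OF p] by (simp add: vec_eq_iff matrix_matrix_mult_def transpose_def mat_def)
qed

text \<open>The trace of the pull-back of \<open>\<partial>\<partial>\<close>-bar \<open>\<phi>\<close> is \<open>d P / N\<^sup>\<mu>\<close>: only the horizontal block of the inverse metric,
  which is \<open>P / N\<^sup>\<mu>\<close> times the inverse of \<open>pot2\<close>, meets it.\<close>

lemma scalar_curvature_gCH:
  assumes p: "p \<in> CH"
  shows "scalar_curvature gCH p = of_real einstein_defect * of_nat CARD('d) * (fibre_gap p / fibre_radius2 p)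
    - of_real (real CARD('d) + 2) * (of_nat CARD('d) + 1)"
proof -
  have "scalar_curvature gCH p =
      of_real einstein_defect * (\<Sum>\<alpha>\<in>UNIV. \<Sum>\<beta>\<in>UNIV. metric_inv p $ \<alpha> $ \<beta> * option_block (pot2 (base_part p)) 0 $ \<alpha> $ \<beta>)
      - of_real (real CARD('d) + 2) * (\<Sum>\<alpha>\<in>UNIV. \<Sum>\<beta>\<in>UNIV. metric_inv p $ \<alpha> $ \<beta> * gCH p $ \<alpha> $ \<beta>)"
    unfolding scalar_curvature_def inverse_metric_gCH[OF p] ricci_gCH[OF p] sum_distrib_left sum_subtractf[symmetric]
    by (intro sum.cong) (simp_all add: algebra_simps)
  then show ?thesis
    unfolding metric_inv_block[OF p] metric_inv_metric[OF p] by (simp add: sum_UNIV_option add.commute)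
qed

lemma scalar_curvature_bar:
  assumes p: "p \<in> CH"
  shows "wirtinger_bar \<beta> (scalar_curvature gCH) p
    = - (of_real einstein_defect * of_nat CARD('d)) * (fibre_part p / fibre_radius2 p) * bvec p $ \<beta>"
proof -
  have base: "base_part p \<in> \<Omega>" using p by (simp add: CH_iff)
  have "has_wirtinger (\<lambda>q. fibre_gap q * inverse (fibre_radius2 q))
     (\<lambda>\<alpha>. lift_index (\<lambda>i. - fibre_radius2 p * pot_grad p i) (- cnj (fibre_part p)) \<alpha> * inverse (fibre_radius2 p)
        + fibre_gap p * (- lift_index (\<lambda>i. - fibre_radius2 p * pot_grad p i) 0 \<alpha> / (fibre_radius2 p)\<^sup>2))
     (\<lambda>\<beta>. lift_index (\<lambda>j. - fibre_radius2 p * pot_grad_bar p j) (- fibre_part p) \<beta> * inverse (fibre_radius2 p)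
        + fibre_gap p * (- lift_index (\<lambda>j. - fibre_radius2 p * pot_grad_bar p j) 0 \<beta> / (fibre_radius2 p)\<^sup>2)) p"
    by (rule has_wirtinger_mult[OF fibre_gap_wirtinger[OF base] has_wirtinger_inverse[OF fibre_radius2_wirtinger[OF base] fibre_radius2_nonzero]])
  from has_wirtinger_cmult[OF this, of "of_real einstein_defect * of_nat CARD('d)"]
  have w: "wirtinger_bar \<beta> (\<lambda>q. of_real einstein_defect * of_nat CARD('d) * (fibre_gap q * inverse (fibre_radius2 q))
        - of_real (real CARD('d) + 2) * (of_nat CARD('d) + 1)) p
    = of_real einstein_defect * of_nat CARD('d) * (lift_index (\<lambda>j. - fibre_radius2 p * pot_grad_bar p j) (- fibre_part p) \<beta> * inverse (fibre_radius2 p)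
        + fibre_gap p * (- lift_index (\<lambda>j. - fibre_radius2 p * pot_grad_bar p j) 0 \<beta> / (fibre_radius2 p)\<^sup>2))"
    by (subst has_wirtinger_imp(2)[OF has_wirtinger_diff[OF _ has_wirtinger_const]]) auto
  have "lift_index (\<lambda>j. - fibre_radius2 p * pot_grad_bar p j) (- fibre_part p) \<beta> * inverse (fibre_radius2 p)
        + fibre_gap p * (- lift_index (\<lambda>j. - fibre_radius2 p * pot_grad_bar p j) 0 \<beta> / (fibre_radius2 p)\<^sup>2) = - (fibre_part p / fibre_radius2 p) * bvec p $ \<beta>"
  proof (cases \<beta>)
    case None
    then show ?thesis by (simp add: bvec_def divide_inverse)
  next
    case (Some j)
    then show ?thesis using fibre_radius2_nonzero[of p]
      by (simp add: bvec_def fibre_gap_def field_simps power2_eq_square)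
  qed
  then have "wirtinger_bar \<beta> (\<lambda>q. of_real einstein_defect * of_nat CARD('d) * (fibre_gap q * inverse (fibre_radius2 q))
        - of_real (real CARD('d) + 2) * (of_nat CARD('d) + 1)) p
     = - (of_real einstein_defect * of_nat CARD('d)) * (fibre_part p / fibre_radius2 p) * bvec p $ \<beta>"
    unfolding w by simp
  moreover have "wirtinger_bar \<beta> (scalar_curvature gCH) p = wirtinger_bar \<beta> (\<lambda>q. of_real einstein_defect * of_nat CARD('d) * (fibre_gap q * inverse (fibre_radius2 q))
        - of_real (real CARD('d) + 2) * (of_nat CARD('d) + 1)) p"
    by (rule wirtinger_cong(2)[OF open_CH p]) (simp only: scalar_curvature_gCH divide_inverse)
  ultimately show ?thesis by simp
qed

text \<open>The antiholomorphic derivative of \<open>P / N\<^sup>\<mu>\<close> is a multiple of \<open>bvec\<close>, whose image under the inverse metric is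
  vertical.\<close>

lemma scalar_curvature_gradient_fibre:
  assumes p: "p \<in> CH"
  shows "(\<Sum>\<beta>\<in>UNIV. inverse_metric gCH p $ None $ \<beta> * wirtinger_bar \<beta> (scalar_curvature gCH) p)
    = - (of_real einstein_defect * of_nat CARD('d)) * fibre_part p * ((fibre_gap p * inverse (fibre_radius2 p)) * (fibre_gap p * inverse (fibre_radius2 p)))"
proof -
  have "(\<Sum>\<beta>\<in>UNIV. inverse_metric gCH p $ None $ \<beta> * wirtinger_bar \<beta> (scalar_curvature gCH) p)
      = - (of_real einstein_defect * of_nat CARD('d)) * (fibre_part p / fibre_radius2 p) * (\<Sum>\<beta>\<in>UNIV. metric_inv p $ None $ \<beta> * bvec p $ \<beta>)"
    unfolding inverse_metric_gCH[OF p] scalar_curvature_bar[OF p] sum_distrib_left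
    by (intro sum.cong) (simp_all add: mult_ac)
  then show ?thesis unfolding metric_inv_bvec using fibre_radius2_nonzero[of p]
    by (simp add: field_simps power2_eq_square)
qed

lemma CH_point_off_zero_section:
  obtains p where "p \<in> CH" "fibre_part p \<noteq> 0"
proof -
  obtain z where z: "z \<in> \<Omega>" using D_nonempty[OF base_bounded_domain] by blast
  define N where "N = generic_norm \<Omega> z powr \<mu>"
  have "complex_of_real N \<noteq> 0" unfolding N_def generic_norm_powr[OF z] by simp
  then have N: "N > 0" unfolding N_def by simp
  define p :: "complex^('d option)" where
    "p = (\<chi> \<alpha>. case \<alpha> of None \<Rightarrow> of_real (sqrt (N / 2)) | Some i \<Rightarrow> z $ i)"
  have "base_part p = z" "fibre_part p = of_real (sqrt (N / 2))"
    by (simp_all add: p_def base_part_def fibre_part_def vec_eq_iff)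
  moreover from this have "p \<in> CH" using z N by (simp add: cartan_hartogs_def N_def[symmetric])
  ultimately show ?thesis using that N by simp
qed

text \<open>The antiholomorphic fibre derivative of the gradient component is \<open>2 c d w\<^sup>2 P / (N\<^sup>\<mu>)\<^sup>2\<close>, which must vanish
  also at a point with \<open>w \<noteq> 0\<close>.\<close>

lemma einstein_if_extremal:
  assumes ext: "extremal CH gCH"
  shows "kaehler_einstein CH gCH"
proof (rule einstein_if)
  obtain p where p: "p \<in> CH" "fibre_part p \<noteq> 0" using CH_point_off_zero_section .
  have base: "base_part p \<in> \<Omega>" using p by (simp add: CH_iff)
  have "0 = wirtinger_bar None (\<lambda>q. \<Sum>\<beta>\<in>UNIV. inverse_metric gCH q $ None $ \<beta> * wirtinger_bar \<beta> (scalar_curvature gCH) q) p"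
    using ext p(1) by (simp add: extremal_def)
  also have "\<dots> = wirtinger_bar None (\<lambda>q. - (of_real einstein_defect * of_nat CARD('d)) * fibre_part q
      * ((fibre_gap q * inverse (fibre_radius2 q)) * (fibre_gap q * inverse (fibre_radius2 q)))) p"
    by (rule wirtinger_cong(2)[OF open_CH p(1) scalar_curvature_gradient_fibre])
  also have "\<dots> = - (of_real einstein_defect * of_nat CARD('d)) * fibre_part p
      * (2 * (fibre_gap p * inverse (fibre_radius2 p)) * (- fibre_part p * inverse (fibre_radius2 p)))"
  proof -
    note q = has_wirtinger_mult[OF fibre_gap_wirtinger[OF base] has_wirtinger_inverse[OF fibre_radius2_wirtinger[OF base] fibre_radius2_nonzero]]
    show ?thesis
      unfolding has_wirtinger_imp(2)[OF has_wirtinger_mult[OF has_wirtinger_cmult[OF has_wirtinger_fibre_part] has_wirtinger_mult[OF q q]]]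
      by (simp add: algebra_simps)
  qed
  finally show "einstein_defect = 0" using p(2) fibre_gap_nonzero[OF p(1)] fibre_radius2_nonzero[of p] by simp
qed

text \<open>The trace of the Einstein equation shows that the scalar curvature is constant.\<close>

lemma extremal_if_einstein:
  assumes "kaehler_einstein CH gCH"
  shows "extremal CH gCH"
proof -
  obtain l :: real where l: "\<And>p \<alpha> \<beta>. p \<in> CH \<Longrightarrow> ricci gCH p $ \<alpha> $ \<beta> = of_real l * gCH p $ \<alpha> $ \<beta>"
    using assms unfolding kaehler_einstein_def by blast
  have sc: "scalar_curvature gCH p = of_real l * (of_nat CARD('d) + 1)" if p: "p \<in> CH" for p
  proof -
    have "scalar_curvature gCH p = of_real l * (\<Sum>\<alpha>\<in>UNIV. \<Sum>\<beta>\<in>UNIV. metric_inv p $ \<alpha> $ \<beta> * gCH p $ \<alpha> $ \<beta>)"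
      unfolding scalar_curvature_def inverse_metric_gCH[OF p] l[OF p] sum_distrib_left
      by (intro sum.cong) (simp_all add: mult_ac)
    then show ?thesis unfolding metric_inv_metric[OF p] by (simp add: sum_UNIV_option)
  qed
  have const: "wirtinger_bar \<beta> f p = 0" if "p \<in> CH" "\<And>q. q \<in> CH \<Longrightarrow> f q = c" for \<beta> f c p
  proof -
    have "wirtinger_bar \<beta> f p = wirtinger_bar \<beta> (\<lambda>_. c) p"
      by (rule wirtinger_cong(2)[OF open_CH that])
    then show ?thesis using has_wirtinger_imp(2)[OF has_wirtinger_const] by metis
  qed
  show ?thesis
    unfolding extremal_def
  proof (intro ballI allI)
    fix p \<alpha> \<eta> assume p: "p \<in> CH"
    show "wirtinger_bar \<eta> (\<lambda>q. \<Sum>\<beta>\<in>UNIV. inverse_metric gCH q $ \<alpha> $ \<beta> * wirtinger_bar \<beta> (scalar_curvature gCH) q) p = 0"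
      by (rule const[OF p, where c = 0]) (simp add: const[OF _ sc])
  qed
qed

end

theorem theorem1:
  fixes \<Omega> :: "(complex^'d::finite) set" and \<mu> :: real
  assumes "irreducible_bounded_symmetric_domain \<Omega>"
    and "\<mu> > 0"
  shows "extremal (cartan_hartogs \<Omega> \<mu>) (cartan_hartogs_metric \<Omega> \<mu>) \<longleftrightarrow>
         kaehler_einstein (cartan_hartogs \<Omega> \<mu>) (cartan_hartogs_metric \<Omega> \<mu>)"
proof -
  have "bounded_symmetric_domain \<Omega>"
    using assms(1) by (simp add: irreducible_bounded_symmetric_domain_def)
  then show ?thesis
    using einstein_if_extremal extremal_if_einstein assms(2) by blast
qed

end
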